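(* For every $r\ge 0$ let $\psi_{\mathcal E}(r)\colon \mathcal W(r)\to\mathcal E(r)$ be the $\mathbb Z[\mathrm C_r]$-linear map, from the minimal complex $\mathcal W(r)$ to the arity $r$ part of the Barratt--Eccles operad $\mathcal E$, defined on basis elements by $$\psi_{\mathcal E}(r)(e_{n})=\begin{cases}\displaystyle\sum_{r_1,\dots,r_m}\big(\rho^0,\rho^{r_1},\rho^{r_1+1},\rho^{r_2},\rho^{r_2+1},\dots,\rho^{r_m},\rho^{r_m+1}\big) & n=2m,\\[2ex] \displaystyle\sum_{r_1,\dots,r_m}\big(\rho^0,\rho^1,\rho^{r_1},\rho^{r_1+1},\dots,\rho^{r_m},\rho^{r_m+1}\big) & n=2m+1,\end{cases}$$ where each sum is over all $r_1,\dots,r_m\in\{0,\dots,r-1\}$. Then the collection $\psi_{\mathcal E}=\{\psi_{\mathcal E}(r)\}_{r\ge0}$ is a morphism of $\mathrm C$-modules $\mathcal W\to\mathcal E$ (in particular each $\psi_{\mathcal E}(r)$ is a chain map) and it defines a May--Steenrod structure on the operad $\mathcal E$.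
   Context: All chain complexes are homologically graded complexes of $\mathbb Z$-modules. **Groups.** $\mathrm S_r$ is the symmetric group on $r$ elements ($\mathrm S_0$ is trivial) and $\mathrm C_r\subset \mathrm S_r$ is the cyclic subgroup of order $r$ generated by the cycle $\rho$ with $\rho(1)=2,\dots,\rho(r-1)=r,\rho(r)=1$ (for $r=0$, $\mathrm C_0$ is the trivial group and $\rho=1$). In $\mathbb Z[\mathrm C_r]$ put $T=\rho-1$ and $N=1+\rho+\cdots+\rho^{r-1}$ (the sum of all group elements; for $r=0$, $N=1$). **$\Gamma$-modules.** An $\mathrm S$-module (resp. $\mathrm C$-module) is a collection, indexed by $r\ge 0$, of chain complexes of left $\mathbb Z[\mathrm S_r]$-modules (resp. $\mathbb Z[\mathrm C_r]$-modules); morphisms are collections of equivariant chain maps. Right actions are turned into left ones using inverses. Every $\mathrm S$-module is a $\mathrm C$-module by restriction. A morphism is a quasi-isomorphism if it is one in each arity $r$. **The $\mathrm C$-module $\mathcal W$.** $\mathcal W(r)$ is concentrated in non-negative degrees, with $\mathcal W(r)_d$ the free $\mathbb Z[\mathrm C_r]$-module on one generator $e_d$ for each $d\ge0$, and differential determined by $\partial e_d=Te_{d-1}$ for $d$ odd and $\partial e_d=Ne_{d-1}$ for $d>0$ even. **$E_\infty$-operads.** An operad is an $\mathrm S$-module with the usual associative, equivariant, unital operadic compositions. An operad $\mathcal R$ is an $E_\infty$-operad if $\mathcal R(0)=\mathbb Z$ and there is a morphism of $\mathrm S$-modules $\mathcal R\to\underline{\mathbb Z}$, where $\underline{\mathbb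 Z}(r)=\mathbb Z$ with trivial action in degree $0$, such that for each $r$ the map $\mathcal R(r)\to\mathbb Z$ is a quasi-isomorphism and $\mathcal R(r)$ is a free $\mathbb Z[\mathrm S_r]$-module in each degree. **May--Steenrod structures.** A May--Steenrod structure on an operad $\mathcal O$ is a morphism of $\mathrm C$-modules $\psi\colon\mathcal W\to\mathcal O$ for which there exist an $E_\infty$-operad $\mathcal R$, a quasi-isomorphism of $\mathrm C$-modules $\iota\colon\mathcal W\to\mathcal R$ and a morphism of operads $\phi\colon\mathcal R\to\mathcal O$ with $\psi=\phi\circ\iota$. **The Barratt--Eccles operad $\mathcal E$.** For $r\ge0$ let $E(\mathrm S_r)$ be the simplicial set with $E(\mathrm S_r)_n=\{(\sigma_0,\dots,\sigma_n)\mid\sigma_i\in\mathrm S_r\}$, face maps $d_i$ deleting $\sigma_i$, degeneracy maps $s_i$ repeating $\sigma_i$, and left $\mathrm S_r$-action $\sigma(\sigma_0,\dots,\sigma_n)=(\sigma\sigma_0,\dots,\sigma\sigma_n)$. Then $\mathcal E(r)$ is the complex of normalized integral chains of $E(\mathrm S_r)$: it is generated by such tuples modulo the degenerate ones (those with $\sigma_i=\sigma_{i+1}$ for some $i$), with $\partial=\sum_i(-1)^id_i$. The operad composition of $\mathcal E$ is the standard one: the simplicial sets $E(\mathrm S_r)$ form an operad by applying the composition of the (associative) operad of symmetric groups (block permutations) levelwise, and the composition of $\mathcal E$ is induced from it using the Eilenberg--Zilber shuffle map on normalized chains. It is known that $\mathcal E$ is an $E_\infty$-operad. *)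

theory Defs
  imports
    "HOL-Algebra.Sym_Groups"
    "HOL-Algebra.Generated_Groups"
    "HOL-Algebra.Elementary_Groups"
    "HOL-Algebra.Free_Abelian_Groups"
begin

section \<open>Symmetric and cyclic groups\<close>

definition rot :: "nat \<Rightarrow> nat \<Rightarrow> nat"
  where "rot r i = (if i \<in> {1..r} then (if i = r then 1 else i + 1) else i)"

definition cyc_group :: "nat \<Rightarrow> (nat \<Rightarrow> nat) monoid"
  where "cyc_group r = subgroup_generated (sym_group r) {rot r}"

section \<open>Families of chain complexes with group actions\<close>

text \<open>
  The first index is the arity, the second one the (homological) degree. The abelian groups are
  HOL-Algebra groups, hence written multiplicatively. \<open>Act M r d g\<close> is the action of the group
  element \<open>g\<close> on the degree \<open>d\<close> part of arity \<open>r\<close>. For a family with actions of the symmetric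
  groups, restriction to the cyclic subgroups does not change the record.
\<close>

record 'a gmod =
  Grp :: "nat \<Rightarrow> int \<Rightarrow> 'a monoid"
  Bd :: "nat \<Rightarrow> int \<Rightarrow> 'a \<Rightarrow> 'a"
  Act :: "nat \<Rightarrow> int \<Rightarrow> (nat \<Rightarrow> nat) \<Rightarrow> 'a \<Rightarrow> 'a"

locale gamma_module =
  fixes \<Gamma> :: "nat \<Rightarrow> (nat \<Rightarrow> nat) monoid" and M :: "('a, 'm) gmod_scheme"
  assumes Grp_comm_group: "comm_group (Grp M r d)"
    and Bd_hom: "Bd M r d \<in> hom (Grp M r d) (Grp M r (d - 1))"
    and Bd_Bd: "x \<in> carrier (Grp M r d) \<Longrightarrow> Bd M r (d - 1) (Bd M r d x) = \<one>\<^bsub>Grp M r (d - 2)\<^esub>"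
    and Act_hom: "g \<in> carrier (\<Gamma> r) \<Longrightarrow> Act M r d g \<in> hom (Grp M r d) (Grp M r d)"
    and Act_one: "x \<in> carrier (Grp M r d) \<Longrightarrow> Act M r d \<one>\<^bsub>\<Gamma> r\<^esub> x = x"
    and Act_mult: "\<lbrakk>g \<in> carrier (\<Gamma> r); h \<in> carrier (\<Gamma> r); x \<in> carrier (Grp M r d)\<rbrakk>
      \<Longrightarrow> Act M r d (g \<otimes>\<^bsub>\<Gamma> r\<^esub> h) x = Act M r d g (Act M r d h x)"
    and Bd_Act: "\<lbrakk>g \<in> carrier (\<Gamma> r); x \<in> carrier (Grp M r d)\<rbrakk>
      \<Longrightarrow> Bd M r d (Act M r d g x) = Act M r (d - 1) g (Bd M r d x)"

locale gamma_morphism =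
  dom: gamma_module \<Gamma> M + cod: gamma_module \<Gamma> N
  for \<Gamma> :: "nat \<Rightarrow> (nat \<Rightarrow> nat) monoid"
    and M :: "('a, 'm) gmod_scheme" and N :: "('b, 'n) gmod_scheme" +
  fixes f :: "nat \<Rightarrow> int \<Rightarrow> 'a \<Rightarrow> 'b"
  assumes mor_hom: "f r d \<in> hom (Grp M r d) (Grp N r d)"
    and mor_Bd: "x \<in> carrier (Grp M r d) \<Longrightarrow> f r (d - 1) (Bd M r d x) = Bd N r d (f r d x)"
    and mor_Act: "\<lbrakk>g \<in> carrier (\<Gamma> r); x \<in> carrier (Grp M r d)\<rbrakk>
      \<Longrightarrow> f r d (Act M r d g x) = Act N r d g (f r d x)"

abbreviation S_module :: "('a, 'm) gmod_scheme \<Rightarrow> bool"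
  where "S_module \<equiv> gamma_module sym_group"

abbreviation S_morphism ::
    "('a, 'm) gmod_scheme \<Rightarrow> ('b, 'n) gmod_scheme \<Rightarrow> (nat \<Rightarrow> int \<Rightarrow> 'a \<Rightarrow> 'b) \<Rightarrow> bool"
  where "S_morphism \<equiv> gamma_morphism sym_group"

abbreviation C_morphism ::
    "('a, 'm) gmod_scheme \<Rightarrow> ('b, 'n) gmod_scheme \<Rightarrow> (nat \<Rightarrow> int \<Rightarrow> 'a \<Rightarrow> 'b) \<Rightarrow> bool"
  where "C_morphism \<equiv> gamma_morphism cyc_group"

definition cycles :: "('a, 'm) gmod_scheme \<Rightarrow> nat \<Rightarrow> int \<Rightarrow> 'a set"
  where "cycles M r d = kernel (Grp M r d) (Grp M r (d - 1)) (Bd M r d)"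

definition boundaries :: "('a, 'm) gmod_scheme \<Rightarrow> nat \<Rightarrow> int \<Rightarrow> 'a set"
  where "boundaries M r d = Bd M r (d + 1) ` carrier (Grp M r (d + 1))"

definition homology :: "('a, 'm) gmod_scheme \<Rightarrow> nat \<Rightarrow> int \<Rightarrow> 'a set monoid"
  where "homology M r d = subgroup_generated (Grp M r d) (cycles M r d) Mod boundaries M r d"

text \<open>The induced map sends the class \<open>B + x\<close> to \<open>B' + f (B + x) = B' + f x\<close>.\<close>

definition homology_map ::
    "('a, 'm) gmod_scheme \<Rightarrow> ('b, 'n) gmod_scheme \<Rightarrow> (nat \<Rightarrow> int \<Rightarrow> 'a \<Rightarrow> 'b) \<Rightarrow>
     nat \<Rightarrow> int \<Rightarrow> 'a set \<Rightarrow> 'b set"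
  where "homology_map M N f r d X = boundaries N r d <#>\<^bsub>Grp N r d\<^esub> f r d ` X"

definition quasi_iso ::
    "('a, 'm) gmod_scheme \<Rightarrow> ('b, 'n) gmod_scheme \<Rightarrow> (nat \<Rightarrow> int \<Rightarrow> 'a \<Rightarrow> 'b) \<Rightarrow> bool"
  where "quasi_iso M N f \<longleftrightarrow>
    (\<forall>r d. homology_map M N f r d \<in> iso (homology M r d) (homology N r d))"

text \<open>
  Freeness over the integral group ring of \<open>G\<close>: every element is a linear combination of elements
  of \<open>B\<close> with unique coefficients in the group ring, where the coefficient of \<open>b\<close> is
  \<open>\<Sum>g. c (g, b) g\<close>.
\<close>

definition free_group_ring_module ::
    "('g, 'k) monoid_scheme \<Rightarrow> ('a, 'm) monoid_scheme \<Rightarrow> ('g \<Rightarrow> 'a \<Rightarrow> 'a) \<Rightarrow> bool"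
  where "free_group_ring_module G A act \<longleftrightarrow>
    (\<exists>B \<subseteq> carrier A. \<forall>x \<in> carrier A. \<exists>!c :: 'g \<times> 'a \<Rightarrow>\<^sub>0 int.
       Poly_Mapping.keys c \<subseteq> carrier G \<times> B \<and>
       x = finprod A (\<lambda>(g, b). act g b [^]\<^bsub>A\<^esub> Poly_Mapping.lookup c (g, b)) (Poly_Mapping.keys c))"

section \<open>Operads\<close>

text \<open>
  Composite \<open>\<sigma> \<circ>\<^sub>k \<tau>\<close> in the operad of symmetric groups with left multiplication as action,
  where \<open>\<tau>\<close> permutes \<open>{1..s}\<close>: writing a permutation as the word of its values, the letter \<open>k\<close> of
  \<open>\<sigma>\<close> is replaced by the word \<open>\<tau>\<close> shifted by \<open>k - 1\<close>, and the letters above \<open>k\<close> are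
  shifted by \<open>s - 1\<close>.
\<close>

definition perm_comp :: "nat \<Rightarrow> nat \<Rightarrow> (nat \<Rightarrow> nat) \<Rightarrow> (nat \<Rightarrow> nat) \<Rightarrow> nat \<Rightarrow> nat"
  where "perm_comp s k \<sigma> \<tau> l =
    (let i = Hilbert_Choice.inv \<sigma> k; shift = (\<lambda>j. if j < k then j else j + s - 1)
     in if l < i then shift (\<sigma> l)
        else if l < i + s then \<tau> (l + 1 - i) + k - 1
        else shift (\<sigma> (l + 1 - s)))"

definition ksign :: "int \<Rightarrow> int"
  where "ksign d = (if even d then 1 else - 1)"

text \<open>
  Operads are given by partial compositions: \<open>Comp P r d s e k x y\<close> is \<open>x \<circ>\<^sub>k y\<close> for \<open>x\<close> of arity
  \<open>r\<close> and degree \<open>d\<close>, and \<open>y\<close> of arity \<open>s\<close> and degree \<open>e\<close>. As the symmetric groups act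
  from the left, \<open>(\<sigma> x)(a\<^sub>1, \<dots>, a\<^sub>r)\<close> is \<open>x (a\<^bsub>\<sigma> 1\<^esub>, \<dots>, a\<^bsub>\<sigma> r\<^esub>)\<close> up to Koszul sign; thus
  input \<open>k\<close> of \<open>\<sigma> x\<close> is input \<open>inv \<sigma> k\<close> of \<open>x\<close>.
\<close>

record 'a operad_data = "'a gmod" +
  Unit :: 'a
  Comp :: "nat \<Rightarrow> int \<Rightarrow> nat \<Rightarrow> int \<Rightarrow> nat \<Rightarrow> 'a \<Rightarrow> 'a \<Rightarrow> 'a"

locale operad = gamma_module sym_group P
  for P :: "('a, 'm) operad_data_scheme" +
  assumes Comp_hom_left: "\<lbrakk>k \<in> {1..r}; y \<in> carrier (Grp P s e)\<rbrakk>
      \<Longrightarrow> (\<lambda>x. Comp P r d s e k x y) \<in> hom (Grp P r d) (Grp P (r + s - 1) (d + e))"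
    and Comp_hom_right: "\<lbrakk>k \<in> {1..r}; x \<in> carrier (Grp P r d)\<rbrakk>
      \<Longrightarrow> (\<lambda>y. Comp P r d s e k x y) \<in> hom (Grp P s e) (Grp P (r + s - 1) (d + e))"
    and Comp_Bd: "\<lbrakk>k \<in> {1..r}; x \<in> carrier (Grp P r d); y \<in> carrier (Grp P s e)\<rbrakk>
      \<Longrightarrow> Bd P (r + s - 1) (d + e) (Comp P r d s e k x y) =
          Comp P r (d - 1) s e k (Bd P r d x) y
            \<otimes>\<^bsub>Grp P (r + s - 1) (d + e - 1)\<^esub>
          (Comp P r d s (e - 1) k x (Bd P s e y) [^]\<^bsub>Grp P (r + s - 1) (d + e - 1)\<^esub> ksign d)"
    and Comp_seq_assoc: "\<lbrakk>i \<in> {1..r}; j \<in> {1..s}; x \<in> carrier (Grp P r d);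
        y \<in> carrier (Grp P s e); z \<in> carrier (Grp P t f)\<rbrakk>
      \<Longrightarrow> Comp P (r + s - 1) (d + e) t f (i + j - 1) (Comp P r d s e i x y) z =
          Comp P r d (s + t - 1) (e + f) i x (Comp P s e t f j y z)"
    and Comp_par_assoc: "\<lbrakk>1 \<le> i; i < k; k \<le> r; x \<in> carrier (Grp P r d);
        y \<in> carrier (Grp P s e); z \<in> carrier (Grp P t f)\<rbrakk>
      \<Longrightarrow> Comp P (r + s - 1) (d + e) t f (k + s - 1) (Comp P r d s e i x y) z =
          Comp P (r + t - 1) (d + f) s e i (Comp P r d t f k x z) y
            [^]\<^bsub>Grp P (r + s + t - 2) (d + e + f)\<^esub> ksign (e * f)"
    and Unit_closed: "Unit P \<in> carrier (Grp P 1 0)"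
    and Bd_Unit: "Bd P 1 0 (Unit P) = \<one>\<^bsub>Grp P 1 (- 1)\<^esub>"
    and Comp_Unit_left: "x \<in> carrier (Grp P r d) \<Longrightarrow> Comp P 1 0 r d 1 (Unit P) x = x"
    and Comp_Unit_right: "\<lbrakk>k \<in> {1..r}; x \<in> carrier (Grp P r d)\<rbrakk>
      \<Longrightarrow> Comp P r d 1 0 k x (Unit P) = x"
    and Comp_Act: "\<lbrakk>k \<in> {1..r}; \<sigma> \<in> carrier (sym_group r); \<tau> \<in> carrier (sym_group s);
        x \<in> carrier (Grp P r d); y \<in> carrier (Grp P s e)\<rbrakk>
      \<Longrightarrow> Comp P r d s e k (Act P r d \<sigma> x) (Act P s e \<tau> y) =
          Act P (r + s - 1) (d + e) (perm_comp s k \<sigma> \<tau>)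
            (Comp P r d s e (Hilbert_Choice.inv \<sigma> k) x y)"

locale operad_morphism =
  dom: operad P + cod: operad Q + gamma_morphism sym_group P Q f
  for P :: "('a, 'm) operad_data_scheme" and Q :: "('b, 'n) operad_data_scheme"
    and f :: "nat \<Rightarrow> int \<Rightarrow> 'a \<Rightarrow> 'b" +
  assumes mor_Unit: "f 1 0 (Unit P) = Unit Q"
    and mor_Comp: "\<lbrakk>k \<in> {1..r}; x \<in> carrier (Grp P r d); y \<in> carrier (Grp P s e)\<rbrakk>
      \<Longrightarrow> f (r + s - 1) (d + e) (Comp P r d s e k x y) = Comp Q r d s e k (f r d x) (f s e y)"

definition const_int :: "int gmod"
  where "const_int = \<lparr>
    Grp = (\<lambda>r d. if d = 0 then integer_group else singleton_group 0),
    Bd = (\<lambda>r d x. 0),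
    Act = (\<lambda>r d g x. x)\<rparr>"

locale E_infinity_operad = operad P for P :: "('a, 'm) operad_data_scheme" +
  assumes arity_zero: "Grp P 0 0 \<cong> integer_group" "d \<noteq> 0 \<Longrightarrow> trivial_group (Grp P 0 d)"
    and free_resolution: "\<exists>\<epsilon>. S_morphism P const_int \<epsilon> \<and> quasi_iso P const_int \<epsilon> \<and>
      (\<forall>r d. free_group_ring_module (sym_group r) (Grp P r d) (Act P r d))"

section \<open>The minimal resolutions\<close>

text \<open>Integral group rings are spanned by group elements; this is their multiplication.\<close>

definition gr_mult :: "(('g \<Rightarrow> 'g) \<Rightarrow>\<^sub>0 int) \<Rightarrow> (('g \<Rightarrow> 'g) \<Rightarrow>\<^sub>0 int) \<Rightarrow> (('g \<Rightarrow> 'g) \<Rightarrow>\<^sub>0 int)"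
  where "gr_mult a b = frag_extend (\<lambda>g. frag_extend (\<lambda>h. frag_of (g \<circ> h)) b) a"

definition T_elem :: "nat \<Rightarrow> (nat \<Rightarrow> nat) \<Rightarrow>\<^sub>0 int"
  where "T_elem r = frag_of (rot r) - frag_of id"

definition N_elem :: "nat \<Rightarrow> (nat \<Rightarrow> nat) \<Rightarrow>\<^sub>0 int"
  where "N_elem r = (\<Sum>g\<in>carrier (cyc_group r). frag_of g)"

text \<open>In each degree \<open>d \<ge> 0\<close>, the element \<open>\<lambda> e\<^sub>d\<close> is represented by \<open>\<lambda>\<close> in the group ring.\<close>

definition W_module :: "((nat \<Rightarrow> nat) \<Rightarrow>\<^sub>0 int) gmod"
  where "W_module = \<lparr>
    Grp = (\<lambda>r d. free_Abelian_group (if d \<ge> 0 then carrier (cyc_group r) else {})),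
    Bd = (\<lambda>r d x. if d \<le> 0 then 0 else if odd d then gr_mult x (T_elem r) else gr_mult x (N_elem r)),
    Act = (\<lambda>r d g x. gr_mult (frag_of g) x)\<rparr>"

section \<open>May--Steenrod structures\<close>

text \<open>
  A formula cannot quantify over types, so the type of the elements of the intermediate
  \<open>E\<^sub>\<infinity>\<close>-operad is a parameter.
\<close>

definition may_steenrod_structure ::
    "'u itself \<Rightarrow> ('o, 'm) operad_data_scheme \<Rightarrow>
     (nat \<Rightarrow> int \<Rightarrow> ((nat \<Rightarrow> nat) \<Rightarrow>\<^sub>0 int) \<Rightarrow> 'o) \<Rightarrow> bool"
  where "may_steenrod_structure U P \<psi> \<longleftrightarrow>
    operad P \<and> C_morphism W_module P \<psi> \<and>
    (\<exists>(R :: 'u operad_data) \<iota> \<phi>.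
       E_infinity_operad R \<and>
       C_morphism W_module R \<iota> \<and> quasi_iso W_module R \<iota> \<and>
       operad_morphism R P \<phi> \<and>
       (\<forall>r d. \<forall>x\<in>carrier (Grp W_module r d). \<psi> r d x = \<phi> r d (\<iota> r d x)))"

section \<open>The Barratt--Eccles operad\<close>

text \<open>
  An \<open>n\<close>-simplex is a list of length \<open>n + 1\<close>. The quotient of the free abelian group on all
  simplices by the span of the degenerate ones is represented by the free abelian group on the
  nondegenerate simplices; \<open>simplex\<close> is the quotient map on generators.
  The empty list, which arises as the face of a vertex, is sent to zero.
\<close>

type_synonym be_elem = "(nat \<Rightarrow> nat) list \<Rightarrow>\<^sub>0 int"

definition nondegenerate :: "(nat \<Rightarrow> nat) list \<Rightarrow> bool"
  where "nondegenerate xs \<longleftrightarrow> xs \<noteq> [] \<and> distinct_adj xs"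

definition simplex :: "(nat \<Rightarrow> nat) list \<Rightarrow> be_elem"
  where "simplex xs = (if nondegenerate xs then frag_of xs else 0)"

definition be_basis :: "nat \<Rightarrow> int \<Rightarrow> (nat \<Rightarrow> nat) list set"
  where "be_basis r d =
    {xs. int (length xs) = d + 1 \<and> set xs \<subseteq> carrier (sym_group r) \<and> nondegenerate xs}"

definition face :: "nat \<Rightarrow> 'b list \<Rightarrow> 'b list"
  where "face i xs = take i xs @ drop (Suc i) xs"

definition be_boundary :: "be_elem \<Rightarrow> be_elem"
  where "be_boundary =
    frag_extend (\<lambda>xs. \<Sum>i<length xs. frag_cmul ((- 1) ^ i) (simplex (face i xs)))"

definition be_act :: "(nat \<Rightarrow> nat) \<Rightarrow> be_elem \<Rightarrow> be_elem"
  where "be_act g = frag_extend (\<lambda>xs. frag_of (map ((\<circ>) g) xs))"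

text \<open>
  A \<open>(p, q)\<close>-shuffle is encoded by the set \<open>A \<subseteq> {..<p + q}\<close> of size \<open>p\<close> of the steps at which the
  first coordinate advances; its sign counts the inversions. In the corresponding simplex of the
  product, the coordinates of vertex \<open>t\<close> are the vertices of the two factors indexed by the numbers
  of steps before \<open>t\<close> in \<open>A\<close> and outside \<open>A\<close>, and these are composed by \<open>perm_comp\<close>.
\<close>

definition shuffle_sets :: "nat \<Rightarrow> nat \<Rightarrow> nat set set"
  where "shuffle_sets p q = {A. A \<subseteq> {..<p + q} \<and> card A = p}"

definition shuffle_sign :: "nat \<Rightarrow> nat \<Rightarrow> nat set \<Rightarrow> int"
  where "shuffle_sign p q A = (- 1) ^ card {(a, b). a \<in> A \<and> b \<in> {..<p + q} - A \<and> b < a}"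

definition be_comp_simplex :: "nat \<Rightarrow> nat \<Rightarrow> (nat \<Rightarrow> nat) list \<Rightarrow> (nat \<Rightarrow> nat) list \<Rightarrow> be_elem"
  where "be_comp_simplex s k xs ys =
    (let p = length xs - 1; q = length ys - 1 in
     \<Sum>A\<in>shuffle_sets p q. frag_cmul (shuffle_sign p q A)
       (simplex (map (\<lambda>t. perm_comp s k (xs ! card ({..<t} \<inter> A)) (ys ! card ({..<t} - A)))
                     [0..<p + q + 1])))"

definition be_comp :: "nat \<Rightarrow> nat \<Rightarrow> be_elem \<Rightarrow> be_elem \<Rightarrow> be_elem"
  where "be_comp s k x y =
    frag_extend (\<lambda>xs. frag_extend (\<lambda>ys. be_comp_simplex s k xs ys) y) x"

definition barratt_eccles :: "be_elem operad_data"
  where "barratt_eccles = \<lparr>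
    Grp = (\<lambda>r d. free_Abelian_group (be_basis r d)),
    Bd = (\<lambda>r d. be_boundary),
    Act = (\<lambda>r d. be_act),
    Unit = frag_of [id],
    Comp = (\<lambda>r d s e k. be_comp s k)\<rparr>"

section \<open>The morphism into the Barratt--Eccles operad\<close>

definition psi_tuple :: "nat \<Rightarrow> nat \<Rightarrow> nat list \<Rightarrow> (nat \<Rightarrow> nat) list"
  where "psi_tuple r n js =
    (if even n then [rot r ^^ 0] else [rot r ^^ 0, rot r ^^ 1]) @
    concat (map (\<lambda>j. [rot r ^^ j, rot r ^^ (j + 1)]) js)"

definition psi_gen :: "nat \<Rightarrow> nat \<Rightarrow> be_elem"
  where "psi_gen r n =
    (\<Sum>js\<in>{js. length js = n div 2 \<and> set js \<subseteq> {..<r}}. simplex (psi_tuple r n js))"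

text \<open>The \<open>\<int>[C\<^sub>r]\<close>-linear extension of \<open>e\<^sub>d \<mapsto> psi_gen r d\<close>; only degrees \<open>d \<ge> 0\<close> matter.\<close>

definition psi_BE :: "nat \<Rightarrow> int \<Rightarrow> ((nat \<Rightarrow> nat) \<Rightarrow>\<^sub>0 int) \<Rightarrow> be_elem"
  where "psi_BE r d = frag_extend (\<lambda>g. be_act g (psi_gen r (nat d)))"

end

theory Submission
  imports Defs
begin

text \<open>
  The Barratt--Eccles operad \<open>\<E>\<close> can itself serve as the intermediate \<open>E\<^sub>\<infinity>\<close>-operad, with the identity
  as morphism of operads. Four things then have to be shown: \<open>\<E>\<close> is an operad, it is \<open>E\<^sub>\<infinity>\<close>, the map
  \<open>\<psi>\<close> is a morphism of cyclic modules, and \<open>\<psi>\<close> is a quasi-isomorphism.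

  A composition in \<open>\<E>\<close> is a shuffle product of two simplices, evaluated vertexwise by the
  composition of permutations, and then normalised. The sum over shuffles obeys a recursion on the first
  step of the lattice path (\<open>ez_list\<close>, \<open>ez_list_eq_sum_shuffles\<close>). On the unnormalised chains, augmented
  by the empty simplex in degree \<open>-1\<close>, the boundary satisfies \<open>\<partial>(v a) = a - v (\<partial> a)\<close>, where \<open>v a\<close>
  puts the vertex \<open>v\<close> in front of \<open>a\<close>. With these two recursions the Leibniz rule, associativity and
  graded commutativity of the shuffle product are direct inductions (\<open>aug_bd_ez_list\<close>, \<open>ez_list_assoc\<close>,
  \<open>ez_list_commute\<close>). The results descend to normalised chains because boundaries and shuffle products
  of degenerate simplices are combinations of degenerate ones. What is left of the axioms are
  identities between permutations (\<open>perm_comp_comp\<close>, \<open>perm_comp_seq_assoc\<close>, \<open>perm_comp_par_assoc\<close>).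

  As for \<open>E\<^sub>\<infinity>\<close>, the simplices that start with the identity form a basis over the group ring, and
  putting the identity in front of a simplex contracts the complex (\<open>free_barratt_eccles\<close>, \<open>barratt_eccles_exact\<close>).

  For \<open>\<psi>\<close> to be a chain map, strip the leading vertices \<open>1\<close> or \<open>1, \<rho>\<close> from the tuples that define \<open>\<psi>(e\<^sub>n)\<close>, and
  let \<open>t\<^sub>m\<close> be the sum over \<open>r\<^sub>1, \<dots>, r\<^sub>m\<close> of the remaining tuples
  \<open>(\<rho>\<^bsup>r\<^sub>1\<^esup>, \<rho>\<^bsup>r\<^sub>1+1\<^esup>, \<dots>)\<close>. It is invariant under \<open>\<rho>\<close>, and \<open>\<partial> t\<^sub>m = 0\<close>, since deleting either
  vertex of a pair \<open>\<rho>\<^sup>j, \<rho>\<^bsup>j+1\<^esup>\<close> gives opposite sums. Hence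
  \<open>\<partial> \<psi>(e\<^bsub>2m\<^esub>) = t\<^sub>m = N \<psi>(e\<^bsub>2m-1\<^esub>)\<close> for \<open>m > 0\<close>, and \<open>\<partial> \<psi>(e\<^bsub>2m+1\<^esub>) = \<rho> t\<^sub>m - 1 t\<^sub>m = T \<psi>(e\<^bsub>2m\<^esub>)\<close>.

  Finally, \<open>\<psi>\<close> is a quasi-isomorphism because both \<open>\<W>(r)\<close> and \<open>\<E>(r)\<close> have the homology of a point, detected by the sum of
  the coefficients in degree \<open>0\<close>, and \<open>\<psi>\<close> preserves this sum.
\<close>

section \<open>Linear extension on free abelian groups\<close>

abbreviation keys :: "('a \<Rightarrow>\<^sub>0 int) \<Rightarrow> 'a set" where "keys \<equiv> Poly_Mapping.keys"
abbreviation lookup :: "('a \<Rightarrow>\<^sub>0 int) \<Rightarrow> 'a \<Rightarrow> int" where "lookup \<equiv> Poly_Mapping.lookup"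

lemma frag_extend_frag_extend:
  "frag_extend f (frag_extend g x) = frag_extend (\<lambda>i. frag_extend f (g i)) x"
  by (rule frag_induction[where S = UNIV]) (auto simp: frag_extend_diff)

lemma frag_extend_linear:
  "frag_extend (\<lambda>i. f i + g i) x = frag_extend f x + frag_extend g x"
  "frag_extend (\<lambda>i. f i - g i) x = frag_extend f x - frag_extend g x"
  "frag_extend (\<lambda>i. frag_cmul c (f i)) x = frag_cmul c (frag_extend f x)"
  "frag_extend (\<lambda>i. 0) x = 0"
  by (rule frag_induction[where S = UNIV and c = x];
      auto simp: frag_extend_diff frag_cmul_distrib2 algebra_simps frag_cmul_sum
        poly_mapping_eq_iff fun_eq_iff lookup_minus)+

lemma frag_cmul_diff: "frag_cmul c (a - b) = frag_cmul c a - frag_cmul c b"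
  by (simp add: poly_mapping_eq_iff fun_eq_iff lookup_minus algebra_simps)

section \<open>The shuffle product on unnormalised chains\<close>

definition prepend :: "'a \<Rightarrow> ('a list \<Rightarrow>\<^sub>0 int) \<Rightarrow> 'a list \<Rightarrow>\<^sub>0 int"
  where "prepend v = frag_extend (\<lambda>xs. frag_of (v # xs))"

lemma prepend_simps [simp]:
  "prepend v 0 = 0" "prepend v (a + b) = prepend v a + prepend v b" "prepend v (a - b) = prepend v a - prepend v b"
  "prepend v (- a) = - prepend v a" "prepend v (frag_cmul n a) = frag_cmul n (prepend v a)"
  "prepend v (frag_of xs) = frag_of (v # xs)"
  by (auto simp: prepend_def frag_extend_add frag_extend_diff frag_extend_minus frag_extend_cmul)

lemma prepend_sum: "prepend v (sum g I) = (\<Sum>i\<in>I. prepend v (g i))"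
  by (induction I rule: infinite_finite_induct) auto

lemma keys_prepend: "keys (prepend v a) \<subseteq> (#) v ` keys a"
  unfolding prepend_def by (rule order_trans[OF keys_frag_extend]) auto

text \<open>
  The complex is augmented: the face of a vertex is the empty simplex, of degree \<open>-1\<close>. This gives the
  boundary a recursion without an exceptional case at vertices. Discarding the empty simplex afterwards
  gives back the boundary of the Barratt--Eccles complexes.
\<close>

fun aug_bd_list :: "'a list \<Rightarrow> 'a list \<Rightarrow>\<^sub>0 int" where
  "aug_bd_list [] = 0"
| "aug_bd_list (x # xs) = frag_of xs - prepend x (aug_bd_list xs)"

definition aug_bd :: "('a list \<Rightarrow>\<^sub>0 int) \<Rightarrow> 'a list \<Rightarrow>\<^sub>0 int"
  where "aug_bd = frag_extend aug_bd_list"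

lemma aug_bd_simps [simp]:
  "aug_bd 0 = 0" "aug_bd (a + b) = aug_bd a + aug_bd b" "aug_bd (a - b) = aug_bd a - aug_bd b"
  "aug_bd (- a) = - aug_bd a" "aug_bd (frag_cmul n a) = frag_cmul n (aug_bd a)"
  "aug_bd (frag_of xs) = aug_bd_list xs"
  by (auto simp: aug_bd_def frag_extend_add frag_extend_diff frag_extend_minus frag_extend_cmul)

lemma aug_bd_prepend [simp]: "aug_bd (prepend v a) = a - prepend v (aug_bd a)"
  by (rule frag_induction[where S = UNIV and c = a]) (auto simp: algebra_simps)

lemma aug_bd_list_aug_bd [simp]: "aug_bd (aug_bd_list xs) = 0"
  by (induction xs) auto

lemma aug_bd_aug_bd [simp]: "aug_bd (aug_bd a) = 0"
  by (rule frag_induction[where S = UNIV and c = a]) auto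

lemma aug_bd_list_eq_sum:
  "aug_bd_list xs = (\<Sum>i<length xs. frag_cmul ((- 1) ^ i) (frag_of (face i xs)))"
proof (induction xs)
  case (Cons x xs)
  have "(\<Sum>i<length (x # xs). frag_cmul ((- 1) ^ i) (frag_of (face i (x # xs)))) =
        frag_of xs + (\<Sum>i<length xs. frag_cmul ((- 1) ^ Suc i) (frag_of (face (Suc i) (x # xs))))"
    by (simp add: sum.lessThan_Suc_shift face_def del: sum.lessThan_Suc)
  also have "(\<Sum>i<length xs. frag_cmul ((- 1) ^ Suc i) (frag_of (face (Suc i) (x # xs)))) =
      - prepend x (aug_bd_list xs)"
    unfolding Cons prepend_sum by (simp add: face_def flip: sum_negf)
  finally show ?case by simp
qed simp

lemma keys_aug_bd_list:
  "keys (aug_bd_list xs) \<subseteq> {ys. Suc (length ys) = length xs \<and> set ys \<subseteq> set xs}"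
proof (induction xs)
  case (Cons x xs)
  have "keys (aug_bd_list (x # xs)) \<subseteq> {xs} \<union> (#) x ` keys (aug_bd_list xs)"
    using keys_diff[of "frag_of xs" "prepend x (aug_bd_list xs)"] keys_prepend[of x "aug_bd_list xs"]
    by auto
  with Cons show ?case by fastforce
qed simp

lemma lookup_aug_bd_list_Nil:
  "lookup (aug_bd_list xs) [] = (if length xs = 1 then 1 else 0)"
proof (cases "length xs = 1")
  case True
  then show ?thesis by (cases xs) auto
next
  case False
  then have "[] \<notin> keys (aug_bd_list xs)" using keys_aug_bd_list[of xs] by fastforce
  then show ?thesis using False by (simp add: in_keys_iff)
qed

lemma keys_add_cmul_If:
  "keys (a + frag_cmul c b + (if P then frag_of z else 0)) \<subseteq>
    keys a \<union> keys b \<union> (if P then {z} else {})"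
  using keys_add[of "a + frag_cmul c b" "frag_of z"] keys_add[of a "frag_cmul c b"] keys_cmul[of c b]
  by auto

text \<open>
  The shuffle product, by recursion on the first step of the lattice path. A first step in the first
  factor carries no sign; a first step in the second factor passes the \<open>length xs\<close> steps that the first
  factor still has to make. The last summand is the end of the path, where both factors are at their last
  vertex. The function \<open>f\<close> labels the lattice points, which allows to evaluate a composition vertexwise
  without building simplices of pairs. Products with the empty simplex vanish.
\<close>

fun ez_list :: "('a \<Rightarrow> 'b \<Rightarrow> 'c) \<Rightarrow> 'a list \<Rightarrow> 'b list \<Rightarrow> 'c list \<Rightarrow>\<^sub>0 int" where
  "ez_list f [] ys = 0"
| "ez_list f (x # xs) [] = 0"
| "ez_list f (x # xs) (y # ys) = prepend (f x y)
    (ez_list f xs (y # ys) + frag_cmul ((- 1) ^ length xs) (ez_list f (x # xs) ys)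
      + (if xs = [] \<and> ys = [] then frag_of [] else 0))"

definition ez :: "('a \<Rightarrow> 'b \<Rightarrow> 'c) \<Rightarrow> ('a list \<Rightarrow>\<^sub>0 int) \<Rightarrow> ('b list \<Rightarrow>\<^sub>0 int) \<Rightarrow> 'c list \<Rightarrow>\<^sub>0 int"
  where "ez f a b = frag_extend (\<lambda>xs. frag_extend (ez_list f xs) b) a"

lemma ez_list_Nil2 [simp]: "ez_list f xs [] = 0"
  by (cases xs) auto

lemma ez_simps [simp]:
  "ez f 0 b = 0" "ez f a 0 = 0"
  "ez f (a + a') b = ez f a b + ez f a' b" "ez f a (b + b') = ez f a b + ez f a b'"
  "ez f (a - a') b = ez f a b - ez f a' b" "ez f a (b - b') = ez f a b - ez f a b'"
  "ez f (- a) b = - ez f a b" "ez f a (- b) = - ez f a b"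
  "ez f (frag_cmul n a) b = frag_cmul n (ez f a b)" "ez f a (frag_cmul n b) = frag_cmul n (ez f a b)"
  "ez f (frag_of xs) (frag_of ys) = ez_list f xs ys"
  using frag_extend_linear(3)[of "-1"]
  by (auto simp: ez_def frag_extend_add frag_extend_diff frag_extend_minus frag_extend_cmul
       frag_extend_linear)

lemma ez_Nil [simp]: "ez f (frag_of []) b = 0" "ez f a (frag_of []) = 0"
  by (auto simp: ez_def intro!: frag_extend_eq_0)

lemma keys_ez_list:
  "keys (ez_list f xs ys) \<subseteq>
    {zs. Suc (length zs) = length xs + length ys \<and> set zs \<subseteq> {f x y |x y. x \<in> set xs \<and> y \<in> set ys}}"
proof (induction f xs ys rule: ez_list.induct)
  case (3 f x xs y ys)
  let ?b = "ez_list f xs (y # ys) + frag_cmul ((- 1) ^ length xs) (ez_list f (x # xs) ys)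
      + (if xs = [] \<and> ys = [] then frag_of [] else 0)"
  have "keys ?b \<subseteq> {zs. length zs = length xs + length ys \<and>
     set zs \<subseteq> {f a b |a b. a \<in> set (x # xs) \<and> b \<in> set (y # ys)}}" (is "_ \<subseteq> ?S")
  proof (intro order_trans[OF keys_add_cmul_If] Un_least)
    show "keys (ez_list f xs (y # ys)) \<subseteq> ?S" using "3.IH"(1) by fastforce
    show "keys (ez_list f (x # xs) ys) \<subseteq> ?S" using "3.IH"(2) by fastforce
  qed auto
  then have "(#) (f x y) ` keys ?b \<subseteq> (#) (f x y) ` ?S"
    by (rule image_mono)
  also have "\<dots> \<subseteq> {zs. Suc (length zs) = length (x # xs) + length (y # ys) \<and>
     set zs \<subseteq> {f a b |a b. a \<in> set (x # xs) \<and> b \<in> set (y # ys)}}"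
    by (intro image_subsetI) (simp; blast)
  finally show ?case using keys_prepend[of "f x y" ?b] by (simp only: ez_list.simps)
qed auto

lemma lookup_ez_list_Nil [simp]: "lookup (ez_list f xs ys) [] = 0"
proof -
  have "[] \<notin> keys (ez_list f xs ys)"
  proof
    assume "[] \<in> keys (ez_list f xs ys)"
    then have "length xs + length ys = 1" using keys_ez_list[of f xs ys] by auto
    with \<open>[] \<in> keys (ez_list f xs ys)\<close> show False by (cases xs; cases ys) auto
  qed
  then show ?thesis by (simp add: in_keys_iff)
qed

text \<open>
  The recursion of \<open>ez_list\<close>, extended to chains in one factor. The last summand belongs to the empty
  simplex in that chain, which becomes a vertex by prepending.
\<close>

lemma ez_prepend_right:
  "ez f (frag_of (x # xs)) (prepend w b) = prepend (f x w)
    (ez f (frag_of xs) (prepend w b) + frag_cmul ((- 1) ^ length xs) (ez f (frag_of (x # xs)) b)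
      + (if xs = [] then frag_cmul (lookup b []) (frag_of []) else 0))"
  by (rule frag_induction[where S = UNIV and c = b])
    (auto simp: algebra_simps frag_cmul_diff lookup_minus frag_cmul_diff_distrib)

lemma ez_prepend_left:
  assumes "keys a \<subseteq> {xs. length xs = m}"
  shows "ez f (prepend v a) (frag_of (z # zs)) = prepend (f v z)
    (ez f a (frag_of (z # zs)) + frag_cmul ((- 1) ^ m) (ez f (prepend v a) (frag_of zs))
      + (if zs = [] then frag_cmul (lookup a []) (frag_of []) else 0))"
  using assms
  by (induction rule: frag_induction)
    (auto simp: algebra_simps frag_cmul_diff lookup_minus frag_cmul_diff_distrib)

text \<open>
  The Leibniz rule. Write \<open>X = x xs\<close> and \<open>Y = y ys\<close>. Expanding both sides with the two recursions, the
  terms that start with \<open>(x, y)\<close> agree by induction once the two occurrences of \<open>xs \<times> ys\<close> cancel: one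
  comes from \<open>xs \<times> \<partial> Y\<close> and the other from \<open>\<partial> X \<times> ys\<close>, with opposite signs. The extra summand reflects
  that the product of two vertices is a vertex, with the empty simplex as its face, whereas products with
  the empty simplex vanish.
\<close>

lemma aug_bd_ez_list:
  "aug_bd (ez_list f xs ys) = ez f (aug_bd_list xs) (frag_of ys)
     - frag_cmul ((- 1) ^ length xs) (ez f (frag_of xs) (aug_bd_list ys))
     + (if length xs = 1 \<and> length ys = 1 then frag_of [] else 0)"
proof (induction f xs ys rule: ez_list.induct)
  case (3 f x xs y ys)
  let ?d = "if length xs = 1 then frag_of [] else 0 :: 'c list \<Rightarrow>\<^sub>0 int"
  have l: "ez f (prepend x (aug_bd_list xs)) (frag_of (y # ys)) = prepend (f x y)
    (ez f (aug_bd_list xs) (frag_of (y # ys)) 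
      - frag_cmul ((- 1) ^ length xs) (ez f (prepend x (aug_bd_list xs)) (frag_of ys))
      + (if ys = [] \<and> length xs = 1 then frag_of [] else 0))"
  proof (cases "length xs")
    case (Suc m)
    then have "keys (aug_bd_list xs) \<subseteq> {l. length l = m}"
      using keys_aug_bd_list[of xs] by auto
    from ez_prepend_left[OF this, of f x y ys] show ?thesis
      by (simp add: lookup_aug_bd_list_Nil Suc)
  qed simp
  have r: "ez f (frag_of (x # xs)) (prepend y (aug_bd_list ys)) = prepend (f x y)
    (ez f (frag_of xs) (prepend y (aug_bd_list ys))
      + frag_cmul ((- 1) ^ length xs) (ez f (frag_of (x # xs)) (aug_bd_list ys))
      + (if xs = [] \<and> length ys = 1 then frag_of [] else 0))"
    by (simp add: ez_prepend_right lookup_aug_bd_list_Nil)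
  have 1: "aug_bd (ez_list f xs (y # ys)) = ez f (aug_bd_list xs) (frag_of (y # ys))
      - frag_cmul ((- 1) ^ length xs) (ez_list f xs ys - ez f (frag_of xs) (prepend y (aug_bd_list ys)))
      + (if length xs = 1 \<and> ys = [] then frag_of [] else 0)"
    using "3.IH"(1) by simp
  have 2: "aug_bd (ez_list f (x # xs) ys) =
      ez_list f xs ys - ez f (prepend x (aug_bd_list xs)) (frag_of ys)
      + frag_cmul ((- 1) ^ length xs) (ez f (frag_of (x # xs)) (aug_bd_list ys))
      + (if xs = [] \<and> length ys = 1 then frag_of [] else 0)"
    using "3.IH"(2) by simp
  show ?case
    using 1 2 l r
    by (cases "even (length xs)"; cases "xs = []"; cases "ys = []") simp_all
qed auto

text \<open>
  Both sides run over the lattice paths in a three-dimensional grid, with the same signs. In the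
  induction, the facts \<open>i1\<close>, \<open>i2\<close>, \<open>i3\<close> belong to a first step in \<open>xs\<close>, \<open>ys\<close> and \<open>zs\<close>.
\<close>

lemma ez_list_assoc:
  assumes "\<And>x y z. \<lbrakk>x \<in> set xs; y \<in> set ys; z \<in> set zs\<rbrakk> \<Longrightarrow> f (g x y) z = f' x (g' y z)"
  shows "ez f (ez_list g xs ys) (frag_of zs) = ez f' (frag_of xs) (ez_list g' ys zs)"
  using assms
proof (induction "length xs + length ys + length zs" arbitrary: xs ys zs rule: less_induct)
  case less
  show ?case
  proof (cases "xs = [] \<or> ys = [] \<or> zs = []")
    case False
    then obtain x xs' y ys' z zs' where eq: "xs = x # xs'" "ys = y # ys'" "zs = z # zs'"
      by (metis list.exhaust)
    let ?A = "ez_list g xs' (y # ys') + frag_cmul ((- 1) ^ length xs') (ez_list g (x # xs') ys')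
      + (if xs' = [] \<and> ys' = [] then frag_of [] else 0)"
    let ?B = "ez_list g' ys' (z # zs') + frag_cmul ((- 1) ^ length ys') (ez_list g' (y # ys') zs')
      + (if ys' = [] \<and> zs' = [] then frag_of [] else 0)"
    have i1: "ez f (ez_list g xs' (y # ys')) (frag_of (z # zs')) = ez f' (frag_of xs') (prepend (g' y z) ?B)"
      using less.hyps[of xs' ys zs] less.prems by (simp add: eq)
    have i2: "ez f (ez_list g (x # xs') ys') (frag_of (z # zs')) = ez f' (frag_of (x # xs')) (ez_list g' ys' (z # zs'))"
      using less.hyps[of xs ys' zs] less.prems by (simp add: eq)
    have i3: "ez f (prepend (g x y) ?A) (frag_of zs') = ez f' (frag_of (x # xs')) (ez_list g' (y # ys') zs')"
      using less.hyps[of xs ys zs'] less.prems by (simp add: eq)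
    have A: "keys ?A \<subseteq> {l. length l = length xs' + length ys'}"
    proof (intro order_trans[OF keys_add_cmul_If] Un_least)
      show "keys (ez_list g xs' (y # ys')) \<subseteq> {l. length l = length xs' + length ys'}"
        using keys_ez_list[of g xs' "y # ys'"] by auto
      show "keys (ez_list g (x # xs') ys') \<subseteq> {l. length l = length xs' + length ys'}"
        using keys_ez_list[of g "x # xs'" ys'] by auto
    qed auto
    have lk: "lookup ?A [] = (if xs' = [] \<and> ys' = [] then 1 else 0)"
       "lookup ?B [] = (if ys' = [] \<and> zs' = [] then 1 else 0)"
      by (simp_all add: lookup_add)
    have "ez f (ez_list g xs ys) (frag_of zs) = ez f (prepend (g x y) ?A) (frag_of (z # zs'))"
      by (simp add: eq)
    also have "\<dots> = prepend (f (g x y) z) (ez f ?A (frag_of (z # zs'))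
          + frag_cmul ((- 1) ^ (length xs' + length ys')) (ez f (prepend (g x y) ?A) (frag_of zs'))
          + (if zs' = [] then frag_cmul (lookup ?A []) (frag_of []) else 0))"
      by (rule ez_prepend_left[OF A])
    also have "\<dots> = prepend (f' x (g' y z)) (ez f' (frag_of xs') (prepend (g' y z) ?B)
       + frag_cmul ((- 1) ^ length xs') (ez f' (frag_of (x # xs')) ?B)
       + (if xs' = [] then frag_cmul (lookup ?B []) (frag_of []) else 0))"
      unfolding i3 lk using less.prems[of x y z] i1 i2
      by (auto simp: eq power_add frag_cmul_distrib2 add_ac)
    also have "\<dots> = ez f' (frag_of (x # xs')) (prepend (g' y z) ?B)"
      by (rule ez_prepend_right[symmetric])
    also have "\<dots> = ez f' (frag_of xs) (ez_list g' ys zs)"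
      by (simp add: eq)
    finally show ?thesis .
  qed auto
qed

lemma ez_list_commute:
  assumes "\<And>x y. \<lbrakk>x \<in> set xs; y \<in> set ys\<rbrakk> \<Longrightarrow> f x y = g y x"
  shows "ez_list f xs ys =
     frag_cmul ((- 1) ^ ((length xs - 1) * (length ys - 1))) (ez_list g ys xs)"
  using assms
proof (induction f xs ys rule: ez_list.induct)
  case (3 f x xs y ys)
  have "ez_list f xs (y # ys) = frag_cmul ((- 1) ^ ((length xs - 1) * length ys)) (ez_list g (y # ys) xs)"
    using "3.IH"(1) "3.prems" by simp
  moreover have "ez_list f (x # xs) ys = frag_cmul ((- 1) ^ (length xs * (length ys - 1))) (ez_list g ys (x # xs))"
    using "3.IH"(2) "3.prems" by simp
  moreover have "f x y = g y x" using "3.prems" by simp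
  ultimately show ?case
    by (cases "even (length xs)"; cases "even (length ys)"; cases xs; cases ys) simp_all
qed auto

section \<open>Shuffles as lattice paths\<close>

text \<open>
  The path starts with a step in the first factor iff \<open>0 \<in> A\<close>. The remaining steps form a shuffle
  whose positions are shifted by one.
\<close>

lemma shuffle_sets_split:
  assumes "p \<noteq> 0 \<or> q \<noteq> 0"
  shows "shuffle_sets p q =
    (if p = 0 then {} else (\<lambda>A. insert 0 (Suc ` A)) ` shuffle_sets (p - 1) q) \<union>
    (if q = 0 then {} else (\<lambda>A. Suc ` A) ` shuffle_sets p (q - 1))" (is "_ = ?L \<union> ?R")
proof (intro equalityI subsetI)
  fix A assume "A \<in> shuffle_sets p q"
  then have A: "A \<subseteq> {..<p + q}" "card A = p" by (auto simp: shuffle_sets_def)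
  then have fin: "finite A" using finite_subset by blast
  define B where "B = {a. Suc a \<in> A}"
  have SB: "Suc ` B = A - {0}"
    unfolding B_def by (auto simp: image_iff) (metis not0_implies_Suc)
  have cB: "card B = card (A - {0})"
    unfolding SB[symmetric] by (simp add: card_image)
  have B: "b < p + q - 1" if "b \<in> B" for b
    using that A(1) unfolding B_def by fastforce
  show "A \<in> ?L \<union> ?R"
  proof (cases "0 \<in> A")
    case True
    then have p: "p \<noteq> 0" using A fin by (auto simp: card_gt_0_iff)
    have "card B = p - 1" using cB A(2) True fin by simp
    moreover have "B \<subseteq> {..<p - 1 + q}" using B p by fastforce
    ultimately have "B \<in> shuffle_sets (p - 1) q" by (simp add: shuffle_sets_def)
    moreover have "A = insert 0 (Suc ` B)" using SB True by blast
    ultimately show ?thesis using p by auto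
  next
    case False
    then have A': "A = Suc ` B" using SB by simp
    have cB': "card B = p" using cB A(2) False by simp
    have "card B \<le> card {..<p + q - 1}" using B by (intro card_mono) auto
    then have q: "q \<noteq> 0" using cB' assms by auto
    then have "B \<in> shuffle_sets p (q - 1)" using cB' B by (fastforce simp: shuffle_sets_def)
    then show ?thesis using q A' by auto
  qed
next
  fix A assume "A \<in> ?L \<union> ?R"
  then consider B where "p \<noteq> 0" "A = insert 0 (Suc ` B)" "B \<in> shuffle_sets (p - 1) q"
    | B where "q \<noteq> 0" "A = Suc ` B" "B \<in> shuffle_sets p (q - 1)"
    by (auto split: if_splits)
  then show "A \<in> shuffle_sets p q"
  proof cases
    case 1
    then have "finite B" using finite_subset by (auto simp: shuffle_sets_def)
    then show ?thesis using 1 by (fastforce simp: shuffle_sets_def card_image card_insert_if)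
  next
    case 2
    then show ?thesis by (fastforce simp: shuffle_sets_def card_image)
  qed
qed

lemma finite_shuffle_sets [simp]: "finite (shuffle_sets p q)"
  unfolding shuffle_sets_def by (rule finite_subset[of _ "Pow {..<p + q}"]) auto

lemma sum_shuffle_sets:
  fixes g :: "nat set \<Rightarrow> 'a :: comm_monoid_add"
  assumes "p \<noteq> 0 \<or> q \<noteq> 0"
  shows "sum g (shuffle_sets p q) =
    (if p = 0 then 0 else \<Sum>A\<in>shuffle_sets (p - 1) q. g (insert 0 (Suc ` A))) +
    (if q = 0 then 0 else \<Sum>A\<in>shuffle_sets p (q - 1). g (Suc ` A))"
proof -
  have inj: "inj_on (\<lambda>A. insert 0 (Suc ` A)) S" "inj_on (\<lambda>A. Suc ` A) S" for S
    by (auto simp: inj_on_def)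
  show ?thesis
    unfolding shuffle_sets_split[OF assms]
    by (subst sum.union_disjoint) (auto simp: sum.reindex inj)
qed

text \<open>
  A first step in the first factor is part of no inversion; a first step in the second factor is part
  of one inversion with each of the \<open>p\<close> steps in the first factor.
\<close>

lemma shuffle_sign_step:
  assumes "A \<in> shuffle_sets p q"
  shows "shuffle_sign (Suc p) q (insert 0 (Suc ` A)) = shuffle_sign p q A"
    and "shuffle_sign p (Suc q) (Suc ` A) = (- 1) ^ p * shuffle_sign p q A"
proof -
  let ?I = "{(a, b). a \<in> A \<and> b \<in> {..<p + q} - A \<and> b < a}"
  have A: "A \<subseteq> {..<p + q}" "card A = p" "finite A"
    using assms finite_subset by (auto simp: shuffle_sets_def)
  have fin: "finite ?I"
    by (rule finite_subset[of _ "A \<times> {..<p + q}"]) (use A in auto)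
  have inj: "inj_on (map_prod Suc Suc) S" for S
    by (auto simp: inj_on_def)
  have "{(a, b). a \<in> insert 0 (Suc ` A) \<and> b \<in> {..<Suc p + q} - insert 0 (Suc ` A) \<and> b < a} =
      map_prod Suc Suc ` ?I"
  proof (intro equalityI subsetI)
    fix z assume "z \<in> {(a, b). a \<in> insert 0 (Suc ` A) \<and> b \<in> {..<Suc p + q} - insert 0 (Suc ` A) \<and> b < a}"
    then obtain a b where "z = (a, b)" "a \<in> insert 0 (Suc ` A)" "b < Suc p + q" "b \<notin> insert 0 (Suc ` A)" "b < a"
      by auto
    then show "z \<in> map_prod Suc Suc ` ?I"
      by (cases a; cases b) auto
  qed auto
  then show "shuffle_sign (Suc p) q (insert 0 (Suc ` A)) = shuffle_sign p q A"
    unfolding shuffle_sign_def by (simp add: card_image inj)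
  have "{(a, b). a \<in> Suc ` A \<and> b \<in> {..<p + Suc q} - Suc ` A \<and> b < a} =
      map_prod Suc Suc ` ?I \<union> (\<lambda>a. (Suc a, 0)) ` A"
  proof (intro equalityI subsetI)
    fix z assume "z \<in> {(a, b). a \<in> Suc ` A \<and> b \<in> {..<p + Suc q} - Suc ` A \<and> b < a}"
    then obtain a b where "z = (a, b)" "a \<in> Suc ` A" "b < Suc (p + q)" "b \<notin> Suc ` A" "b < a"
      by auto
    then show "z \<in> map_prod Suc Suc ` ?I \<union> (\<lambda>a. (Suc a, 0)) ` A"
      by (cases a; cases b) auto
  qed auto
  moreover have "card (map_prod Suc Suc ` ?I \<union> (\<lambda>a. (Suc a, 0)) ` A) = card ?I + p"
    by (subst card_Un_disjoint) (use fin A in \<open>auto simp: card_image inj inj_on_def\<close>)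
  ultimately show "shuffle_sign p (Suc q) (Suc ` A) = (- 1) ^ p * shuffle_sign p q A"
    unfolding shuffle_sign_def by (simp add: power_add mult.commute)
qed

definition shuffle_path :: "('a \<Rightarrow> 'b \<Rightarrow> 'c) \<Rightarrow> 'a list \<Rightarrow> 'b list \<Rightarrow> nat set \<Rightarrow> nat \<Rightarrow> 'c list"
  where "shuffle_path f xs ys A n =
    map (\<lambda>t. f (xs ! card ({..<t} \<inter> A)) (ys ! card ({..<t} - A))) [0..<n]"

lemma shuffle_path_step:
  "shuffle_path f (x # xs) ys (insert 0 (Suc ` A)) (Suc n) = f x (ys ! 0) # shuffle_path f xs ys A n"
  "shuffle_path f xs (y # ys) (Suc ` A) (Suc n) = f (xs ! 0) y # shuffle_path f xs ys A n"
proof -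
  have 1: "{..<Suc t} \<inter> insert 0 (Suc ` A) = insert 0 (Suc ` ({..<t} \<inter> A))"
     "{..<Suc t} - insert 0 (Suc ` A) = Suc ` ({..<t} - A)"
     "{..<Suc t} \<inter> Suc ` A = Suc ` ({..<t} \<inter> A)"
     "{..<Suc t} - Suc ` A = insert 0 (Suc ` ({..<t} - A))" for t
    by (auto simp: lessThan_Suc_eq_insert_0)
  have 2: "[0..<Suc n] = 0 # map Suc [0..<n]"
    by (simp add: map_Suc_upt upt_conv_Cons)
  show "shuffle_path f (x # xs) ys (insert 0 (Suc ` A)) (Suc n) = f x (ys ! 0) # shuffle_path f xs ys A n"
    unfolding shuffle_path_def 2 by (simp add: 1 card_image card_insert_if)
  show "shuffle_path f xs (y # ys) (Suc ` A) (Suc n) = f (xs ! 0) y # shuffle_path f xs ys A n"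
    unfolding shuffle_path_def 2 by (simp add: 1 card_image card_insert_if)
qed

lemma ez_list_eq_sum_shuffles:
  assumes "xs \<noteq> []" "ys \<noteq> []"
  shows "ez_list f xs ys = (\<Sum>A\<in>shuffle_sets (length xs - 1) (length ys - 1).
    frag_cmul (shuffle_sign (length xs - 1) (length ys - 1) A)
      (frag_of (shuffle_path f xs ys A (length xs - 1 + (length ys - 1) + 1))))"
  using assms
proof (induction f xs ys rule: ez_list.induct)
  case (3 f x xs y ys)
  let ?p = "length xs" and ?q = "length ys"
  let ?g = "\<lambda>A. frag_cmul (shuffle_sign ?p ?q A) (frag_of (shuffle_path f (x # xs) (y # ys) A (?p + ?q + 1)))"
  show ?case
  proof (cases "xs = [] \<and> ys = []")
    case True
    have "shuffle_sets 0 0 = {{}}" by (auto simp: shuffle_sets_def)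
    then show ?thesis using True by (simp add: shuffle_sign_def shuffle_path_def)
  next
    case False
    have l: "(if ?p = 0 then 0 else \<Sum>A\<in>shuffle_sets (?p - 1) ?q. ?g (insert 0 (Suc ` A))) =
        prepend (f x y) (ez_list f xs (y # ys))"
    proof (cases xs)
      case (Cons x' xs')
      then show ?thesis
        using "3.IH"(1) by (simp add: prepend_sum shuffle_sign_step shuffle_path_step del: ez_list.simps)
    qed simp
    have r: "(if ?q = 0 then 0 else \<Sum>A\<in>shuffle_sets ?p (?q - 1). ?g (Suc ` A)) =
        frag_cmul ((- 1) ^ ?p) (prepend (f x y) (ez_list f (x # xs) ys))"
    proof (cases ys)
      case (Cons y' ys')
      then show ?thesis
        using "3.IH"(2) by (simp add: prepend_sum frag_cmul_sum shuffle_sign_step shuffle_path_step del: ez_list.simps)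
    qed simp
    have "sum ?g (shuffle_sets ?p ?q) = prepend (f x y) (ez_list f xs (y # ys)) +
        frag_cmul ((- 1) ^ ?p) (prepend (f x y) (ez_list f (x # xs) ys))"
      using False by (subst sum_shuffle_sets) (auto simp only: l r)
    then show ?thesis using False by auto
  qed
qed auto

section \<open>Normalisation\<close>

text \<open>
  The empty simplex survives, in contrast to \<open>normalise\<close> below; this makes degenerate chains, the
  kernel, stable under \<open>prepend\<close>.
\<close>

definition reduce :: "('a list \<Rightarrow>\<^sub>0 int) \<Rightarrow> 'a list \<Rightarrow>\<^sub>0 int"
  where "reduce = frag_extend (\<lambda>xs. if distinct_adj xs then frag_of xs else 0)"

lemma reduce_simps [simp]:
  "reduce 0 = 0" "reduce (a + b) = reduce a + reduce b" "reduce (a - b) = reduce a - reduce b"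
  "reduce (- a) = - reduce a" "reduce (frag_cmul n a) = frag_cmul n (reduce a)"
  "reduce (frag_of xs) = (if distinct_adj xs then frag_of xs else 0)"
  by (auto simp: reduce_def frag_extend_add frag_extend_diff frag_extend_minus frag_extend_cmul)

lemma reduce_prepend: "reduce (prepend v (reduce a)) = reduce (prepend v a)"
  by (rule frag_induction[where S = UNIV and c = a]) (auto simp: distinct_adj_Cons)

lemma reduce_prepend_prepend: "reduce (prepend v (prepend v a)) = 0"
  by (rule frag_induction[where S = UNIV and c = a]) auto

lemma reduce_prepend_eq_0: "reduce a = 0 \<Longrightarrow> reduce (prepend v a) = 0"
  by (metis reduce_prepend prepend_simps(1) reduce_simps(1))

text \<open>
  If the first two vertices are equal, the first two faces cancel and the other faces start with the
  same repetition.
\<close>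

lemma reduce_aug_bd_degenerate: "\<not> distinct_adj xs \<Longrightarrow> reduce (aug_bd_list xs) = 0"
proof (induction xs rule: induct_list012)
  case (3 x y zs)
  show ?case
  proof (cases "x = y")
    case True
    then show ?thesis by (simp add: reduce_prepend_prepend)
  next
    case False
    then have "\<not> distinct_adj (y # zs)" using 3 by simp
    then show ?thesis using 3 by (simp add: reduce_prepend_eq_0 del: aug_bd_list.simps(2)
      add: aug_bd_list.simps(2)[of x])
  qed
qed auto

text \<open>
  While the first factor makes the step between its two equal vertices, the second factor stands still,
  so the lattice path repeats a vertex as well.
\<close>

lemma reduce_ez_degenerate_left: "\<not> distinct_adj xs \<Longrightarrow> reduce (ez_list f xs ys) = 0"
proof (induction f xs ys rule: ez_list.induct)
  case (3 f x xs y ys)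
  have 2: "reduce (prepend (f x y) (ez_list f (x # xs) ys)) = 0"
    using 3 by (simp add: reduce_prepend_eq_0)
  have 1: "reduce (prepend (f x y) (ez_list f xs (y # ys))) = 0"
  proof (cases "distinct_adj xs")
    case False
    then show ?thesis using 3 by (simp add: reduce_prepend_eq_0)
  next
    case True
    then obtain xs' where "xs = x # xs'" using 3 by (cases xs) auto
    then show ?thesis by (simp only: ez_list.simps reduce_prepend_prepend)
  qed
  have "xs \<noteq> []" using 3 by auto
  then show ?case using 1 2 by simp
qed auto

lemma reduce_ez_degenerate_right: "\<not> distinct_adj ys \<Longrightarrow> reduce (ez_list f xs ys) = 0"
  using ez_list_commute[of xs ys f "\<lambda>y x. f x y"]
  by (simp add: reduce_ez_degenerate_left)

text \<open>
  The quotient map onto normalised chains, as an idempotent on the free abelian group of all tuples.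
\<close>

definition normalise :: "be_elem \<Rightarrow> be_elem"
  where "normalise = frag_extend simplex"

lemma normalise_simps [simp]:
  "normalise 0 = 0" "normalise (a + b) = normalise a + normalise b"
  "normalise (a - b) = normalise a - normalise b"
  "normalise (- a) = - normalise a" "normalise (frag_cmul n a) = frag_cmul n (normalise a)"
  "normalise (frag_of xs) = simplex xs"
  by (auto simp: normalise_def frag_extend_add frag_extend_diff frag_extend_minus frag_extend_cmul)

lemma normalise_sum: "normalise (sum g I) = (\<Sum>i\<in>I. normalise (g i))"
  by (induction I rule: infinite_finite_induct) auto

lemma normalise_reduce: "normalise (reduce a) = normalise a"
  by (rule frag_induction[where S = UNIV and c = a]) (auto simp: simplex_def nondegenerate_def)

lemma normalise_simplex [simp]: "normalise (simplex xs) = simplex xs"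
  by (auto simp: simplex_def)

lemma normalise_normalise [simp]: "normalise (normalise a) = normalise a"
  by (rule frag_induction[where S = UNIV and c = a]) auto

lemma normalise_0_if_reduce_0: "reduce a = 0 \<Longrightarrow> normalise a = 0"
  by (metis normalise_reduce normalise_simps(1))

lemma reduce_eq_normalise: "[] \<notin> keys a \<Longrightarrow> reduce a = normalise a"
  by (auto simp: reduce_def normalise_def simplex_def nondegenerate_def intro!: frag_extend_eq)

lemma normalise_aug_bd_normalise [simp]: "normalise (aug_bd (normalise a)) = normalise (aug_bd a)"
  by (rule frag_induction[where S = UNIV and c = a])
    (auto simp: simplex_def nondegenerate_def normalise_0_if_reduce_0 reduce_aug_bd_degenerate)

lemma normalise_ez_normalise [simp]:
  "normalise (ez f (normalise a) b) = normalise (ez f a b)"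
  "normalise (ez f a (normalise b)) = normalise (ez f a b)"
proof -
  have 1: "normalise (ez f (simplex xs) (frag_of ys)) = normalise (ez_list f xs ys)" for f xs and ys :: "'z list"
    by (auto simp: simplex_def nondegenerate_def normalise_0_if_reduce_0 reduce_ez_degenerate_left)
  have 2: "normalise (ez f (simplex xs) b) = normalise (ez f (frag_of xs) b)" for f xs and b :: "'z list \<Rightarrow>\<^sub>0 int"
    by (rule frag_induction[where S = UNIV and c = b]) (auto simp: 1)
  show "normalise (ez f (normalise a) b) = normalise (ez f a b)"
    by (rule frag_induction[where S = UNIV and c = a]) (auto simp: 2)
next
  have 1: "normalise (ez f (frag_of xs) (simplex ys)) = normalise (ez_list f xs ys)" for f ys and xs :: "'z list"
    by (auto simp: simplex_def nondegenerate_def normalise_0_if_reduce_0 reduce_ez_degenerate_right)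
  have 2: "normalise (ez f a (simplex ys)) = normalise (ez f a (frag_of ys))" for f ys and a :: "'z list \<Rightarrow>\<^sub>0 int"
    by (rule frag_induction[where S = UNIV and c = a]) (auto simp: 1)
  show "normalise (ez f a (normalise b)) = normalise (ez f a b)"
    by (rule frag_induction[where S = UNIV and c = b]) (auto simp: 2)
qed

lemma be_boundary_eq: "be_boundary a = normalise (aug_bd a)"
proof (rule frag_induction[where S = UNIV and c = a])
  show "be_boundary (frag_of xs) = normalise (aug_bd (frag_of xs))" for xs
    by (simp add: be_boundary_def aug_bd_list_eq_sum normalise_sum)
qed (auto simp: be_boundary_def frag_extend_diff)

lemma be_comp_eq:
  assumes "[] \<notin> keys x" "[] \<notin> keys y"
  shows "be_comp s k x y = normalise (ez (perm_comp s k) x y)"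
proof -
  have *: "be_comp_simplex s k xs ys = normalise (ez_list (perm_comp s k) xs ys)"
    if "xs \<noteq> []" "ys \<noteq> []" for xs ys
    using that by (simp add: be_comp_simplex_def ez_list_eq_sum_shuffles normalise_sum Let_def shuffle_path_def)
  have "be_comp s k x y = frag_extend (\<lambda>xs. frag_extend (\<lambda>ys. normalise (ez_list (perm_comp s k) xs ys)) y) x"
    unfolding be_comp_def
    by (intro frag_extend_eq) (metis assms *)
  also have "\<dots> = normalise (ez (perm_comp s k) x y)"
    by (simp add: normalise_def ez_def frag_extend_frag_extend)
  finally show ?thesis .
qed

section \<open>The operad of symmetric groups\<close>

lemma perm_comp_apply:
  assumes "\<sigma> permutes {1..r}" "\<sigma> i = k"
  shows "perm_comp s k \<sigma> \<tau> l =
    (if l < i then (if \<sigma> l < k then \<sigma> l else \<sigma> l + s - 1)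
     else if l < i + s then \<tau> (l + 1 - i) + k - 1
     else (if \<sigma> (l + 1 - s) < k then \<sigma> (l + 1 - s) else \<sigma> (l + 1 - s) + s - 1))"
proof -
  have "Hilbert_Choice.inv \<sigma> k = i"
    using assms permutes_inverses(2) by metis
  then show ?thesis by (simp add: perm_comp_def Let_def)
qed

text \<open>
  The word of \<open>perm_comp s k \<sigma> \<tau>\<close> consists of three parts: what stands before the letter \<open>k\<close> in
  the word of \<open>\<sigma>\<close>, the inserted word of \<open>\<tau>\<close>, and what stands after \<open>k\<close>.
\<close>

lemma perm_comp_cases:
  assumes "\<sigma> permutes {1..r}" "\<sigma> i = k"
  shows "l < i \<Longrightarrow> perm_comp s k \<sigma> \<tau> l = (if \<sigma> l < k then \<sigma> l else \<sigma> l + s - 1)"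
    and "\<lbrakk>i \<le> l; l < i + s\<rbrakk> \<Longrightarrow> perm_comp s k \<sigma> \<tau> l = \<tau> (l + 1 - i) + k - 1"
    and "i + s \<le> l \<Longrightarrow> perm_comp s k \<sigma> \<tau> l =
      (if \<sigma> (l + 1 - s) < k then \<sigma> (l + 1 - s) else \<sigma> (l + 1 - s) + s - 1)"
  by (auto simp: perm_comp_apply[OF assms])

lemma perm_comp_id:
  assumes "k \<ge> 1"
  shows "perm_comp s k id id = id"
  using assms by (auto simp: fun_eq_iff perm_comp_def)

text \<open>
  Equivariance of the partial compositions: \<open>\<sigma>'\<close> places the inserted block at the letter
  \<open>inv \<sigma> k\<close>, which \<open>\<sigma>\<close> then carries to \<open>k\<close>. Taking inverses for \<open>\<sigma>'\<close> and \<open>\<tau>'\<close> shows that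
  composites are invertible.
\<close>

lemma perm_comp_comp:
  assumes "k \<in> {1..r}" "\<sigma> permutes {1..r}" "\<sigma>' permutes {1..r}" "\<tau>' permutes {1..s}"
  shows "perm_comp s k (\<sigma> \<circ> \<sigma>') (\<tau> \<circ> \<tau>') =
    perm_comp s k \<sigma> \<tau> \<circ> perm_comp s (Hilbert_Choice.inv \<sigma> k) \<sigma>' \<tau>'"
proof
  fix l
  define j where "j = Hilbert_Choice.inv \<sigma> k"
  define i where "i = Hilbert_Choice.inv \<sigma>' j"
  have j: "\<sigma> j = k" "j \<in> {1..r}" and i: "\<sigma>' i = j" "i \<in> {1..r}"
    using assms by (auto simp: j_def i_def permutes_inverses permutes_in_image permutes_inv
      simp del: atLeastAtMost_iff)
  have ne: "\<sigma>' m \<noteq> j" if "m \<noteq> i" for m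
    using that i assms(3) by (metis permutes_inverses(2))
  have \<tau>': "\<tau>' m \<in> {1..s}" if "m \<in> {1..s}" for m
    using that assms(4) by (simp add: permutes_in_image del: atLeastAtMost_iff)
  note [simp] = perm_comp_apply[OF permutes_compose[OF assms(3,2)], of i k]
    perm_comp_apply[OF assms(2) j(1)] perm_comp_apply[OF assms(3) i(1)]
  consider "l < i" | "i \<le> l" "l < i + s" | "i + s \<le> l" by linarith
  then show "perm_comp s k (\<sigma> \<circ> \<sigma>') (\<tau> \<circ> \<tau>') l =
      (perm_comp s k \<sigma> \<tau> \<circ> perm_comp s (Hilbert_Choice.inv \<sigma> k) \<sigma>' \<tau>') l"
  proof cases
    case 1
    then show ?thesis using ne[of l] i j unfolding j_def[symmetric] by auto
  next
    case 2
    then have "\<tau>' (l + 1 - i) \<in> {1..s}" by (intro \<tau>') auto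
    with 2 show ?thesis using i j unfolding j_def[symmetric] by auto
  next
    case 3
    then have "\<sigma>' (l + 1 - s) \<noteq> j" by (intro ne) auto
    with 3 show ?thesis using i j unfolding j_def[symmetric] by auto
  qed
qed

lemma perm_comp_permutes:
  assumes "k \<in> {1..r}" "\<sigma> permutes {1..r}" "\<tau> permutes {1..s}"
  shows "perm_comp s k \<sigma> \<tau> permutes {1..r + s - 1}"
proof -
  let ?j = "Hilbert_Choice.inv \<sigma> k"
  let ?w = "perm_comp s k \<sigma> \<tau>"
    and ?v = "perm_comp s ?j (Hilbert_Choice.inv \<sigma>) (Hilbert_Choice.inv \<tau>)"
  have inv: "Hilbert_Choice.inv \<sigma> permutes {1..r}" "Hilbert_Choice.inv \<tau> permutes {1..s}"
    using assms by (auto intro: permutes_inv)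
  have j: "?j \<in> {1..r}" "\<sigma> ?j = k"
    using assms inv by (simp_all add: permutes_inverses permutes_in_image del: atLeastAtMost_iff)
  have 1: "?w \<circ> ?v = id"
    using perm_comp_comp[OF assms(1,2) inv, of \<tau>] assms
    by (simp add: permutes_inv_o perm_comp_id)
  have 2: "?v \<circ> ?w = id"
    using perm_comp_comp[OF j(1) inv(1) assms(2,3), of "Hilbert_Choice.inv \<tau>"] assms j
    by (simp add: permutes_inv_o perm_comp_id permutes_inv_inv)
  have "bij ?w" using 1 2 by (rule o_bij[rotated])
  moreover have "?w l = l" if "l \<notin> {1..r + s - 1}" for l
  proof -
    have "\<sigma> 0 = 0" using assms(2) by (auto intro!: permutes_not_in)
    moreover have "\<sigma> (l + 1 - s) = l + 1 - s" if "l \<noteq> 0"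
      using assms(2) that \<open>l \<notin> _\<close> by (auto intro!: permutes_not_in)
    ultimately show ?thesis
      using that j assms(1) by (cases "l = 0") (auto simp: perm_comp_apply[OF assms(2) j(2)])
  qed
  ultimately show "?w permutes {1..r + s - 1}"
    unfolding permutes_def bij_iff by blast
qed

lemma perm_comp_unit_left:
  assumes "\<tau> permutes {1..s}"
  shows "perm_comp s 1 id \<tau> = \<tau>"
proof -
  have "\<tau> l = l" if "l = 0 \<or> l > s" for l
    using assms that by (auto intro!: permutes_not_in)
  then show ?thesis by (auto simp: fun_eq_iff perm_comp_def)
qed

lemma perm_comp_unit_right:
  assumes "\<sigma> permutes {1..r}" "k \<ge> 1"
  shows "perm_comp 1 k \<sigma> id = \<sigma>"
proof
  fix l
  show "perm_comp 1 k \<sigma> id l = \<sigma> l"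
    using perm_comp_apply[OF assms(1) permutes_inverses(1)[OF assms(1)], of 1 k id l] assms
      permutes_inverses(1)[OF assms(1), of k]
    by (auto simp: not_less le_less_Suc_eq)
qed

text \<open>
  Positions are compared in five ranges: before the block of \<open>\<tau>\<close>, in that block but before, in or after
  the block of \<open>\<upsilon>\<close>, and after the block of \<open>\<tau>\<close>.
\<close>

lemma perm_comp_seq_assoc:
  assumes i: "i \<in> {1..r}" and j: "j \<in> {1..s}"
    and p: "\<sigma> permutes {1..r}" "\<tau> permutes {1..s}" "\<upsilon> permutes {1..t}"
  shows "perm_comp t (i + j - 1) (perm_comp s i \<sigma> \<tau>) \<upsilon> =
    perm_comp (s + t - 1) i \<sigma> (perm_comp t j \<tau> \<upsilon>)"
proof
  fix l
  define a b where "a = Hilbert_Choice.inv \<sigma> i" and "b = Hilbert_Choice.inv \<tau> j"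
  have a: "\<sigma> a = i" "a \<in> {1..r}" and b: "\<tau> b = j" "b \<in> {1..s}"
    using assms by (auto simp: a_def b_def permutes_inverses permutes_in_image permutes_inv
      simp del: atLeastAtMost_iff)
  have \<tau>: "\<tau> m \<in> {1..s}" "m \<noteq> b \<Longrightarrow> \<tau> m \<noteq> j" if "m \<in> {1..s}" for m
    using that p b by (auto simp: permutes_in_image simp del: atLeastAtMost_iff) (metis permutes_inverses(2))
  have \<sigma>: "\<sigma> m \<noteq> i" if "m \<noteq> a" for m
    using that a p by (metis permutes_inverses(2))
  have \<upsilon>: "\<upsilon> m \<in> {1..t}" if "m \<in> {1..t}" for m
    using that p by (simp add: permutes_in_image del: atLeastAtMost_iff)
  \<comment> \<open>The position at which the left hand side inserts the word of \<open>\<upsilon>\<close>.\<close>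
  have w: "perm_comp s i \<sigma> \<tau> (a + b - 1) = i + j - 1"
    by (subst perm_comp_cases(2)[OF p(1) a(1)]) (use a(2) b in auto)
  note app = perm_comp_cases[OF perm_comp_permutes[OF i p(1,2)] w, unfolded One_nat_def]
    perm_comp_cases[OF p(1) a(1), unfolded One_nat_def] perm_comp_cases[OF p(2) b(1), unfolded One_nat_def]
  consider "l < a" | "a \<le> l" "l < a + b - 1" | "a + b - 1 \<le> l" "l < a + b - 1 + t"
    | "a + b - 1 + t \<le> l" "l < a + (s + t - 1)" | "a + (s + t - 1) \<le> l" by linarith
  then show "perm_comp t (i + j - 1) (perm_comp s i \<sigma> \<tau>) \<upsilon> l =
    perm_comp (s + t - 1) i \<sigma> (perm_comp t j \<tau> \<upsilon>) l"
  proof cases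
    case 1
    then show ?thesis using \<sigma>[of l] i j a(2) b(2) by (auto simp: app; simp add: add_ac)
  next
    case 2
    have "\<tau> (l + 1 - a) \<in> {1..s}" using 2 b by (intro \<tau>(1)) auto
    moreover have "\<tau> (l + 1 - a) \<noteq> j" using 2 b by (intro \<tau>(2)) auto
    ultimately show ?thesis using 2 i j a(2) b(2) by (auto simp: app; simp add: add_ac)
  next
    case 3
    define m where "m = l + 1 - (a + b - 1)"
    have m: "m = l + 1 - a + 1 - b" unfolding m_def using 3 a b by auto
    have ms: "\<upsilon> m \<in> {1..t}" unfolding m_def using 3 a b by (intro \<upsilon>) auto
    have 1: "perm_comp t j \<tau> \<upsilon> (l + 1 - a) = \<upsilon> m + j - 1"
      unfolding m by (rule perm_comp_cases(2)[OF p(2) b(1)]) (use 3 a b in auto)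
    have "a \<le> l" "l < a + (s + t - 1)" using 3 b by auto
    note 2 = perm_comp_cases(2)[OF perm_comp_permutes[OF i p(1,2)] w 3, where \<tau> = \<upsilon>]
      perm_comp_cases(2)[OF p(1) a(1) this]
    show ?thesis unfolding 2 1 m_def[symmetric] using i j ms by auto
  next
    case 4
    define m where "m = \<tau> (l + 1 - a + 1 - t)"
    have m: "m = \<tau> (l + 1 - t + 1 - a)"
      unfolding m_def by (rule arg_cong[of _ _ \<tau>]) (use 4 a b in auto)
    have ms: "m \<in> {1..s}" unfolding m_def using 4 a b by (intro \<tau>(1)) auto
    have mj: "m \<noteq> j" unfolding m_def using 4 a b by (intro \<tau>(2)) auto
    have 1: "perm_comp s i \<sigma> \<tau> (l + 1 - t) = m + i - 1"
      unfolding m by (rule perm_comp_cases(2)[OF p(1) a(1)]) (use 4 a b in auto)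
    have 2: "perm_comp t j \<tau> \<upsilon> (l + 1 - a) = (if m < j then m else m + t - 1)"
      unfolding m_def by (rule perm_comp_cases(3)[OF p(2) b(1)]) (use 4 a b in auto)
    have "a \<le> l" using 4 b by auto
    note 3 = perm_comp_cases(3)[OF perm_comp_permutes[OF i p(1,2)] w 4(1), where \<tau> = \<upsilon>]
      perm_comp_cases(2)[OF p(1) a(1) this 4(2)]
    show ?thesis unfolding 3 1 2 using i j ms mj by (cases "m < j") auto
  next
    case 5
    define m where "m = \<sigma> (l + 1 - (s + t - 1))"
    have m: "m = \<sigma> (l + 1 - t + 1 - s)"
      unfolding m_def by (rule arg_cong[of _ _ \<sigma>]) (use 5 a b in auto)
    have mi: "m \<noteq> i" unfolding m_def using 5 a b by (intro \<sigma>) auto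
    have 1: "perm_comp s i \<sigma> \<tau> (l + 1 - t) = (if m < i then m else m + s - 1)"
      unfolding m by (rule perm_comp_cases(3)[OF p(1) a(1)]) (use 5 a b in auto)
    have "a + b - 1 + t \<le> l" using 5 b by auto
    note 2 = perm_comp_cases(3)[OF perm_comp_permutes[OF i p(1,2)] w this, where \<tau> = \<upsilon>]
      perm_comp_cases(3)[OF p(1) a(1) 5]
    show ?thesis unfolding 2 1 unfolding m_def[symmetric] using i j mi by (cases "m < i") auto
  qed
qed

text \<open>
  The inserted blocks are disjoint. Their order in the word depends on whether \<open>i\<close> precedes \<open>k\<close> in the
  word of \<open>\<sigma>\<close>; in both cases positions are compared in the five ranges cut out by the blocks.
\<close>

lemma perm_comp_par_assoc:
  assumes ik: "1 \<le> i" "i < k" "k \<le> r"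
    and p: "\<sigma> permutes {1..r}" "\<tau> permutes {1..s}" "\<upsilon> permutes {1..t}"
  shows "perm_comp t (k + s - 1) (perm_comp s i \<sigma> \<tau>) \<upsilon> =
    perm_comp s i (perm_comp t k \<sigma> \<upsilon>) \<tau>"
proof
  fix l
  define a b where "a = Hilbert_Choice.inv \<sigma> i" and "b = Hilbert_Choice.inv \<sigma> k"
  have i: "i \<in> {1..r}" and k: "k \<in> {1..r}" using ik by auto
  have a: "\<sigma> a = i" "a \<in> {1..r}" and b: "\<sigma> b = k" "b \<in> {1..r}"
    using i k p by (auto simp: a_def b_def permutes_inverses permutes_in_image permutes_inv
      simp del: atLeastAtMost_iff)
  have \<sigma>: "\<sigma> m \<noteq> i" if "m \<noteq> a" for m
    using that a p by (metis permutes_inverses(2))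
  have \<sigma>': "\<sigma> m \<noteq> k" if "m \<noteq> b" for m
    using that b p by (metis permutes_inverses(2))
  have \<tau>: "\<tau> m \<in> {1..s}" if "m \<in> {1..s}" for m
    using that p by (simp add: permutes_in_image del: atLeastAtMost_iff)
  have \<upsilon>: "\<upsilon> m \<in> {1..t}" if "m \<in> {1..t}" for m
    using that p by (simp add: permutes_in_image del: atLeastAtMost_iff)
  have ab: "a \<noteq> b" using a b ik by auto
  have ab1: "1 \<le> a" "1 \<le> b" using a(2) b(2) by simp_all
  \<comment> \<open>The positions of the letters \<open>k + s - 1\<close> and \<open>i\<close> after the first insertion.\<close>
  let ?b = "if b < a then b else b + s - 1" and ?a = "if a < b then a else a + t - 1"
  have w: "perm_comp s i \<sigma> \<tau> ?b = k + s - 1"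
    using a b ab ik by (auto simp: perm_comp_cases[OF p(1) a(1)])
  have w': "perm_comp t k \<sigma> \<upsilon> ?a = i"
    using a b ab ik by (auto simp: perm_comp_cases[OF p(1) b(1)])
  note app = perm_comp_cases[OF perm_comp_permutes[OF i p(1,2)] w, unfolded One_nat_def]
    perm_comp_cases[OF perm_comp_permutes[OF k p(1,3)] w', unfolded One_nat_def]
    perm_comp_cases[OF p(1) a(1), unfolded One_nat_def] perm_comp_cases[OF p(1) b(1), unfolded One_nat_def]
  show "perm_comp t (k + s - 1) (perm_comp s i \<sigma> \<tau>) \<upsilon> l =
    perm_comp s i (perm_comp t k \<sigma> \<upsilon>) \<tau> l"
  proof (cases "a < b")
    case True
    consider "l < a" | "a \<le> l" "l < a + s" | "a + s \<le> l" "l < b + s - 1"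
      | "b + s - 1 \<le> l" "l < b + s - 1 + t" | "b + s - 1 + t \<le> l" using True by linarith
    then show ?thesis
    proof cases
      case 1
      then have "l < b + s - 1" using True by auto
      with 1 show ?thesis using True \<sigma>[of l] \<sigma>'[of l] ik a(2) b(2) by (auto simp: app; simp add: add_ac)
    next
      case 2
      then have "\<tau> (l + 1 - a) \<in> {1..s}" by (intro \<tau>) auto
      with 2 show ?thesis using True ik a(2) b(2) by (auto simp: app; simp add: add_ac)
    next
      case 3
      define m where "m = \<sigma> (l + 1 - s)"
      have mi: "m \<noteq> i" unfolding m_def using 3 True by (intro \<sigma>) auto
      have mk: "m \<noteq> k" unfolding m_def using 3 True by (intro \<sigma>') auto
      have 1: "perm_comp s i \<sigma> \<tau> l = (if m < i then m else m + s - 1)"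
        unfolding m_def by (rule perm_comp_cases(3)[OF p(1) a(1)]) (use 3 in auto)
      have 2: "perm_comp t k \<sigma> \<upsilon> (l + 1 - s) = (if m < k then m else m + t - 1)"
        unfolding m_def by (rule perm_comp_cases(1)[OF p(1) b(1)]) (use 3 ab1 in auto)
      have "l < ?b" "?a + s \<le> l" using 3 True by auto
      note 3 = perm_comp_cases(1)[OF perm_comp_permutes[OF i p(1,2)] w this(1), where \<tau> = \<upsilon>]
        perm_comp_cases(3)[OF perm_comp_permutes[OF k p(1,3)] w' this(2), where \<tau> = \<tau>]
      consider "m < i" | "i < m" "m < k" | "k < m" using mi mk by linarith
      then show ?thesis unfolding 3 1 2 using ik by cases auto
    next
      case 4
      define m where "m = l + 1 - (b + s - 1)"
      have m: "m = l + 1 - s + 1 - b" using 4 b by (auto simp: m_def)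
      have ms: "\<upsilon> m \<in> {1..t}" unfolding m_def using 4 b by (intro \<upsilon>) auto
      have 1: "perm_comp t k \<sigma> \<upsilon> (l + 1 - s) = \<upsilon> m + k - 1"
        unfolding m by (rule perm_comp_cases(2)[OF p(1) b(1)]) (use 4 True in auto)
      have "?b \<le> l" "l < ?b + t" "?a + s \<le> l" using 4 True by auto
      note 2 = perm_comp_cases(2)[OF perm_comp_permutes[OF i p(1,2)] w this(1,2), where \<tau> = \<upsilon>]
        perm_comp_cases(3)[OF perm_comp_permutes[OF k p(1,3)] w' this(3), where \<tau> = \<tau>]
      have "l + 1 - ?b = m" unfolding m_def using True by simp
      show ?thesis unfolding 2 1 \<open>l + 1 - ?b = m\<close> using ik ms by (auto simp: add_ac)
    next
      case 5
      define m where "m = \<sigma> (l + 1 - t + 1 - s)"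
      have m: "m = \<sigma> (l + 1 - s + 1 - t)"
        unfolding m_def by (rule arg_cong[of _ _ \<sigma>]) (use 5 ab1 True in linarith)
      have mi: "m \<noteq> i" unfolding m_def using 5 True by (intro \<sigma>) auto
      have mk: "m \<noteq> k" unfolding m_def using 5 True by (intro \<sigma>') auto
      have 1: "perm_comp s i \<sigma> \<tau> (l + 1 - t) = (if m < i then m else m + s - 1)"
        unfolding m_def by (rule perm_comp_cases(3)[OF p(1) a(1)]) (use 5 True in auto)
      have 2: "perm_comp t k \<sigma> \<upsilon> (l + 1 - s) = (if m < k then m else m + t - 1)"
        unfolding m by (rule perm_comp_cases(3)[OF p(1) b(1)]) (use 5 True in auto)
      have "?b + t \<le> l" "?a + s \<le> l" using 5 True by auto
      note 3 = perm_comp_cases(3)[OF perm_comp_permutes[OF i p(1,2)] w this(1), where \<tau> = \<upsilon>]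
        perm_comp_cases(3)[OF perm_comp_permutes[OF k p(1,3)] w' this(2), where \<tau> = \<tau>]
      consider "m < i" | "i < m" "m < k" | "k < m" using mi mk by linarith
      then show ?thesis unfolding 3 1 2 using ik by cases auto
    qed
  next
    case False
    then have ba: "b < a" using ab by simp
    consider "l < b" | "b \<le> l" "l < b + t" | "b + t \<le> l" "l < a + t - 1"
      | "a + t - 1 \<le> l" "l < a + t - 1 + s" | "a + t - 1 + s \<le> l" using ba by linarith
    then show ?thesis
    proof cases
      case 1
      then have "l < a + t - 1" using ba by auto
      with 1 show ?thesis using ba \<sigma>[of l] \<sigma>'[of l] ik a(2) b(2) by (auto simp: app; simp add: add_ac)
    next
      case 2
      then have "\<upsilon> (l + 1 - b) \<in> {1..t}" by (intro \<upsilon>) auto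
      with 2 show ?thesis using ba ik a(2) b(2) by (auto simp: app; simp add: add_ac)
    next
      case 3
      define m where "m = \<sigma> (l + 1 - t)"
      have mi: "m \<noteq> i" unfolding m_def using 3 ba by (intro \<sigma>) auto
      have mk: "m \<noteq> k" unfolding m_def using 3 ba by (intro \<sigma>') auto
      have 1: "perm_comp s i \<sigma> \<tau> (l + 1 - t) = (if m < i then m else m + s - 1)"
        unfolding m_def by (rule perm_comp_cases(1)[OF p(1) a(1)]) (use 3 ab1 in auto)
      have 2: "perm_comp t k \<sigma> \<upsilon> l = (if m < k then m else m + t - 1)"
        unfolding m_def by (rule perm_comp_cases(3)[OF p(1) b(1)]) (use 3 in auto)
      have "?b + t \<le> l" "l < ?a" using 3 ba by auto
      note 3 = perm_comp_cases(3)[OF perm_comp_permutes[OF i p(1,2)] w this(1), where \<tau> = \<upsilon>]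
        perm_comp_cases(1)[OF perm_comp_permutes[OF k p(1,3)] w' this(2), where \<tau> = \<tau>]
      consider "m < i" | "i < m" "m < k" | "k < m" using mi mk by linarith
      then show ?thesis unfolding 3 1 2 using ik by cases auto
    next
      case 4
      define m where "m = l + 1 - (a + t - 1)"
      have m: "m = l + 1 - t + 1 - a" using 4 a by (auto simp: m_def)
      have ms: "\<tau> m \<in> {1..s}" unfolding m_def using 4 a by (intro \<tau>) auto
      have 1: "perm_comp s i \<sigma> \<tau> (l + 1 - t) = \<tau> m + i - 1"
        unfolding m by (rule perm_comp_cases(2)[OF p(1) a(1)]) (use 4 ba in auto)
      have "?a \<le> l" "l < ?a + s" "?b + t \<le> l" using 4 ba by auto
      note 2 = perm_comp_cases(2)[OF perm_comp_permutes[OF k p(1,3)] w' this(1,2), where \<tau> = \<tau>]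
        perm_comp_cases(3)[OF perm_comp_permutes[OF i p(1,2)] w this(3), where \<tau> = \<upsilon>]
      have "l + 1 - ?a = m" unfolding m_def using ba by simp
      show ?thesis unfolding 2 1 \<open>l + 1 - ?a = m\<close> using ik ms by (auto simp: add_ac)
    next
      case 5
      define m where "m = \<sigma> (l + 1 - t + 1 - s)"
      have m: "m = \<sigma> (l + 1 - s + 1 - t)"
        unfolding m_def by (rule arg_cong[of _ _ \<sigma>]) (use 5 ab1 ba in linarith)
      have mi: "m \<noteq> i" unfolding m_def using 5 ba by (intro \<sigma>) auto
      have mk: "m \<noteq> k" unfolding m_def using 5 ba by (intro \<sigma>') auto
      have 1: "perm_comp s i \<sigma> \<tau> (l + 1 - t) = (if m < i then m else m + s - 1)"
        unfolding m_def by (rule perm_comp_cases(3)[OF p(1) a(1)]) (use 5 ba in auto)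
      have 2: "perm_comp t k \<sigma> \<upsilon> (l + 1 - s) = (if m < k then m else m + t - 1)"
        unfolding m by (rule perm_comp_cases(3)[OF p(1) b(1)]) (use 5 ba in auto)
      have "?b + t \<le> l" "?a + s \<le> l" using 5 ba by auto
      note 3 = perm_comp_cases(3)[OF perm_comp_permutes[OF i p(1,2)] w this(1), where \<tau> = \<upsilon>]
        perm_comp_cases(3)[OF perm_comp_permutes[OF k p(1,3)] w' this(2), where \<tau> = \<tau>]
      consider "m < i" | "i < m" "m < k" | "k < m" using mi mk by linarith
      then show ?thesis unfolding 3 1 2 using ik by cases auto
    qed
  qed
qed

section \<open>Bilinear extension\<close>

definition map_chain :: "('a \<Rightarrow> 'b) \<Rightarrow> ('a list \<Rightarrow>\<^sub>0 int) \<Rightarrow> 'b list \<Rightarrow>\<^sub>0 int"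
  where "map_chain h = frag_extend (\<lambda>xs. frag_of (map h xs))"

lemma map_chain_simps [simp]:
  "map_chain h 0 = 0" "map_chain h (a + b) = map_chain h a + map_chain h b"
  "map_chain h (a - b) = map_chain h a - map_chain h b" "map_chain h (- a) = - map_chain h a"
  "map_chain h (frag_cmul n a) = frag_cmul n (map_chain h a)"
  "map_chain h (frag_of xs) = frag_of (map h xs)"
  by (auto simp: map_chain_def frag_extend_add frag_extend_diff frag_extend_minus frag_extend_cmul)

lemma map_chain_prepend [simp]: "map_chain h (prepend v a) = prepend (h v) (map_chain h a)"
  by (rule frag_induction[where S = UNIV and c = a]) auto

lemma aug_bd_list_map: "aug_bd_list (map h xs) = map_chain h (aug_bd_list xs)"
  by (induction xs) auto

lemma aug_bd_map_chain: "aug_bd (map_chain h a) = map_chain h (aug_bd a)"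
  by (rule frag_induction[where S = UNIV and c = a]) (auto simp: aug_bd_list_map)

lemma ez_list_map: "ez_list f (map h xs) (map h' ys) = ez_list (\<lambda>x y. f (h x) (h' y)) xs ys"
  by (induction "\<lambda>x y. f (h x) (h' y)" xs ys rule: ez_list.induct) auto

lemma map_chain_ez_list: "map_chain h (ez_list f xs ys) = ez_list (\<lambda>x y. h (f x y)) xs ys"
  by (induction f xs ys rule: ez_list.induct) auto

lemma ez_list_cong:
  "(\<And>x y. \<lbrakk>x \<in> set xs; y \<in> set ys\<rbrakk> \<Longrightarrow> f x y = g x y) \<Longrightarrow> ez_list f xs ys = ez_list g xs ys"
  by (induction f xs ys rule: ez_list.induct) auto

lemma bilinear_frag_eqI:
  assumes "keys x \<subseteq> S" "keys y \<subseteq> T"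
    and "\<And>xs ys. \<lbrakk>xs \<in> S; ys \<in> T\<rbrakk> \<Longrightarrow> F (frag_of xs) (frag_of ys) = G (frag_of xs) (frag_of ys)"
    and "\<And>b. F 0 b = 0" "\<And>a. F a 0 = 0" "\<And>b. G 0 b = 0" "\<And>a. G a 0 = 0"
    and "\<And>a a' b. F (a - a') b = F a b - F a' b" "\<And>a b b'. F a (b - b') = F a b - F a b'"
    and "\<And>a a' b. G (a - a') b = G a b - G a' b" "\<And>a b b'. G a (b - b') = G a b - G a b'"
  shows "F x y = (G x y :: 'c \<Rightarrow>\<^sub>0 int)"
  using assms(1)
proof (induction rule: frag_induction)
  case (one xs)
  show ?case using assms(2)
    by (induction rule: frag_induction) (use one assms in auto)
qed (use assms in auto)

lemma ez_map_chain: "ez f (map_chain h x) (map_chain h' y) = ez (\<lambda>a b. f (h a) (h' b)) x y"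
  by (rule bilinear_frag_eqI[where S = UNIV and T = UNIV and
        F = "\<lambda>x y. ez f (map_chain h x) (map_chain h' y)"]) (auto simp: ez_list_map)

lemma map_chain_ez: "map_chain h (ez f x y) = ez (\<lambda>a b. h (f a b)) x y"
  by (rule bilinear_frag_eqI[where S = UNIV and T = UNIV and F = "\<lambda>x y. map_chain h (ez f x y)"])
    (auto simp: map_chain_ez_list)

lemma ez_cong:
  assumes "keys x \<subseteq> lists A" "keys y \<subseteq> lists B" "\<And>a b. \<lbrakk>a \<in> A; b \<in> B\<rbrakk> \<Longrightarrow> f a b = g a b"
  shows "ez f x y = ez g x y"
  by (rule bilinear_frag_eqI[OF assms(1,2)]) (auto intro!: ez_list_cong assms(3))

lemma ez_assoc:
  assumes "keys x \<subseteq> lists A" "keys y \<subseteq> lists B" "keys z \<subseteq> lists C"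
    and "\<And>a b c. \<lbrakk>a \<in> A; b \<in> B; c \<in> C\<rbrakk> \<Longrightarrow> f (g a b) c = f' a (g' b c)"
  shows "ez f (ez g x y) z = ez f' x (ez g' y z)"
  using assms(3)
proof (induction rule: frag_induction)
  case (one zs)
  show ?case
    by (rule bilinear_frag_eqI[OF assms(1,2), where F = "\<lambda>x y. ez f (ez g x y) (frag_of zs)"])
      (use one in \<open>auto intro!: ez_list_assoc assms(4)\<close>)
qed auto

lemma ez_commute:
  assumes "keys x \<subseteq> {xs. length xs = m}" "keys y \<subseteq> {ys. length ys = n}"
  shows "ez f x y = frag_cmul ((- 1) ^ ((m - 1) * (n - 1))) (ez (\<lambda>b a. f a b) y x)"
  by (rule bilinear_frag_eqI[OF assms,
       where G = "\<lambda>x y. frag_cmul ((- 1) ^ ((m - 1) * (n - 1))) (ez (\<lambda>b a. f a b) y x)"])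
    (auto simp: frag_cmul_diff simp del: One_nat_def intro!: ez_list_commute)

text \<open>
  Both sides are triple shuffle products with the same labels, but with \<open>y\<close> and \<open>z\<close> in different
  order. Associativity isolates the product of \<open>y\<close> and \<open>z\<close>, to which commutativity applies.
\<close>

lemma ez_par_assoc:
  assumes "keys x \<subseteq> lists A" "keys y \<subseteq> lists B" "keys z \<subseteq> lists C"
    and "keys y \<subseteq> {ys. length ys = m}" "keys z \<subseteq> {zs. length zs = n}"
    and "\<And>a b c. \<lbrakk>a \<in> A; b \<in> B; c \<in> C\<rbrakk> \<Longrightarrow> f (g a b) c = f' (g' a c) b"
  shows "ez f (ez g x y) z = frag_cmul ((- 1) ^ ((m - 1) * (n - 1))) (ez f' (ez g' x z) y)"
proof -
  let ?F = "\<lambda>a (b, c). f (g a b) c"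
  have "ez f (ez g x y) z = ez ?F x (ez Pair y z)"
    by (rule ez_assoc[OF assms(1-3)]) auto
  also have "\<dots> = frag_cmul ((- 1) ^ ((m - 1) * (n - 1))) (ez ?F x (ez (\<lambda>c b. (b, c)) z y))"
    by (subst ez_commute[OF assms(4,5)]) simp
  also have "ez ?F x (ez (\<lambda>c b. (b, c)) z y) = ez f' (ez g' x z) y"
    by (rule ez_assoc[OF assms(1,3,2), symmetric]) (auto simp: assms(6))
  finally show ?thesis .
qed

text \<open>
  Normalisation removes the empty simplex, hence the extra summand in \<open>aug_bd_ez_list\<close>.
\<close>

lemma normalise_aug_bd_ez:
  assumes "keys x \<subseteq> {xs. length xs = m}"
  shows "normalise (aug_bd (ez f x y)) =
    normalise (ez f (aug_bd x) y) - frag_cmul ((- 1) ^ m) (normalise (ez f x (aug_bd y)))"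
  by (rule bilinear_frag_eqI[OF assms subset_UNIV,
       where F = "\<lambda>x y. normalise (aug_bd (ez f x y))" and
       G = "\<lambda>x y. normalise (ez f (aug_bd x) y) - frag_cmul ((- 1) ^ m) (normalise (ez f x (aug_bd y)))"])
    (auto simp: aug_bd_ez_list frag_cmul_diff simplex_def nondegenerate_def)

lemma ez_list_vertex_left: "ys \<noteq> [] \<Longrightarrow> ez_list f [u] ys = frag_of (map (f u) ys)"
  by (induction ys rule: list_nonempty_induct) auto

lemma ez_list_vertex_right: "xs \<noteq> [] \<Longrightarrow> ez_list f xs [u] = frag_of (map (\<lambda>x. f x u) xs)"
  by (induction xs rule: list_nonempty_induct) auto

section \<open>The Barratt--Eccles operad\<close>

lemma barratt_eccles_simps [simp]:
  "Grp barratt_eccles r d = free_Abelian_group (be_basis r d)"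
  "Bd barratt_eccles r d = be_boundary"
  "Act barratt_eccles r d = be_act"
  "Unit barratt_eccles = frag_of [id]"
  "Comp barratt_eccles r d s e k = be_comp s k"
  by (simp_all add: barratt_eccles_def)

lemma be_act_eq: "be_act g = map_chain ((\<circ>) g)"
  by (simp add: be_act_def map_chain_def)

text \<open>
  Degenerate tuples included, and the empty tuple in degree \<open>-1\<close>: the simplices that occur before
  normalisation.
\<close>

definition tuples :: "nat \<Rightarrow> int \<Rightarrow> (nat \<Rightarrow> nat) list set"
  where "tuples r d = {xs \<in> lists (carrier (sym_group r)). int (length xs) = d + 1}"

lemma be_basis_eq: "be_basis r d = {xs \<in> tuples r d. nondegenerate xs}"
  by (auto simp: be_basis_def tuples_def)

lemma
  assumes "keys x \<subseteq> be_basis r d"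
  shows Nil_notin_keys: "[] \<notin> keys x"
    and keys_tuples: "keys x \<subseteq> tuples r d"
    and keys_lists: "keys x \<subseteq> lists (carrier (sym_group r))"
    and keys_length: "keys x \<subseteq> {xs. length xs = nat (d + 1)}"
    and normalise_basis: "normalise x = x"
proof -
  show "[] \<notin> keys x" "keys x \<subseteq> tuples r d" "keys x \<subseteq> lists (carrier (sym_group r))"
      "keys x \<subseteq> {xs. length xs = nat (d + 1)}"
    using assms by (auto simp: be_basis_eq tuples_def nondegenerate_def)
  have "normalise x = frag_extend frag_of x"
    using assms unfolding normalise_def
    by (intro frag_extend_eq) (auto simp: be_basis_eq simplex_def)
  then show "normalise x = x" by (simp flip: frag_expansion)
qed

lemma keys_normalise: "keys (normalise a) \<subseteq> {xs \<in> keys a. nondegenerate xs}"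
  unfolding normalise_def
  by (rule order_trans[OF keys_frag_extend]) (auto simp: simplex_def split: if_splits)

lemma keys_normalise_be_basis: "keys a \<subseteq> tuples r d \<Longrightarrow> keys (normalise a) \<subseteq> be_basis r d"
  using keys_normalise[of a] by (auto simp: be_basis_eq)

lemma Nil_notin_keys_normalise [simp]: "[] \<notin> keys (normalise a)"
  using keys_normalise[of a] by (auto simp: nondegenerate_def)

lemma keys_aug_bd: "keys a \<subseteq> tuples r d \<Longrightarrow> keys (aug_bd a) \<subseteq> tuples r (d - 1)"
  unfolding aug_bd_def
  by (rule order_trans[OF keys_frag_extend]) (use keys_aug_bd_list in \<open>fastforce simp: tuples_def\<close>)

lemma keys_be_boundary: "keys x \<subseteq> be_basis r d \<Longrightarrow> keys (be_boundary x) \<subseteq> be_basis r (d - 1)"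
  unfolding be_boundary_eq by (intro keys_normalise_be_basis keys_aug_bd keys_tuples)

lemma keys_ez:
  assumes "keys x \<subseteq> tuples r d" "keys y \<subseteq> tuples s e"
    and "\<And>a b. \<lbrakk>a \<in> carrier (sym_group r); b \<in> carrier (sym_group s)\<rbrakk> \<Longrightarrow> f a b \<in> carrier (sym_group t)"
  shows "keys (ez f x y) \<subseteq> tuples t (d + e)"
proof -
  have "keys (ez_list f xs ys) \<subseteq> tuples t (d + e)" if "xs \<in> keys x" "ys \<in> keys y" for xs ys
  proof
    fix zs assume "zs \<in> keys (ez_list f xs ys)"
    then have "Suc (length zs) = length xs + length ys"
      "set zs \<subseteq> {f x y |x y. x \<in> set xs \<and> y \<in> set ys}"
      using subsetD[OF keys_ez_list \<open>zs \<in> _\<close>] by simp_all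
    moreover have "int (length xs) = d + 1" "int (length ys) = e + 1"
      "set xs \<subseteq> carrier (sym_group r)" "set ys \<subseteq> carrier (sym_group s)"
      using assms that by (auto simp: tuples_def)
    ultimately show "zs \<in> tuples t (d + e)"
      using assms(3) by (auto simp: tuples_def; blast)
  qed
  then show ?thesis
    unfolding ez_def
    by (intro order_trans[OF keys_frag_extend] UN_least) blast
qed

lemma perm_comp_closed:
  assumes "k \<in> {1..r}" "\<sigma> \<in> carrier (sym_group r)" "\<tau> \<in> carrier (sym_group s)"
  shows "perm_comp s k \<sigma> \<tau> \<in> carrier (sym_group (r + s - 1))"
  using perm_comp_permutes[OF assms(1)] assms(2,3) by (simp add: sym_group_carrier)

lemma keys_be_comp:
  assumes "k \<in> {1..r}" "keys x \<subseteq> be_basis r d" "keys y \<subseteq> be_basis s e"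
  shows "keys (be_comp s k x y) \<subseteq> be_basis (r + s - 1) (d + e)"
  unfolding be_comp_eq[OF Nil_notin_keys[OF assms(2)] Nil_notin_keys[OF assms(3)]]
  by (rule keys_normalise_be_basis, rule keys_ez[OF keys_tuples[OF assms(2)] keys_tuples[OF assms(3)]])
    (rule perm_comp_closed[OF assms(1)])

lemma comp_perm_closed:
  "\<lbrakk>g \<in> carrier (sym_group r); a \<in> carrier (sym_group r)\<rbrakk> \<Longrightarrow> g \<circ> a \<in> carrier (sym_group r)"
  by (simp add: sym_group_carrier permutes_compose)

lemma inj_comp: "g permutes A \<Longrightarrow> inj ((\<circ>) g)"
  by (intro injI) (metis comp_assoc fun.map_id permutes_inv_o(2) id_comp)

lemma nondegenerate_map_comp:
  "g permutes A \<Longrightarrow> nondegenerate (map ((\<circ>) g) xs) \<longleftrightarrow> nondegenerate xs"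
  unfolding nondegenerate_def
  using distinct_adj_map_iff[OF inj_on_subset[OF inj_comp subset_UNIV], of g A xs] by simp

lemma keys_be_act:
  assumes "g \<in> carrier (sym_group r)" "keys x \<subseteq> be_basis r d"
  shows "keys (be_act g x) \<subseteq> be_basis r d"
proof -
  have "map ((\<circ>) g) xs \<in> be_basis r d" if "xs \<in> keys x" for xs
  proof -
    have xs: "xs \<in> be_basis r d" using assms(2) that by blast
    then have "set (map ((\<circ>) g) xs) \<subseteq> carrier (sym_group r)"
      using assms(1) by (auto simp: be_basis_def intro!: comp_perm_closed)
    moreover have "nondegenerate (map ((\<circ>) g) xs)"
      using xs assms(1) nondegenerate_map_comp[of g "{1..r}" xs]
      by (simp add: be_basis_def sym_group_carrier)
    ultimately show ?thesis using xs by (simp add: be_basis_def)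
  qed
  then show ?thesis
    unfolding be_act_def by (intro order_trans[OF keys_frag_extend]) auto
qed

lemma normalise_be_act:
  assumes "g permutes A"
  shows "normalise (be_act g a) = be_act g (normalise a)"
proof -
  have *: "simplex (map ((\<circ>) g) xs) = map_chain ((\<circ>) g) (simplex xs)" for xs
    unfolding simplex_def nondegenerate_map_comp[OF assms] by simp
  show ?thesis
    unfolding be_act_eq
  proof (rule frag_induction[where S = UNIV and c = a])
    show "normalise (map_chain ((\<circ>) g) (frag_of xs)) = map_chain ((\<circ>) g) (normalise (frag_of xs))" for xs
      unfolding map_chain_simps normalise_simps by (rule *)
  qed auto
qed

lemma be_act_simps [simp]:
  "be_act g 0 = 0" "be_act g (a + b) = be_act g a + be_act g b"
  "be_act g (a - b) = be_act g a - be_act g b" "be_act g (- a) = - be_act g a"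
  "be_act g (frag_cmul n a) = frag_cmul n (be_act g a)"
  "be_act g (frag_of xs) = frag_of (map ((\<circ>) g) xs)"
  unfolding be_act_eq by simp_all

lemma be_act_id [simp]: "be_act id x = x"
proof (rule frag_induction[where S = UNIV and c = x])
  show "be_act id (frag_of xs) = frag_of xs" for xs
    unfolding be_act_simps by (rule arg_cong[of _ _ frag_of]) (simp add: map_idI)
qed auto

lemma be_act_comp: "be_act (g \<circ> h) x = be_act g (be_act h x)"
proof (rule frag_induction[where S = UNIV and c = x])
  show "be_act (g \<circ> h) (frag_of xs) = be_act g (be_act h (frag_of xs))" for xs
    unfolding be_act_simps by (rule arg_cong[of _ _ frag_of]) (simp add: comp_assoc)
qed auto

lemma aug_bd_be_act: "aug_bd (be_act g x) = be_act g (aug_bd x)"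
  by (simp add: be_act_eq aug_bd_map_chain)

lemma be_boundary_be_act: "g permutes A \<Longrightarrow> be_boundary (be_act g x) = be_act g (be_boundary x)"
  by (simp add: be_boundary_eq normalise_be_act aug_bd_be_act)

lemma ksign_eq: "d \<ge> 0 \<Longrightarrow> ksign d = (- 1) ^ nat d"
  by (simp add: ksign_def even_nat_iff)

lemma be_basis_neg: "d < 0 \<Longrightarrow> be_basis r d = {}"
  by (auto simp: be_basis_def nondegenerate_def simp flip: length_greater_0_conv)

lemma gamma_module_barratt_eccles: "gamma_module sym_group barratt_eccles"
proof (rule gamma_module.intro)
  fix r d x g h
  show "comm_group (Grp barratt_eccles r d)"
    by (simp add: abelian_free_Abelian_group)
  show "Bd barratt_eccles r d \<in> hom (Grp barratt_eccles r d) (Grp barratt_eccles r (d - 1))"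
    by (auto simp: hom_def keys_be_boundary[THEN subsetD] be_boundary_eq[of "_ + _"])
      (simp_all add: be_boundary_eq)
  show "Bd barratt_eccles r (d - 1) (Bd barratt_eccles r d x) = \<one>\<^bsub>Grp barratt_eccles r (d - 2)\<^esub>"
    by (simp add: be_boundary_eq)
  show "Act barratt_eccles r d \<one>\<^bsub>sym_group r\<^esub> x = x"
    by (simp add: sym_group_one)
  show "Act barratt_eccles r d (g \<otimes>\<^bsub>sym_group r\<^esub> h) x = Act barratt_eccles r d g (Act barratt_eccles r d h x)"
    by (simp add: sym_group_mult be_act_comp)
  assume g: "g \<in> carrier (sym_group r)"
  show "Act barratt_eccles r d g \<in> hom (Grp barratt_eccles r d) (Grp barratt_eccles r d)"
    using keys_be_act[OF g] by (auto simp: hom_def)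
  show "Bd barratt_eccles r d (Act barratt_eccles r d g x) = Act barratt_eccles r (d - 1) g (Bd barratt_eccles r d x)"
    using g by (simp add: sym_group_carrier be_boundary_be_act)
qed

lemma be_comp_simps:
  assumes "keys x \<subseteq> be_basis r d" "keys y \<subseteq> be_basis s e"
  shows "be_comp s k x y = normalise (ez (perm_comp s k) x y)"
  using assms by (intro be_comp_eq Nil_notin_keys)

lemma operad_barratt_eccles: "operad barratt_eccles"
proof (intro operad.intro operad_axioms.intro gamma_module_barratt_eccles)
  fix k r s :: nat and d e :: int and x y :: be_elem
  assume k: "k \<in> {1..r}"
  show "(\<lambda>x. Comp barratt_eccles r d s e k x y)
      \<in> hom (Grp barratt_eccles r d) (Grp barratt_eccles (r + s - 1) (d + e))"
    if "y \<in> carrier (Grp barratt_eccles s e)"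
    using that keys_be_comp[OF k] by (intro homI) (auto simp: be_comp_def frag_extend_add)
  show "(\<lambda>y. Comp barratt_eccles r d s e k x y)
      \<in> hom (Grp barratt_eccles s e) (Grp barratt_eccles (r + s - 1) (d + e))"
    if "x \<in> carrier (Grp barratt_eccles r d)"
    using that keys_be_comp[OF k]
    by (intro homI) (auto simp: be_comp_def frag_extend_add frag_extend_linear)
  assume x: "x \<in> carrier (Grp barratt_eccles r d)" and y: "y \<in> carrier (Grp barratt_eccles s e)"
  then have xy: "keys x \<subseteq> be_basis r d" "keys y \<subseteq> be_basis s e" by auto
  note Bx = keys_be_boundary[OF xy(1)] and By = keys_be_boundary[OF xy(2)]
  have "keys (be_comp s k x (be_boundary y)) \<subseteq> be_basis (r + s - 1) (d + e - 1)"
    using keys_be_comp[OF k xy(1) By] by (simp add: algebra_simps)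
  moreover have "be_boundary (be_comp s k x y) =
      be_comp s k (be_boundary x) y + frag_cmul (ksign d) (be_comp s k x (be_boundary y))"
  proof (cases "d < 0")
    case True
    then have "x = 0" using xy be_basis_neg by auto
    then show ?thesis by (simp add: be_comp_def be_boundary_eq)
  next
    case False
    then have "- ((- 1) ^ nat (d + 1)) = ksign d"
      by (simp add: ksign_eq nat_add_distrib)
    then show ?thesis
      unfolding be_comp_simps[OF xy] be_comp_simps[OF Bx xy(2)] be_comp_simps[OF xy(1) By]
      by (simp add: be_boundary_eq normalise_aug_bd_ez[OF keys_length[OF xy(1)]])
  qed
  ultimately show "Bd barratt_eccles (r + s - 1) (d + e) (Comp barratt_eccles r d s e k x y) =
          Comp barratt_eccles r (d - 1) s e k (Bd barratt_eccles r d x) y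
            \<otimes>\<^bsub>Grp barratt_eccles (r + s - 1) (d + e - 1)\<^esub>
          (Comp barratt_eccles r d s (e - 1) k x (Bd barratt_eccles s e y)
            [^]\<^bsub>Grp barratt_eccles (r + s - 1) (d + e - 1)\<^esub> ksign d)"
    by simp
next
  fix i j r s t :: nat and d e f :: int and x y z :: be_elem
  assume ij: "i \<in> {1..r}" "j \<in> {1..s}"
    and "x \<in> carrier (Grp barratt_eccles r d)" "y \<in> carrier (Grp barratt_eccles s e)"
      "z \<in> carrier (Grp barratt_eccles t f)"
  then have k: "keys x \<subseteq> be_basis r d" "keys y \<subseteq> be_basis s e" "keys z \<subseteq> be_basis t f" by auto
  have "ez (perm_comp t (i + j - 1)) (ez (perm_comp s i) x y) z =
      ez (perm_comp (s + t - 1) i) x (ez (perm_comp t j) y z)"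
    by (rule ez_assoc[OF k[THEN keys_lists]])
      (use ij in \<open>auto simp: sym_group_carrier intro!: perm_comp_seq_assoc simp del: One_nat_def\<close>)
  then show "Comp barratt_eccles (r + s - 1) (d + e) t f (i + j - 1) (Comp barratt_eccles r d s e i x y) z =
          Comp barratt_eccles r d (s + t - 1) (e + f) i x (Comp barratt_eccles s e t f j y z)"
    using keys_be_comp[OF ij(1) k(1,2)] keys_be_comp[OF ij(2) k(2,3)] k
    by (simp add: be_comp_simps del: One_nat_def)
next
  fix i k r s t :: nat and d e f :: int and x y z :: be_elem
  assume ik: "1 \<le> i" "i < k" "k \<le> r"
    and "x \<in> carrier (Grp barratt_eccles r d)" "y \<in> carrier (Grp barratt_eccles s e)"
      "z \<in> carrier (Grp barratt_eccles t f)"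
  then have ks: "keys x \<subseteq> be_basis r d" "keys y \<subseteq> be_basis s e" "keys z \<subseteq> be_basis t f"
    and i: "i \<in> {1..r}" and k: "k \<in> {1..r}" by auto
  have i': "i \<in> {1..r + t - 1}" using ik by auto
  note xy = keys_be_comp[OF i ks(1,2)] and xz = keys_be_comp[OF k ks(1,3)]
  have xzy: "keys (be_comp s i (be_comp t k x z) y) \<subseteq> be_basis (r + s + t - 2) (d + e + f)"
  proof -
    have "r + t - 1 + s - 1 = r + s + t - 2" "d + f + e = d + e + f" using ik by auto
    with keys_be_comp[OF i' xz ks(2)] show ?thesis by (simp only:)
  qed
  have "be_comp t (k + s - 1) (be_comp s i x y) z =
      frag_cmul (ksign (e * f)) (be_comp s i (be_comp t k x z) y)"
  proof (cases "e < 0 \<or> f < 0")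
    case True
    then have "y = 0 \<or> z = 0" using ks be_basis_neg by auto
    then show ?thesis by (auto simp: be_comp_def frag_extend_linear)
  next
    case False
    then have s: "(- 1) ^ ((nat (e + 1) - 1) * (nat (f + 1) - 1)) = ksign (e * f)"
      by (simp add: ksign_eq nat_mult_distrib nat_add_distrib)
    have "ez (perm_comp t (k + s - 1)) (ez (perm_comp s i) x y) z =
        frag_cmul (ksign (e * f)) (ez (perm_comp s i) (ez (perm_comp t k) x z) y)"
      unfolding s[symmetric]
      by (rule ez_par_assoc[OF ks[THEN keys_lists] ks(2,3)[THEN keys_length]])
        (use ik in \<open>auto simp: sym_group_carrier intro!: perm_comp_par_assoc simp del: One_nat_def\<close>)
    then show ?thesis
      using xy xz ks by (simp add: be_comp_simps del: One_nat_def)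
  qed
  then show "Comp barratt_eccles (r + s - 1) (d + e) t f (k + s - 1) (Comp barratt_eccles r d s e i x y) z =
          Comp barratt_eccles (r + t - 1) (d + f) s e i (Comp barratt_eccles r d t f k x z) y
            [^]\<^bsub>Grp barratt_eccles (r + s + t - 2) (d + e + f)\<^esub> ksign (e * f)"
    using xzy by simp
next
  have u: "frag_of [id] \<in> carrier (free_Abelian_group (be_basis 1 0))"
    by (simp add: be_basis_def nondegenerate_def sym_group_def permutes_id)
  then show "Unit barratt_eccles \<in> carrier (Grp barratt_eccles 1 0)" by simp
  show "Bd barratt_eccles 1 0 (Unit barratt_eccles) = \<one>\<^bsub>Grp barratt_eccles 1 (- 1)\<^esub>"
    by (simp add: be_boundary_eq simplex_def nondegenerate_def)
  fix r k d and x :: be_elem assume "x \<in> carrier (Grp barratt_eccles r d)"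
  then have x: "keys x \<subseteq> be_basis r d" by simp
  have u': "[] \<notin> keys (frag_of [id :: nat \<Rightarrow> nat])" by simp
  have "ez (perm_comp r 1) (frag_of [id]) x = x"
  proof -
    have "ez (perm_comp r 1) (frag_of [id]) x = frag_extend frag_of x"
      unfolding ez_def frag_extend_of
    proof (rule frag_extend_eq)
      fix xs assume "xs \<in> keys x"
      then have "xs \<noteq> []" "\<And>\<sigma>. \<sigma> \<in> set xs \<Longrightarrow> \<sigma> permutes {1..r}"
        using x by (auto simp: be_basis_eq tuples_def nondegenerate_def sym_group_carrier)
      then show "ez_list (perm_comp r 1) [id] xs = frag_of xs"
        by (simp add: ez_list_vertex_left map_idI perm_comp_unit_left del: One_nat_def)
    qed
    then show ?thesis by (simp flip: frag_expansion)
  qed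
  then show "Comp barratt_eccles 1 0 r d 1 (Unit barratt_eccles) x = x"
    by (simp add: be_comp_eq[OF u' Nil_notin_keys[OF x]] normalise_basis[OF x] del: One_nat_def)
  assume k: "k \<in> {1..r}"
  have "ez (perm_comp 1 k) x (frag_of [id]) = x"
  proof -
    have "ez (perm_comp 1 k) x (frag_of [id]) = frag_extend frag_of x"
      unfolding ez_def frag_extend_of
    proof (rule frag_extend_eq)
      fix xs assume "xs \<in> keys x"
      then have "xs \<noteq> []" "\<And>\<sigma>. \<sigma> \<in> set xs \<Longrightarrow> \<sigma> permutes {1..r}"
        using x by (auto simp: be_basis_eq tuples_def nondegenerate_def sym_group_carrier)
      then show "ez_list (perm_comp 1 k) xs [id] = frag_of xs"
        using k by (simp add: ez_list_vertex_right map_idI perm_comp_unit_right[where r = r] del: One_nat_def)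
    qed
    then show ?thesis by (simp flip: frag_expansion)
  qed
  then show "Comp barratt_eccles r d 1 0 k x (Unit barratt_eccles) = x"
    by (simp add: be_comp_eq[OF Nil_notin_keys[OF x] u'] normalise_basis[OF x] del: One_nat_def)
next
  fix k r s :: nat and \<sigma> \<tau> and d e :: int and x y :: be_elem
  assume k: "k \<in> {1..r}" and \<sigma>: "\<sigma> \<in> carrier (sym_group r)" and \<tau>: "\<tau> \<in> carrier (sym_group s)"
    and "x \<in> carrier (Grp barratt_eccles r d)" and "y \<in> carrier (Grp barratt_eccles s e)"
  then have xy: "keys x \<subseteq> be_basis r d" "keys y \<subseteq> be_basis s e" by auto
  let ?w = "perm_comp s k \<sigma> \<tau>" and ?j = "Hilbert_Choice.inv \<sigma> k"
  have w: "?w permutes {1..r + s - 1}"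
    using perm_comp_closed[OF k \<sigma> \<tau>] by (simp add: sym_group_carrier)
  have "be_comp s k (be_act \<sigma> x) (be_act \<tau> y) =
      normalise (ez (\<lambda>a b. perm_comp s k (\<sigma> \<circ> a) (\<tau> \<circ> b)) x y)"
    unfolding be_comp_simps[OF keys_be_act[OF \<sigma> xy(1)] keys_be_act[OF \<tau> xy(2)]]
    by (simp add: be_act_eq ez_map_chain)
  also have "ez (\<lambda>a b. perm_comp s k (\<sigma> \<circ> a) (\<tau> \<circ> b)) x y = ez (\<lambda>a b. ?w \<circ> perm_comp s ?j a b) x y"
    by (rule ez_cong[OF keys_lists[OF xy(1)] keys_lists[OF xy(2)]])
      (use k \<sigma> \<tau> in \<open>auto simp: sym_group_carrier intro!: perm_comp_comp simp del: One_nat_def\<close>)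
  also have "\<dots> = be_act ?w (ez (perm_comp s ?j) x y)"
    by (simp add: be_act_eq map_chain_ez)
  also have "normalise \<dots> = be_act ?w (be_comp s ?j x y)"
    by (simp add: normalise_be_act[OF w] be_comp_simps[OF xy])
  finally show "Comp barratt_eccles r d s e k (Act barratt_eccles r d \<sigma> x) (Act barratt_eccles s e \<tau> y) =
      Act barratt_eccles (r + s - 1) (d + e) ?w (Comp barratt_eccles r d s e ?j x y)"
    by simp
qed

section \<open>Recognising quasi-isomorphisms\<close>

context gamma_module
begin

lemma Bd_group_hom: "group_hom (Grp M r d) (Grp M r (d - 1)) (Bd M r d)"
  using Grp_comm_group[THEN comm_group.axioms(2)] Bd_hom
  by (auto simp: group_hom_def group_hom_axioms_def)

lemma subgroup_cycles: "subgroup (cycles M r d) (Grp M r d)"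
  unfolding cycles_def by (rule group_hom.subgroup_kernel[OF Bd_group_hom])

lemma subgroup_boundaries: "subgroup (boundaries M r d) (Grp M r d)"
  using group_hom.img_is_subgroup[OF Bd_group_hom[of r "d + 1"]] by (simp add: boundaries_def)

lemma boundaries_subset_cycles: "boundaries M r d \<subseteq> cycles M r d"
proof
  fix x assume "x \<in> boundaries M r d"
  then obtain y where "y \<in> carrier (Grp M r (d + 1))" "x = Bd M r (d + 1) y"
    by (auto simp: boundaries_def)
  then show "x \<in> cycles M r d"
    using Bd_Bd[of y r "d + 1"] hom_in_carrier[OF Bd_hom[of r "d + 1"], of y]
    by (simp add: cycles_def kernel_def)
qed

lemma
  shows homology_group: "group (homology M r d)"
    and homology_carrier: "carrier (homology M r d) =
      (\<lambda>x. boundaries M r d #>\<^bsub>Grp M r d\<^esub> x) ` cycles M r d"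
    and homology_one: "\<one>\<^bsub>homology M r d\<^esub> = boundaries M r d"
    and homology_mult: "\<lbrakk>x \<in> cycles M r d; y \<in> cycles M r d\<rbrakk> \<Longrightarrow>
      (boundaries M r d #>\<^bsub>Grp M r d\<^esub> x) \<otimes>\<^bsub>homology M r d\<^esub> (boundaries M r d #>\<^bsub>Grp M r d\<^esub> y) =
       boundaries M r d #>\<^bsub>Grp M r d\<^esub> (x \<otimes>\<^bsub>Grp M r d\<^esub> y)"
proof -
  interpret G: comm_group "Grp M r d" by (rule Grp_comm_group)
  let ?Z = "subgroup_generated (Grp M r d) (cycles M r d)"
  have cZ: "carrier ?Z = cycles M r d"
    by (rule subgroup.carrier_subgroup_generated_subgroup[OF subgroup_cycles])
  have Z: "comm_group ?Z" by (rule G.abelian_subgroup_generated) (rule Grp_comm_group)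
  have B: "subgroup (boundaries M r d) ?Z"
    using subgroup_boundaries[of r d] boundaries_subset_cycles[of r d]
    by (simp add: G.subgroup_of_subgroup_generated)
  have N: "boundaries M r d \<lhd> ?Z"
    using Z B by (simp add: comm_group.normal_iff_subgroup)
  have r: "r_coset ?Z (boundaries M r d) x = r_coset (Grp M r d) (boundaries M r d) x" for x
    by (simp add: r_coset_def)
  show "group (homology M r d)"
    unfolding homology_def by (rule normal.factorgroup_is_group[OF N])
  show "carrier (homology M r d) = (\<lambda>x. boundaries M r d #>\<^bsub>Grp M r d\<^esub> x) ` cycles M r d"
    by (simp add: homology_def carrier_FactGroup cZ r)
  show "\<one>\<^bsub>homology M r d\<^esub> = boundaries M r d"
    by (simp add: homology_def)
  show "(boundaries M r d #>\<^bsub>Grp M r d\<^esub> x) \<otimes>\<^bsub>homology M r d\<^esub> (boundaries M r d #>\<^bsub>Grp M r d\<^esub> y) =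
       boundaries M r d #>\<^bsub>Grp M r d\<^esub> (x \<otimes>\<^bsub>Grp M r d\<^esub> y)"
    if "x \<in> cycles M r d" "y \<in> cycles M r d"
    using normal.rcos_sum[OF N, of x y] that by (simp add: cZ r homology_def)
qed

end

context gamma_morphism
begin

lemma f_cycles: "x \<in> cycles M r d \<Longrightarrow> f r d x \<in> cycles N r d"
  using mor_Bd[of x r d] hom_in_carrier[OF mor_hom[of r d]]
    hom_one[OF mor_hom[of r "d - 1"] dom.Grp_comm_group[THEN comm_group.axioms(2)]
      cod.Grp_comm_group[THEN comm_group.axioms(2)]]
  by (auto simp: cycles_def kernel_def)

lemma f_boundaries: "x \<in> boundaries M r d \<Longrightarrow> f r d x \<in> boundaries N r d"
  using mor_Bd[of _ r "d + 1"] hom_in_carrier[OF mor_hom[of r "d + 1"]]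
  by (fastforce simp: boundaries_def)

lemma homology_map_coset:
  assumes x: "x \<in> cycles M r d"
  shows "homology_map M N f r d (boundaries M r d #>\<^bsub>Grp M r d\<^esub> x) =
    boundaries N r d #>\<^bsub>Grp N r d\<^esub> f r d x"
proof -
  interpret G: comm_group "Grp M r d" by (rule dom.Grp_comm_group)
  interpret H: comm_group "Grp N r d" by (rule cod.Grp_comm_group)
  interpret B: subgroup "boundaries M r d" "Grp M r d" by (rule dom.subgroup_boundaries)
  interpret B': subgroup "boundaries N r d" "Grp N r d" by (rule cod.subgroup_boundaries)
  have xc: "x \<in> carrier (Grp M r d)" "f r d x \<in> carrier (Grp N r d)"
    using x hom_in_carrier[OF mor_hom[of r d]] by (auto simp: cycles_def kernel_def)
  have f: "f r d (b \<otimes>\<^bsub>Grp M r d\<^esub> x) = f r d b \<otimes>\<^bsub>Grp N r d\<^esub> f r d x" if "b \<in> boundaries M r d" for b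
    using hom_mult[OF mor_hom] that xc by simp
  show ?thesis
  proof (intro equalityI subsetI)
    fix z assume "z \<in> homology_map M N f r d (boundaries M r d #>\<^bsub>Grp M r d\<^esub> x)"
    then obtain b b' where b: "b' \<in> boundaries N r d" "b \<in> boundaries M r d"
      "z = b' \<otimes>\<^bsub>Grp N r d\<^esub> (f r d b \<otimes>\<^bsub>Grp N r d\<^esub> f r d x)"
      by (auto simp: homology_map_def set_mult_def r_coset_def f)
    then have "z = (b' \<otimes>\<^bsub>Grp N r d\<^esub> f r d b) \<otimes>\<^bsub>Grp N r d\<^esub> f r d x"
      using f_boundaries xc by (simp add: H.m_assoc)
    moreover have "b' \<otimes>\<^bsub>Grp N r d\<^esub> f r d b \<in> boundaries N r d"
      using b f_boundaries by simp
    ultimately show "z \<in> boundaries N r d #>\<^bsub>Grp N r d\<^esub> f r d x"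
      by (auto simp: r_coset_def)
  next
    fix z assume "z \<in> boundaries N r d #>\<^bsub>Grp N r d\<^esub> f r d x"
    then obtain b' where "b' \<in> boundaries N r d" "z = b' \<otimes>\<^bsub>Grp N r d\<^esub> f r d x"
      by (auto simp: r_coset_def)
    moreover have "x \<in> boundaries M r d #>\<^bsub>Grp M r d\<^esub> x"
      by (rule G.rcos_self[OF xc(1) dom.subgroup_boundaries])
    ultimately show "z \<in> homology_map M N f r d (boundaries M r d #>\<^bsub>Grp M r d\<^esub> x)"
      by (auto simp: homology_map_def set_mult_def)
  qed
qed

text \<open>
  On classes, \<open>f\<close> acts by \<open>homology_map_coset\<close>. The first hypothesis gives surjectivity, and
  the second one says that the kernel is trivial.
\<close>

lemma quasi_isoI:
  assumes surj: "\<And>r d z. z \<in> cycles N r d \<Longrightarrow>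
      \<exists>w\<in>cycles M r d. \<exists>b\<in>boundaries N r d. z = b \<otimes>\<^bsub>Grp N r d\<^esub> f r d w"
    and inj: "\<And>r d w. \<lbrakk>w \<in> cycles M r d; f r d w \<in> boundaries N r d\<rbrakk> \<Longrightarrow> w \<in> boundaries M r d"
  shows "quasi_iso M N f"
  unfolding quasi_iso_def
proof (intro allI)
  fix r d
  interpret G: comm_group "Grp M r d" by (rule dom.Grp_comm_group)
  interpret H: comm_group "Grp N r d" by (rule cod.Grp_comm_group)
  let ?h = "homology_map M N f r d"
  have cyc: "x \<in> carrier (Grp M r d)" if "x \<in> cycles M r d" for x
    using that by (simp add: cycles_def kernel_def)
  have cyc': "x \<in> carrier (Grp N r d)" if "x \<in> cycles N r d" for x
    using that by (simp add: cycles_def kernel_def)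
  have sub': "boundaries N r d \<subseteq> carrier (Grp N r d)"
    by (rule subgroup.subset[OF cod.subgroup_boundaries])
  have "?h \<in> hom (homology M r d) (homology N r d)"
  proof (rule homI)
    fix X assume "X \<in> carrier (homology M r d)"
    then show "?h X \<in> carrier (homology N r d)"
      by (auto simp: dom.homology_carrier cod.homology_carrier homology_map_coset f_cycles)
  next
    fix X Y assume "X \<in> carrier (homology M r d)" "Y \<in> carrier (homology M r d)"
    then obtain x y where x: "x \<in> cycles M r d" "X = boundaries M r d #>\<^bsub>Grp M r d\<^esub> x"
      and y: "y \<in> cycles M r d" "Y = boundaries M r d #>\<^bsub>Grp M r d\<^esub> y"
      by (auto simp: dom.homology_carrier)
    have xy: "x \<otimes>\<^bsub>Grp M r d\<^esub> y \<in> cycles M r d"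
      using x y subgroup.m_closed[OF dom.subgroup_cycles] by blast
    show "?h (X \<otimes>\<^bsub>homology M r d\<^esub> Y) = ?h X \<otimes>\<^bsub>homology N r d\<^esub> ?h Y"
      using x y xy hom_mult[OF mor_hom[of r d] cyc[OF x(1)] cyc[OF y(1)]]
      by (simp add: dom.homology_mult cod.homology_mult homology_map_coset f_cycles)
  qed
  then interpret h: group_hom "homology M r d" "homology N r d" ?h
    using dom.homology_group cod.homology_group by (auto simp: group_hom_def group_hom_axioms_def)
  show "?h \<in> iso (homology M r d) (homology N r d)"
    unfolding h.iso_iff
  proof (intro conjI subsetI ballI impI)
    fix Z assume "Z \<in> carrier (homology N r d)"
    then obtain z where z: "z \<in> cycles N r d" "Z = boundaries N r d #>\<^bsub>Grp N r d\<^esub> z"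
      by (auto simp: cod.homology_carrier)
    from surj[OF z(1)] obtain w b where w: "w \<in> cycles M r d" and b: "b \<in> boundaries N r d"
      and zb: "z = b \<otimes>\<^bsub>Grp N r d\<^esub> f r d w" by blast
    have "Z = (boundaries N r d #>\<^bsub>Grp N r d\<^esub> b) #>\<^bsub>Grp N r d\<^esub> f r d w"
      unfolding z(2) zb using b sub' cyc'[OF f_cycles[OF w]]
      by (intro H.coset_mult_assoc[symmetric]) auto
    also have "boundaries N r d #>\<^bsub>Grp N r d\<^esub> b = boundaries N r d"
      using b sub' by (intro H.coset_join2 cod.subgroup_boundaries) auto
    finally have "Z = ?h (boundaries M r d #>\<^bsub>Grp M r d\<^esub> w)"
      by (simp add: homology_map_coset w)
    then show "Z \<in> ?h ` carrier (homology M r d)"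
      using w by (auto simp: dom.homology_carrier)
  next
    fix X assume "X \<in> carrier (homology M r d)" and one: "?h X = \<one>\<^bsub>homology N r d\<^esub>"
    then obtain x where x: "x \<in> cycles M r d" "X = boundaries M r d #>\<^bsub>Grp M r d\<^esub> x"
      by (auto simp: dom.homology_carrier)
    have "f r d x \<in> boundaries N r d"
      using one x H.rcos_self[OF cyc'[OF f_cycles[OF x(1)]] cod.subgroup_boundaries]
      by (simp add: homology_map_coset cod.homology_one)
    from inj[OF x(1) this] show "X = \<one>\<^bsub>homology M r d\<^esub>"
      unfolding x(2) dom.homology_one by (intro G.coset_join2 cyc x(1) dom.subgroup_boundaries)
  qed
qed

end

section \<open>Augmentations\<close>

definition coeff_sum :: "('a \<Rightarrow>\<^sub>0 int) \<Rightarrow> int"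
  where "coeff_sum x = lookup (frag_extend (\<lambda>_. frag_of ()) x) ()"

lemma coeff_sum_simps [simp]:
  "coeff_sum 0 = 0" "coeff_sum (a + b) = coeff_sum a + coeff_sum b"
  "coeff_sum (a - b) = coeff_sum a - coeff_sum b" "coeff_sum (- a) = - coeff_sum a"
  "coeff_sum (frag_cmul n a) = n * coeff_sum a" "coeff_sum (frag_of g) = 1"
  by (simp_all add: coeff_sum_def frag_extend_add frag_extend_diff frag_extend_minus
      frag_extend_cmul lookup_add lookup_minus)

section \<open>The Barratt--Eccles complexes are free resolutions\<close>

lemma aug_bd_vertices: "keys x \<subseteq> tuples r 0 \<Longrightarrow> aug_bd x = frag_cmul (coeff_sum x) (frag_of [])"
proof (induction rule: frag_induction)
  case (one xs)
  then have "length xs = Suc 0" by (simp add: tuples_def)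
  then show ?case by (auto simp: length_Suc_conv)
qed (auto simp: frag_cmul_diff_distrib)

text \<open>
  In the augmented complex, \<open>\<partial>(1 x) = x - 1 (\<partial> x)\<close> where \<open>1 x\<close> puts the identity in front of
  each simplex. The hypotheses state that the augmented boundary of \<open>x\<close> is degenerate, so \<open>x\<close> is the
  boundary of \<open>1 x\<close>.
\<close>

lemma barratt_eccles_exact:
  assumes x: "keys x \<subseteq> be_basis r d" and cyc: "be_boundary x = 0" and aug: "d = 0 \<Longrightarrow> coeff_sum x = 0"
  shows "x \<in> boundaries barratt_eccles r d"
proof -
  have "reduce (aug_bd x) = 0"
  proof (cases "d = 0")
    case True
    then show ?thesis using aug_bd_vertices[of x r] keys_tuples[OF x] aug by simp
  next
    case False
    have "[] \<notin> keys (aug_bd x)"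
      using keys_aug_bd[OF keys_tuples[OF x]] False by (auto simp: tuples_def)
    then show ?thesis using cyc by (simp add: reduce_eq_normalise be_boundary_eq)
  qed
  then have "normalise (prepend id (aug_bd x)) = 0"
    by (intro normalise_0_if_reduce_0 reduce_prepend_eq_0)
  then have "be_boundary (normalise (prepend id x)) = x"
    by (simp add: be_boundary_eq normalise_basis[OF x])
  moreover have "keys (normalise (prepend id x)) \<subseteq> be_basis r (d + 1)"
  proof (rule keys_normalise_be_basis)
    have "keys (prepend id x) \<subseteq> (#) id ` tuples r d"
      using keys_prepend[of id x] keys_tuples[OF x] by blast
    also have "\<dots> \<subseteq> tuples r (d + 1)"
      by (auto simp: tuples_def sym_group_def permutes_id)
    finally show "keys (prepend id x) \<subseteq> tuples r (d + 1)" .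
  qed
  ultimately show ?thesis
    unfolding boundaries_def by (intro image_eqI[where x = "normalise (prepend id x)"]) auto
qed

lemma coeff_sum_be_act [simp]: "coeff_sum (be_act g x) = coeff_sum x"
  by (rule frag_induction[where S = UNIV and c = x]) auto

lemma coeff_sum_be_boundary: "keys y \<subseteq> be_basis r 1 \<Longrightarrow> coeff_sum (be_boundary y) = 0"
proof (induction rule: frag_induction)
  case (one xs)
  then have "length xs = Suc (Suc 0)" by (simp add: be_basis_def)
  then obtain a b where "xs = [a, b]" by (auto simp: length_Suc_conv)
  then show ?case by (simp add: be_boundary_eq simplex_def nondegenerate_def)
qed (auto simp: be_boundary_eq)

definition augmentation :: "nat \<Rightarrow> int \<Rightarrow> be_elem \<Rightarrow> int"
  where "augmentation r d x = (if d = 0 then coeff_sum x else 0)"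

lemma singleton_group_simps [simp]:
  "\<one>\<^bsub>singleton_group a\<^esub> = a" "x \<otimes>\<^bsub>singleton_group a\<^esub> y = a"
  by (simp_all add: singleton_group_def)

lemma gamma_module_const_int: "gamma_module sym_group const_int"
  by (rule gamma_module.intro) (auto simp: const_int_def hom_def abelian_integer_group)

lemma augmentation_morphism: "S_morphism barratt_eccles const_int augmentation"
proof (intro gamma_morphism.intro gamma_module_barratt_eccles gamma_module_const_int
    gamma_morphism_axioms.intro)
  fix r d g and x :: be_elem
  show "augmentation r d \<in> hom (Grp barratt_eccles r d) (Grp const_int r d)"
    by (auto simp: hom_def augmentation_def const_int_def)
  assume "x \<in> carrier (Grp barratt_eccles r d)"
  then have x: "keys x \<subseteq> be_basis r d" by simp
  then show "augmentation r (d - 1) (Bd barratt_eccles r d x) = Bd const_int r d (augmentation r d x)"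
    using coeff_sum_be_boundary[of x r] by (auto simp: augmentation_def const_int_def)
  show "augmentation r d (Act barratt_eccles r d g x) = Act const_int r d g (augmentation r d x)"
    by (simp add: augmentation_def const_int_def)
qed

lemma vertex_id_basis: "[id] \<in> be_basis r 0"
  by (simp add: be_basis_def nondegenerate_def sym_group_def permutes_id)

lemma be_boundary_vertices: "keys x \<subseteq> be_basis r 0 \<Longrightarrow> be_boundary x = 0"
  using keys_be_boundary[of x r 0] be_basis_neg[of "-1" r] by simp

lemma cycles_barratt_eccles:
  "x \<in> cycles barratt_eccles r d \<longleftrightarrow> keys x \<subseteq> be_basis r d \<and> be_boundary x = 0"
  by (auto simp: cycles_def kernel_def)

lemma augmentation_quasi_iso: "quasi_iso barratt_eccles const_int augmentation"
proof (rule gamma_morphism.quasi_isoI[OF augmentation_morphism])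
  fix r d z assume z: "z \<in> cycles const_int r d"
  have b: "0 \<in> boundaries const_int r d"
    using subgroup.one_closed[OF gamma_module.subgroup_boundaries[OF gamma_module_const_int], of r d]
    by (simp add: const_int_def split: if_splits)
  show "\<exists>w\<in>cycles barratt_eccles r d. \<exists>b\<in>boundaries const_int r d.
      z = b \<otimes>\<^bsub>Grp const_int r d\<^esub> augmentation r d w"
  proof (cases "d = 0")
    case True
    have "keys (frag_cmul z (frag_of [id :: nat \<Rightarrow> nat])) \<subseteq> be_basis r 0"
      using keys_cmul vertex_id_basis by fastforce
    then have "frag_cmul z (frag_of [id]) \<in> cycles barratt_eccles r d"
      using True by (simp add: cycles_barratt_eccles be_boundary_vertices)
    then show ?thesis
      using True b by (intro bexI[of _ "frag_cmul z (frag_of [id])"] bexI[of _ 0])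
        (auto simp: augmentation_def const_int_def)
  next
    case False
    then have "z = 0" using z by (simp add: cycles_def kernel_def const_int_def)
    moreover have "0 \<in> cycles barratt_eccles r d" by (simp add: cycles_barratt_eccles be_boundary_eq)
    ultimately show ?thesis
      using False b by (intro bexI[of _ 0] bexI[of _ 0])
        (auto simp: augmentation_def const_int_def)
  qed
next
  fix r d w assume w: "w \<in> cycles barratt_eccles r d"
    and "augmentation r d w \<in> boundaries const_int r d"
  then have "augmentation r d w = 0" by (auto simp: boundaries_def const_int_def)
  then show "w \<in> boundaries barratt_eccles r d"
    using w barratt_eccles_exact[of w r d]
    by (auto simp: cycles_barratt_eccles augmentation_def split: if_splits)
qed

lemma finprod_free_Abelian_group:
  assumes "finite I" "\<And>i. i \<in> I \<Longrightarrow> keys (g i) \<subseteq> S"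
  shows "finprod (free_Abelian_group S) g I = sum g I"
proof -
  interpret comm_group "free_Abelian_group S" by (rule abelian_free_Abelian_group)
  show ?thesis
    using assms by (induction I rule: finite_induct) (auto simp: finprod_insert Pi_def)
qed

text \<open>
  If \<open>G\<close> permutes a basis \<open>X\<close> freely with transversal \<open>B\<close>, coefficients with respect to \<open>X\<close> and
  coefficients in the group ring with respect to \<open>B\<close> correspond along \<open>(g, b) \<mapsto> g b\<close>.
\<close>

lemma free_group_ring_module_free_Abelian_group:
  assumes "B \<subseteq> X" and act: "\<And>g b. \<lbrakk>g \<in> carrier G; b \<in> B\<rbrakk> \<Longrightarrow> act g (frag_of b) = frag_of (m g b)"
    and bij: "bij_betw (\<lambda>(g, b). m g b) (carrier G \<times> B) X"
  shows "free_group_ring_module G (free_Abelian_group X) act"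
  unfolding free_group_ring_module_def
proof (intro exI[of _ "frag_of ` B"] conjI ballI)
  show "frag_of ` B \<subseteq> carrier (free_Abelian_group X)"
    using assms(1) by auto
  fix x assume "x \<in> carrier (free_Abelian_group X)"
  then have x: "keys x \<subseteq> X" by simp
  let ?G = "carrier G \<times> frag_of ` B"
  \<comment> \<open>The basis element \<open>act g b\<close>, read off from its only key; \<open>b\<close> is itself of the form \<open>frag_of a\<close>.\<close>
  define u where "u = (\<lambda>(g, b). the_elem (keys (act g b)))"
  have u: "act g (frag_of b) = frag_of (u (g, frag_of b))" "u (g, frag_of b) = m g b"
    if "g \<in> carrier G" "b \<in> B" for g b
    using act[OF that] by (auto simp: u_def)
  have fin: "finprod (free_Abelian_group X)
        (\<lambda>(g, b). act g b [^]\<^bsub>free_Abelian_group X\<^esub> lookup c (g, b)) (keys c) =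
      frag_extend (frag_of \<circ> u) c" if c: "keys c \<subseteq> ?G" for c
  proof -
    have *: "(case i of (g, b) \<Rightarrow> act g b [^]\<^bsub>free_Abelian_group X\<^esub> lookup c (g, b)) =
        frag_cmul (lookup c i) (frag_of (u i)) \<and> u i \<in> X" if ik: "i \<in> keys c" for i
    proof -
      obtain g b where i: "i = (g, frag_of b)" "g \<in> carrier G" "b \<in> B"
        using c ik by blast
      then have "m g b \<in> X" using bij by (auto simp: bij_betw_def)
      then show ?thesis using i u by simp
    qed
    have "finprod (free_Abelian_group X)
        (\<lambda>(g, b). act g b [^]\<^bsub>free_Abelian_group X\<^esub> lookup c (g, b)) (keys c) =
        (\<Sum>i\<in>keys c. case i of (g, b) \<Rightarrow> act g b [^]\<^bsub>free_Abelian_group X\<^esub> lookup c (g, b))"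
      by (rule finprod_free_Abelian_group) (use * keys_cmul in \<open>fastforce+\<close>)
    also have "\<dots> = frag_extend (frag_of \<circ> u) c"
      unfolding frag_extend_def using * by (intro sum.cong) auto
    finally show ?thesis .
  qed
  have bij_u: "bij_betw u ?G X"
  proof -
    have "bij_betw frag_of B (frag_of ` B)"
      by (auto simp: bij_betw_def inj_on_def frag_of_eq)
    then have "bij_betw (map_prod id frag_of) (carrier G \<times> B) ?G"
      by (intro bij_betw_map_prod) auto
    moreover have "bij_betw (u \<circ> map_prod id frag_of) (carrier G \<times> B) X"
      using bij by (rule bij_betw_cong[THEN iffD1, rotated]) (auto simp: u)
    ultimately show ?thesis using bij_betw_comp_iff by blast
  qed
  define v where "v = inv_into ?G u"
  have v: "v a \<in> ?G" "u (v a) = a" if "a \<in> X" for a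
    using that bij_u inv_into_into[of a u ?G] f_inv_into_f[of a u ?G]
    unfolding v_def bij_betw_def by blast+
  have vu: "v (u i) = i" if "i \<in> ?G" for i
    using that bij_u inv_into_f_f[of u ?G i] unfolding v_def bij_betw_def by blast
  define c where "c = frag_extend (frag_of \<circ> v) x"
  have c: "keys c \<subseteq> ?G"
    unfolding c_def
  proof (rule order_trans[OF keys_frag_extend], rule UN_least)
    fix a assume "a \<in> keys x"
    then have "v a \<in> ?G" using x by (intro v) blast
    then show "keys ((frag_of \<circ> v) a) \<subseteq> ?G" by simp
  qed
  have "frag_extend (frag_of \<circ> u) c = frag_extend ((frag_of \<circ> u) \<circ> v) x"
    unfolding c_def by (rule frag_extend_compose)
  also have "\<dots> = frag_extend frag_of x"
    using x v by (intro frag_extend_eq) auto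
  finally have cx: "frag_extend (frag_of \<circ> u) c = x" by (simp flip: frag_expansion)
  show "\<exists>!c. keys c \<subseteq> ?G \<and> x = finprod (free_Abelian_group X)
        (\<lambda>(g, b). act g b [^]\<^bsub>free_Abelian_group X\<^esub> lookup c (g, b)) (keys c)"
  proof (intro ex1I[of _ c] conjI c)
    show "x = finprod (free_Abelian_group X)
        (\<lambda>(g, b). act g b [^]\<^bsub>free_Abelian_group X\<^esub> lookup c (g, b)) (keys c)"
      by (simp only: fin[OF c] cx)
    fix c' assume c': "keys c' \<subseteq> ?G \<and> x = finprod (free_Abelian_group X)
        (\<lambda>(g, b). act g b [^]\<^bsub>free_Abelian_group X\<^esub> lookup c' (g, b)) (keys c')"
    then have "x = frag_extend (frag_of \<circ> u) c'" by (simp only: fin)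
    then have "c = frag_extend ((frag_of \<circ> v) \<circ> u) c'"
      unfolding c_def by (simp only: frag_extend_compose)
    also have "\<dots> = frag_extend frag_of c'"
      using c' vu by (intro frag_extend_eq) auto
    finally show "c' = c" by (simp flip: frag_expansion)
  qed
qed

text \<open>
  The orbit of a simplex contains exactly one simplex that starts with the identity, obtained by acting
  with the inverse of the first vertex.
\<close>

lemma free_barratt_eccles:
  "free_group_ring_module (sym_group r) (Grp barratt_eccles r d) (Act barratt_eccles r d)"
  unfolding barratt_eccles_simps
proof (rule free_group_ring_module_free_Abelian_group)
  let ?B = "{xs \<in> be_basis r d. hd xs = id}" and ?m = "\<lambda>g. map ((\<circ>) g)"
  show "?B \<subseteq> be_basis r d" by blast
  show "be_act g (frag_of xs) = frag_of (?m g xs)" for g xs by simp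
  have closed: "map ((\<circ>) g) xs \<in> be_basis r d" if "g \<in> carrier (sym_group r)" "xs \<in> be_basis r d" for g xs
    using keys_be_act[OF that(1), of "frag_of xs" d] that by simp
  show "bij_betw (\<lambda>(g, xs). ?m g xs) (carrier (sym_group r) \<times> ?B) (be_basis r d)"
  proof (rule bij_betwI[where g = "\<lambda>ys. (hd ys, ?m (Hilbert_Choice.inv (hd ys)) ys)"])
    show "(\<lambda>(g, xs). ?m g xs) \<in> carrier (sym_group r) \<times> ?B \<rightarrow> be_basis r d"
      using closed by auto
    have hd: "hd ys \<in> carrier (sym_group r)" "ys \<noteq> []" if "ys \<in> be_basis r d" for ys
      using that by (auto simp: be_basis_def nondegenerate_def)
    have inv: "Hilbert_Choice.inv g \<in> carrier (sym_group r)" if "g \<in> carrier (sym_group r)" for g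
      using that by (simp add: sym_group_carrier permutes_inv)
    have comp: "Hilbert_Choice.inv g \<circ> g = id" "g \<circ> Hilbert_Choice.inv g = id"
      if "g \<in> carrier (sym_group r)" for g
      using that by (auto simp: sym_group_carrier permutes_inv_o)
    show "(\<lambda>ys. (hd ys, ?m (Hilbert_Choice.inv (hd ys)) ys)) \<in> be_basis r d \<rightarrow> carrier (sym_group r) \<times> ?B"
      using hd inv comp closed by (auto simp: hd_map)
    show "(hd (case p of (g, xs) \<Rightarrow> ?m g xs),
        ?m (Hilbert_Choice.inv (hd (case p of (g, xs) \<Rightarrow> ?m g xs))) (case p of (g, xs) \<Rightarrow> ?m g xs)) = p"
      if pin: "p \<in> carrier (sym_group r) \<times> ?B" for p
    proof -
      obtain g xs where p: "p = (g, xs)" "g \<in> carrier (sym_group r)" "xs \<in> be_basis r d" "hd xs = id"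
        using pin by auto
      have "hd (?m g xs) = g" using p hd[of xs] by (simp add: hd_map)
      moreover have "?m (Hilbert_Choice.inv g) (?m g xs) = xs"
        using comp[OF p(2)] by (simp add: map_idI flip: comp_assoc)
      ultimately show ?thesis using p(1) by simp
    qed
    show "(case (hd ys, ?m (Hilbert_Choice.inv (hd ys)) ys) of (g, xs) \<Rightarrow> ?m g xs) = ys"
      if "ys \<in> be_basis r d" for ys
      using comp[OF hd(1)[OF that]] by (simp add: map_idI flip: comp_assoc)
  qed
qed

lemma E_infinity_barratt_eccles: "E_infinity_operad barratt_eccles"
proof (intro E_infinity_operad.intro operad_barratt_eccles E_infinity_operad_axioms.intro)
  have "be_basis 0 0 = {[id]}"
    by (auto simp: be_basis_def nondegenerate_def sym_group_def length_Suc_conv)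
  then show "Grp barratt_eccles 0 0 \<cong> integer_group"
    using group.iso_sym[OF group_integer_group isomorphic_group_integer_free_Abelian_group_singleton]
    by simp
  show "trivial_group (Grp barratt_eccles 0 d)" if d: "d \<noteq> 0" for d
  proof -
    have "be_basis 0 d = {}"
    proof (intro equals0I)
      fix xs assume "xs \<in> be_basis 0 d"
      then have xs: "int (length xs) = d + 1" "set xs \<subseteq> {id}" "xs \<noteq> []" "distinct_adj xs"
        by (auto simp: be_basis_def nondegenerate_def sym_group_def)
      then obtain a ys where "xs = a # ys" by (cases xs) auto
      moreover then obtain b zs where "ys = b # zs" using xs d by (cases ys) auto
      ultimately show False using xs by auto
    qed
    then show ?thesis
      by (auto simp: trivial_group_def)
  qed
  show "\<exists>\<epsilon>. S_morphism barratt_eccles const_int \<epsilon> \<and> quasi_iso barratt_eccles const_int \<epsilon> \<and>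
      (\<forall>r d. free_group_ring_module (sym_group r) (Grp barratt_eccles r d) (Act barratt_eccles r d))"
    using augmentation_morphism augmentation_quasi_iso free_barratt_eccles by blast
qed

section \<open>Cyclic groups\<close>

lemma rot_funpow_apply:
  assumes "x \<in> {1..r}"
  shows "(rot r ^^ i) x = (x - 1 + i) mod r + 1"
proof (induction i)
  case 0
  then show ?case using assms by auto
next
  case (Suc i)
  let ?y = "(x - 1 + i) mod r"
  have y: "?y < r" using assms by auto
  have "(x - 1 + Suc i) mod r = Suc ?y mod r"
    by (simp add: mod_Suc_eq)
  then show ?case
    using Suc y by (auto simp: rot_def mod_Suc)
qed

lemma rot_funpow_outside: "x \<notin> {1..r} \<Longrightarrow> (rot r ^^ i) x = x"
  by (induction i) (auto simp: rot_def)

lemma rot_funpow_order: "rot r ^^ r = id"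
proof
  fix x
  show "(rot r ^^ r) x = id x"
  proof (cases "x \<in> {1..r}")
    case True
    then show ?thesis
      using mod_less[of "x - 1" r] unfolding rot_funpow_apply[OF True] mod_add_self2 by auto
  qed (simp add: rot_funpow_outside)
qed

lemma rot_zero: "rot 0 = id"
  by (auto simp: rot_def)

lemma inj_on_rot_funpow: "inj_on (\<lambda>i. rot r ^^ i) {..<r}"
proof (rule inj_onI)
  fix i j assume ij: "i \<in> {..<r}" "j \<in> {..<r}" and eq: "rot r ^^ i = rot r ^^ j"
  have "(rot r ^^ i) 1 = (rot r ^^ j) 1" by (simp only: eq)
  then show "i = j" using ij by (simp add: rot_funpow_apply)
qed

lemma rot_permutes: "rot r permutes {1..r}"
proof (cases "r = 0")
  case False
  then obtain n where r: "r = Suc n" by (cases r) auto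
  have "rot r ^^ n \<circ> rot r = id" "rot r \<circ> rot r ^^ n = id"
    using rot_funpow_order[of r] by (simp_all add: r funpow_Suc_right del: funpow.simps)
      (simp add: fun_eq_iff funpow_swap1)
  then have "bij (rot r)" by (rule o_bij)
  then show ?thesis
    unfolding permutes_def bij_iff by (auto simp: rot_def)
qed (simp add: rot_zero permutes_id)

lemma rot_funpow_permutes: "(rot r ^^ i) permutes {1..r}"
proof (induction i)
  case 0
  show ?case by (simp only: funpow.simps permutes_id)
next
  case (Suc i)
  show ?case by (simp only: funpow.simps) (rule permutes_compose[OF Suc rot_permutes])
qed

lemma rot_funpow_in_sym_group: "rot r ^^ i \<in> carrier (sym_group r)"
  by (simp only: sym_group_carrier rot_funpow_permutes)

lemma cyc_group_simps [simp]:
  "monoid.mult (cyc_group r) = (\<circ>)" "\<one>\<^bsub>cyc_group r\<^esub> = id"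
  by (simp_all add: cyc_group_def sym_group_mult sym_group_one)

lemma group_cyc_group: "group (cyc_group r)"
  unfolding cyc_group_def by (rule group.group_subgroup_generated[OF sym_group_is_group])

lemma carrier_cyc_group_subset: "carrier (cyc_group r) \<subseteq> carrier (sym_group r)"
  unfolding cyc_group_def by (rule group.carrier_subgroup_generated_subset[OF sym_group_is_group])

lemma rot_in_cyc_group: "rot r \<in> carrier (cyc_group r)"
  unfolding cyc_group_def
  using group.subgroup_generated_subset_carrier_subset[OF sym_group_is_group, of "{rot r}" r]
    rot_permutes by (simp add: sym_group_carrier)

lemma id_in_cyc_group: "id \<in> carrier (cyc_group r)"
  using group.is_monoid[OF group_cyc_group, THEN monoid.one_closed, of r] by simp

lemma comp_in_cyc_group:
  "\<lbrakk>g \<in> carrier (cyc_group r); h \<in> carrier (cyc_group r)\<rbrakk> \<Longrightarrow> g \<circ> h \<in> carrier (cyc_group r)"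
  using group.is_monoid[OF group_cyc_group, THEN monoid.m_closed, of g r h] by simp

text \<open>
  Natural powers suffice because \<open>\<rho>\<close> has finite order: the inverse of \<open>\<rho>\<^sup>i\<close> is \<open>\<rho>\<^bsup>ir-i\<^esup>\<close>.
\<close>

lemma carrier_cyc_group: "carrier (cyc_group r) = range (\<lambda>i. rot r ^^ i)"
proof
  show "range (\<lambda>i. rot r ^^ i) \<subseteq> carrier (cyc_group r)"
  proof clarify
    show "rot r ^^ i \<in> carrier (cyc_group r)" for i
    proof (induction i)
      case 0
      show ?case by (simp only: funpow.simps id_in_cyc_group)
    next
      case (Suc i)
      show ?case by (simp only: funpow.simps) (rule comp_in_cyc_group[OF rot_in_cyc_group Suc])
    qed
  qed
  have "subgroup (range (\<lambda>i. rot r ^^ i)) (sym_group r)"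
  proof (rule group.subgroupI[OF sym_group_is_group])
    show "range (\<lambda>i. rot r ^^ i) \<subseteq> carrier (sym_group r)" using rot_funpow_in_sym_group by auto
    show "range (\<lambda>i. rot r ^^ i) \<noteq> {}" by auto
    show "a \<otimes>\<^bsub>sym_group r\<^esub> b \<in> range (\<lambda>i. rot r ^^ i)"
      if "a \<in> range (\<lambda>i. rot r ^^ i)" "b \<in> range (\<lambda>i. rot r ^^ i)" for a b
      using that by (auto simp: sym_group_mult simp flip: funpow_add)
    show "inv\<^bsub>sym_group r\<^esub> a \<in> range (\<lambda>i. rot r ^^ i)" if a: "a \<in> range (\<lambda>i. rot r ^^ i)" for a
    proof -
      obtain i where i: "a = rot r ^^ i" using a by auto
      have "rot r ^^ (i * r - i) \<circ> a = rot r ^^ (i * r)" if "r > 0"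
        using that by (simp add: i flip: funpow_add)
      also have "rot r ^^ (i * r) = id"
        by (simp add: mult.commute[of i] funpow_mult[symmetric] rot_funpow_order)
      finally have "rot r ^^ (i * r - i) \<circ> a = id" if "r > 0" using that by simp
      moreover have "rot r ^^ (i * r - i) \<circ> a = id" if "r = 0"
        using that by (simp add: i rot_zero)
      ultimately have "rot r ^^ (i * r - i) \<circ> a = id" by blast
      then have "inv\<^bsub>sym_group r\<^esub> a = rot r ^^ (i * r - i)"
        by (intro group.inv_equality[OF sym_group_is_group])
          (auto simp: sym_group_mult sym_group_one i rot_funpow_in_sym_group)
      then show ?thesis by auto
    qed
  qed
  then show "carrier (cyc_group r) \<subseteq> range (\<lambda>i. rot r ^^ i)"
    unfolding cyc_group_def
    by (intro group.subgroup_generated_minimal[OF sym_group_is_group])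
      (auto intro: image_eqI[where x = 1])
qed

lemma carrier_cyc_group_lessThan:
  assumes "r > 0"
  shows "carrier (cyc_group r) = (\<lambda>i. rot r ^^ i) ` {..<r}"
proof -
  have *: "rot r ^^ (r * n) = id" for n
    by (simp add: funpow_mult[symmetric] rot_funpow_order)
  have "rot r ^^ i = rot r ^^ (i mod r)" for i
  proof -
    have "rot r ^^ i = rot r ^^ (i mod r + r * (i div r))" by simp
    also have "\<dots> = rot r ^^ (i mod r)"
      by (simp only: funpow_add * comp_id)
    finally show ?thesis .
  qed
  then show ?thesis
    unfolding carrier_cyc_group using assms by (auto intro!: image_eqI[where x = "_ mod r"])
qed

lemma carrier_cyc_group_0: "carrier (cyc_group 0) = {id}"
  by (auto simp: carrier_cyc_group rot_zero)

lemma finite_cyc_group: "finite (carrier (cyc_group r))"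
  by (cases "r = 0") (simp_all add: carrier_cyc_group_0 carrier_cyc_group_lessThan)

section \<open>The minimal resolutions\<close>

lemma gr_mult_simps [simp]:
  "gr_mult 0 b = 0" "gr_mult a 0 = 0"
  "gr_mult (a + a') b = gr_mult a b + gr_mult a' b" "gr_mult a (b + b') = gr_mult a b + gr_mult a b'"
  "gr_mult (a - a') b = gr_mult a b - gr_mult a' b" "gr_mult a (b - b') = gr_mult a b - gr_mult a b'"
  "gr_mult (frag_cmul n a) b = frag_cmul n (gr_mult a b)"
  "gr_mult a (frag_cmul n b) = frag_cmul n (gr_mult a b)"
  "gr_mult (frag_of g) (frag_of h) = frag_of (g \<circ> h)"
  by (auto simp: gr_mult_def frag_extend_add frag_extend_diff frag_extend_cmul frag_extend_linear)

lemma gr_mult_sum: "gr_mult a (sum f I) = (\<Sum>i\<in>I. gr_mult a (f i))"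
  by (induction I rule: infinite_finite_induct) auto

lemma gr_mult_sum_left: "gr_mult (sum f I) a = (\<Sum>i\<in>I. gr_mult (f i) a)"
  by (induction I rule: infinite_finite_induct) auto

lemma gr_mult_assoc: "gr_mult (gr_mult a b) c = gr_mult a (gr_mult b c)"
proof (rule frag_induction[where S = UNIV and c = c])
  show "gr_mult (gr_mult a b) (frag_of k) = gr_mult a (gr_mult b (frag_of k))" for k
    by (rule bilinear_frag_eqI[where S = UNIV and T = UNIV and
         F = "\<lambda>a b. gr_mult (gr_mult a b) (frag_of k)"]) (auto simp: comp_assoc)
qed auto

lemma gr_mult_one [simp]: "gr_mult (frag_of id) a = a" "gr_mult a (frag_of id) = a"
  by (rule frag_induction[where S = UNIV and c = a]; auto)+

lemma keys_gr_mult: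
  assumes "keys a \<subseteq> carrier (cyc_group r)" "keys b \<subseteq> carrier (cyc_group r)"
  shows "keys (gr_mult a b) \<subseteq> carrier (cyc_group r)"
proof -
  have "keys (frag_extend (\<lambda>h. frag_of (g \<circ> h)) b) \<subseteq> carrier (cyc_group r)" if "g \<in> keys a" for g
    using assms that by (intro order_trans[OF keys_frag_extend]) (auto intro!: comp_in_cyc_group)
  then show ?thesis
    unfolding gr_mult_def by (intro order_trans[OF keys_frag_extend]) blast
qed

lemma keys_T_elem: "keys (T_elem r) \<subseteq> carrier (cyc_group r)"
  unfolding T_elem_def
  by (rule order_trans[OF keys_diff]) (auto simp: rot_in_cyc_group id_in_cyc_group)

lemma keys_N_elem: "keys (N_elem r) \<subseteq> carrier (cyc_group r)"
  unfolding N_elem_def by (rule order_trans[OF keys_sum]) auto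

lemma gr_mult_N_left:
  assumes g: "g \<in> carrier (cyc_group r)"
  shows "gr_mult (frag_of g) (N_elem r) = N_elem r"
proof -
  have "bij_betw (\<lambda>h. g \<circ> h) (carrier (cyc_group r)) (carrier (cyc_group r))"
  proof (rule bij_betwI[where g = "\<lambda>h. inv\<^bsub>cyc_group r\<^esub> g \<circ> h"])
    have i: "inv\<^bsub>cyc_group r\<^esub> g \<in> carrier (cyc_group r)" "inv\<^bsub>cyc_group r\<^esub> g \<circ> g = id" "g \<circ> inv\<^bsub>cyc_group r\<^esub> g = id"
      using group.inv_closed[OF group_cyc_group g] group.l_inv[OF group_cyc_group g]
        group.r_inv[OF group_cyc_group g] by simp_all
    show "(\<lambda>h. g \<circ> h) \<in> carrier (cyc_group r) \<rightarrow> carrier (cyc_group r)"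
      "(\<lambda>h. inv\<^bsub>cyc_group r\<^esub> g \<circ> h) \<in> carrier (cyc_group r) \<rightarrow> carrier (cyc_group r)"
      using g i by (auto intro: comp_in_cyc_group)
    show "inv\<^bsub>cyc_group r\<^esub> g \<circ> (g \<circ> h) = h" "g \<circ> (inv\<^bsub>cyc_group r\<^esub> g \<circ> h) = h" for h
      by (simp_all add: i flip: comp_assoc)
  qed
  then show ?thesis
    unfolding N_elem_def gr_mult_sum gr_mult_simps by (rule sum.reindex_bij_betw)
qed

lemma gr_mult_N_right: "gr_mult (N_elem r) (frag_of (rot r)) = N_elem r"
proof -
  have "gr_mult (frag_of g) (frag_of (rot r)) = gr_mult (frag_of (rot r)) (frag_of g)"
    if "g \<in> carrier (cyc_group r)" for g
  proof -
    obtain i where "g = rot r ^^ i" using \<open>g \<in> _\<close> by (auto simp: carrier_cyc_group)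
    then have "g \<circ> rot r = rot r \<circ> g" by (simp add: fun_eq_iff funpow_swap1)
    then show ?thesis by simp
  qed
  then have "gr_mult (N_elem r) (frag_of (rot r)) = gr_mult (frag_of (rot r)) (N_elem r)"
    unfolding N_elem_def gr_mult_sum gr_mult_sum_left by (intro sum.cong) auto
  then show ?thesis by (simp add: gr_mult_N_left rot_in_cyc_group)
qed

lemma gr_mult_T_N: "gr_mult (T_elem r) (N_elem r) = 0" "gr_mult (N_elem r) (T_elem r) = 0"
  by (simp_all add: T_elem_def gr_mult_N_left gr_mult_N_right rot_in_cyc_group)

lemma gr_mult_N: "keys x \<subseteq> carrier (cyc_group r) \<Longrightarrow> gr_mult x (N_elem r) = frag_cmul (coeff_sum x) (N_elem r)"
  by (induction rule: frag_induction) (auto simp: gr_mult_N_left frag_cmul_diff_distrib)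

lemma N_elem_nonzero: "N_elem r \<noteq> 0"
proof -
  have "lookup (N_elem r) id = (\<Sum>g\<in>carrier (cyc_group r). if id = g then 1 else 0)"
    by (simp add: N_elem_def lookup_sum)
  also have "\<dots> = 1"
    using finite_cyc_group id_in_cyc_group by (simp add: sum.delta)
  finally show ?thesis by auto
qed

lemma coeff_sum_0_if_gr_mult_N_0:
  "\<lbrakk>keys x \<subseteq> carrier (cyc_group r); gr_mult x (N_elem r) = 0\<rbrakk> \<Longrightarrow> coeff_sum x = 0"
  using gr_mult_N[of x r] N_elem_nonzero[of r] by simp

text \<open>
  The element \<open>T\<close> generates the augmentation ideal since
  \<open>\<rho>\<^sup>i - 1 = (1 + \<rho> + \<dots> + \<rho>\<^bsup>i-1\<^esup>) T\<close>.
\<close>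

lemma augmentation_ideal_T:
  assumes "keys x \<subseteq> carrier (cyc_group r)"
  shows "\<exists>y. keys y \<subseteq> carrier (cyc_group r) \<and> gr_mult y (T_elem r) = x - frag_cmul (coeff_sum x) (frag_of id)"
  using assms
proof (induction rule: frag_induction)
  case zero
  show ?case by (intro exI[of _ 0]) simp
next
  case (one g)
  then obtain i where i: "g = rot r ^^ i" by (auto simp: carrier_cyc_group)
  have "gr_mult (\<Sum>j<i. frag_of (rot r ^^ j)) (T_elem r) = frag_of (rot r ^^ i) - frag_of id"
  proof (induction i)
    case (Suc i)
    have "gr_mult (frag_of (rot r ^^ i)) (T_elem r) = frag_of (rot r ^^ Suc i) - frag_of (rot r ^^ i)"
      by (simp only: T_elem_def gr_mult_simps gr_mult_one funpow_Suc_right)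
    then show ?case using Suc by (simp del: funpow.simps)
  qed simp
  moreover have "keys (\<Sum>j<i. frag_of (rot r ^^ j)) \<subseteq> carrier (cyc_group r)"
    by (rule order_trans[OF keys_sum]) (auto simp: carrier_cyc_group)
  ultimately show ?case by (intro exI[of _ "\<Sum>j<i. frag_of (rot r ^^ j)"]) (simp add: i id_def)
next
  case (diff a b)
  then obtain y z where "keys y \<subseteq> carrier (cyc_group r)" "keys z \<subseteq> carrier (cyc_group r)"
    "gr_mult y (T_elem r) = a - frag_cmul (coeff_sum a) (frag_of id)"
    "gr_mult z (T_elem r) = b - frag_cmul (coeff_sum b) (frag_of id)" by blast
  then show ?case
    using keys_diff[of y z] by (intro exI[of _ "y - z"]) (auto simp: frag_cmul_diff_distrib id_def)
qed

text \<open>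
  If \<open>x T = 0\<close>, then \<open>x \<rho> = x\<close>, so the coefficients of \<open>x\<close> are the same at all powers of \<open>\<rho>\<close>.
\<close>

lemma gr_mult_T_eq_0:
  assumes x: "keys x \<subseteq> carrier (cyc_group r)" and T: "gr_mult x (T_elem r) = 0"
  shows "x = frag_cmul (lookup x id) (N_elem r)"
proof -
  have inj: "g \<circ> rot r = h \<circ> rot r \<longleftrightarrow> g = h" for g h :: "nat \<Rightarrow> nat"
    using permutes_surj[OF rot_permutes[of r]] by (metis fun.map_comp o_assoc surj_iff comp_id)
  have shift: "lookup (gr_mult y (frag_of (rot r))) (g \<circ> rot r) = lookup y g" for y g
  proof (rule frag_induction[where S = UNIV and c = y])
    show "lookup (gr_mult (frag_of h) (frag_of (rot r))) (g \<circ> rot r) = lookup (frag_of h) g" for h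
      by (simp only: gr_mult_simps lookup_frag_of inj)
  qed (auto simp: lookup_minus)
  have "gr_mult x (frag_of (rot r)) = x" using T by (simp add: T_elem_def)
  then have step: "lookup x (g \<circ> rot r) = lookup x g" for g using shift[of x g] by simp
  have const: "lookup x (rot r ^^ i) = lookup x id" for i
  proof (induction i)
    case (Suc i)
    then show ?case by (simp only: funpow_Suc_right step)
  qed simp
  show ?thesis
  proof (rule poly_mapping_eqI)
    fix g
    have "lookup (N_elem r) g = (\<Sum>h\<in>carrier (cyc_group r). if g = h then 1 else 0)"
      by (simp add: N_elem_def lookup_sum)
    also have "\<dots> = (if g \<in> carrier (cyc_group r) then 1 else 0)"
      using finite_cyc_group by (simp add: sum.delta)
    finally have N: "lookup (N_elem r) g = (if g \<in> carrier (cyc_group r) then 1 else 0)" .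
    show "lookup x g = lookup (frag_cmul (lookup x id) (N_elem r)) g"
    proof (cases "g \<in> carrier (cyc_group r)")
      case True
      then show ?thesis using const N by (auto simp: carrier_cyc_group)
    next
      case False
      then have "g \<notin> keys x" using x by blast
      then show ?thesis using N False by (simp add: in_keys_iff)
    qed
  qed
qed

definition W_basis :: "nat \<Rightarrow> int \<Rightarrow> (nat \<Rightarrow> nat) set"
  where "W_basis r d = (if d \<ge> 0 then carrier (cyc_group r) else {})"

lemma W_module_simps [simp]:
  "Grp W_module r d = free_Abelian_group (W_basis r d)"
  "Bd W_module r d x =
     (if d \<le> 0 then 0 else if odd d then gr_mult x (T_elem r) else gr_mult x (N_elem r))"
  "Act W_module r d g x = gr_mult (frag_of g) x"
  by (simp_all add: W_module_def W_basis_def)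

lemma W_basis_subset: "W_basis r d \<subseteq> carrier (cyc_group r)"
  by (simp add: W_basis_def)

lemma keys_Bd_W: "keys x \<subseteq> W_basis r d \<Longrightarrow> keys (Bd W_module r d x) \<subseteq> W_basis r (d - 1)"
  using keys_gr_mult[OF _ keys_T_elem, of x r] keys_gr_mult[OF _ keys_N_elem, of x r]
  by (auto simp: W_basis_def)

lemma keys_Act_W:
  "\<lbrakk>g \<in> carrier (cyc_group r); keys x \<subseteq> W_basis r d\<rbrakk> \<Longrightarrow> keys (gr_mult (frag_of g) x) \<subseteq> W_basis r d"
  using keys_gr_mult[of "frag_of g" r x] by (auto simp: W_basis_def split: if_splits)

lemma gamma_module_W: "gamma_module cyc_group W_module"
proof (rule gamma_module.intro)
  fix r d g h and x :: "(nat \<Rightarrow> nat) \<Rightarrow>\<^sub>0 int"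
  show "comm_group (Grp W_module r d)"
    by (simp add: abelian_free_Abelian_group)
  show "Bd W_module r d \<in> hom (Grp W_module r d) (Grp W_module r (d - 1))"
  proof (rule homI)
    show "Bd W_module r d x \<in> carrier (Grp W_module r (d - 1))" if "x \<in> carrier (Grp W_module r d)" for x
      using keys_Bd_W[of x r d] that by (simp del: W_module_simps(2))
  qed simp
  show "Bd W_module r (d - 1) (Bd W_module r d x) = \<one>\<^bsub>Grp W_module r (d - 2)\<^esub>"
    by (simp add: gr_mult_assoc gr_mult_T_N)
  show "Act W_module r d \<one>\<^bsub>cyc_group r\<^esub> x = x" by simp
  show "Act W_module r d (g \<otimes>\<^bsub>cyc_group r\<^esub> h) x = Act W_module r d g (Act W_module r d h x)"
    by (simp flip: gr_mult_assoc)
  show "Bd W_module r d (Act W_module r d g x) = Act W_module r (d - 1) g (Bd W_module r d x)"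
    by (simp add: gr_mult_assoc)
  assume "g \<in> carrier (cyc_group r)"
  then show "Act W_module r d g \<in> hom (Grp W_module r d) (Grp W_module r d)"
    by (intro homI) (simp_all add: keys_Act_W)
qed

section \<open>The morphism into the Barratt--Eccles operad\<close>

text \<open>
  The sum of the tuples of \<open>psi_gen\<close> without the leading vertices \<open>\<rho>\<^sup>0\<close> or \<open>\<rho>\<^sup>0, \<rho>\<^sup>1\<close>.
\<close>

definition psi_tail :: "nat \<Rightarrow> nat \<Rightarrow> be_elem"
  where "psi_tail r m = (\<Sum>js\<in>{js. length js = m \<and> set js \<subseteq> {..<r}}.
    frag_of (concat (map (\<lambda>j. [rot r ^^ j, rot r ^^ (j + 1)]) js)))"

lemma psi_tail_0 [simp]: "psi_tail r 0 = frag_of []"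
proof -
  have "{js. length js = 0 \<and> set js \<subseteq> {..<r}} = {[]}" by auto
  then show ?thesis unfolding psi_tail_def by simp
qed

lemma psi_tail_Suc:
  "psi_tail r (Suc m) = (\<Sum>j<r. prepend (rot r ^^ j) (prepend (rot r ^^ Suc j) (psi_tail r m)))"
proof -
  let ?L = "\<lambda>m. {js. set js \<subseteq> {..<r} \<and> length js = m}"
  have eq: "psi_tail r m = (\<Sum>js\<in>?L m. frag_of (concat (map (\<lambda>j. [rot r ^^ j, rot r ^^ (j + 1)]) js)))" for m
    unfolding psi_tail_def by (simp add: conj_commute)
  have "inj_on (\<lambda>(xs, n). n # xs) (?L m \<times> {..<r})" by (auto simp: inj_on_def)
  then have "psi_tail r (Suc m) = (\<Sum>(js, j)\<in>?L m \<times> {..<r}.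
      frag_of ((rot r ^^ j) # (rot r ^^ Suc j) # concat (map (\<lambda>j. [rot r ^^ j, rot r ^^ (j + 1)]) js)))"
    unfolding eq lists_length_Suc_eq by (simp add: sum.reindex case_prod_unfold)
  also have "\<dots> = (\<Sum>j<r. \<Sum>js\<in>?L m.
      frag_of ((rot r ^^ j) # (rot r ^^ Suc j) # concat (map (\<lambda>j. [rot r ^^ j, rot r ^^ (j + 1)]) js)))"
    by (subst sum.swap) (simp add: sum.cartesian_product)
  finally show ?thesis unfolding eq prepend_sum by simp
qed

lemma psi_gen_eq:
  "psi_gen r (2 * m) = normalise (prepend id (psi_tail r m))"
  "psi_gen r (2 * m + 1) = normalise (prepend id (prepend (rot r) (psi_tail r m)))"
proof -
  have "psi_tuple r (2 * m) js = id # concat (map (\<lambda>j. [rot r ^^ j, rot r ^^ (j + 1)]) js)"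
    "psi_tuple r (2 * m + 1) js = id # rot r # concat (map (\<lambda>j. [rot r ^^ j, rot r ^^ (j + 1)]) js)" for js
    by (simp_all add: psi_tuple_def)
  then show "psi_gen r (2 * m) = normalise (prepend id (psi_tail r m))"
    "psi_gen r (2 * m + 1) = normalise (prepend id (prepend (rot r) (psi_tail r m)))"
    by (simp_all add: psi_gen_def psi_tail_def prepend_sum normalise_sum del: funpow.simps)
qed

lemma sum_cyclic_shift:
  fixes F :: "nat \<Rightarrow> 'a :: ab_group_add"
  assumes "F r = F 0"
  shows "(\<Sum>j<r. F (Suc j)) = (\<Sum>j<r. F j)"
proof -
  have "F 0 + (\<Sum>j<r. F (Suc j)) = (\<Sum>j<r. F j) + F r"
    using sum.lessThan_Suc_shift[of F r] by simp
  then show ?thesis using assms by (simp add: add.commute)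
qed

lemma aug_bd_sum: "aug_bd (sum f I) = (\<Sum>i\<in>I. aug_bd (f i))"
  by (induction I rule: infinite_finite_induct) auto

text \<open>
  Deleting the first vertex of the leading pair \<open>\<rho>\<^sup>j, \<rho>\<^bsup>j+1\<^esup>\<close> leaves \<open>\<rho>\<^bsup>j+1\<^esup>\<close>, deleting the second
  one leaves \<open>\<rho>\<^sup>j\<close>; summed over the residues \<open>j\<close> the two agree.
\<close>

lemma aug_bd_psi_tail: "aug_bd (psi_tail r m) = 0"
proof (induction m)
  case (Suc m)
  have "aug_bd (psi_tail r (Suc m)) = (\<Sum>j<r. prepend (rot r ^^ Suc j) (psi_tail r m)) -
      (\<Sum>j<r. prepend (rot r ^^ j) (psi_tail r m))"
    unfolding psi_tail_Suc aug_bd_sum by (simp add: Suc sum_subtractf)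
  also have "\<dots> = 0"
    using sum_cyclic_shift[of "\<lambda>j. prepend (rot r ^^ j) (psi_tail r m)" r]
    by (simp add: rot_funpow_order del: funpow.simps add: funpow.simps(1))
  finally show ?case .
qed simp

lemma be_act_prepend: "be_act g (prepend v a) = prepend (g \<circ> v) (be_act g a)"
  by (simp add: be_act_eq)

lemma be_act_sum: "be_act g (sum f I) = (\<Sum>i\<in>I. be_act g (f i))"
  by (induction I rule: infinite_finite_induct) auto

text \<open>
  Acting with \<open>\<rho>\<close> raises all exponents by one, a cyclic shift of each summation index.
\<close>

lemma be_act_rot_psi_tail: "be_act (rot r) (psi_tail r m) = psi_tail r m"
proof (induction m)
  case (Suc m)
  have "be_act (rot r) (psi_tail r (Suc m)) =
      (\<Sum>j<r. prepend (rot r ^^ Suc j) (prepend (rot r ^^ Suc (Suc j)) (psi_tail r m)))"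
    unfolding psi_tail_Suc be_act_sum be_act_prepend Suc by (simp add: comp_assoc)
  also have "\<dots> = psi_tail r (Suc m)"
    unfolding psi_tail_Suc
    by (rule sum_cyclic_shift[of "\<lambda>j. prepend (rot r ^^ j) (prepend (rot r ^^ Suc j) (psi_tail r m))"])
      (simp add: rot_funpow_order)
  finally show ?case .
qed simp

lemma be_act_rot_funpow_psi_tail: "be_act (rot r ^^ i) (psi_tail r m) = psi_tail r m"
  by (induction i) (simp_all only: funpow.simps be_act_comp be_act_rot_psi_tail be_act_id)

lemma be_boundary_psi_gen_odd:
  "be_boundary (psi_gen r (2 * m + 1)) = be_act (rot r) (psi_gen r (2 * m)) - psi_gen r (2 * m)"
  unfolding psi_gen_eq be_boundary_eq
  by (simp add: aug_bd_psi_tail be_act_prepend be_act_rot_psi_tail flip: normalise_be_act[OF rot_permutes])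

text \<open>
  The boundary is the normalised sum of the tuples in \<open>psi_tail r (m + 1)\<close>. Grouped by their first
  vertex \<open>\<rho>\<^sup>j\<close>, they are the translates by \<open>\<rho>\<^sup>j\<close> of the tuples in \<open>psi_gen r (2 m + 1)\<close>. For \<open>r = 0\<close> no
  exponents exist while the group has one element; there the right hand side vanishes since its tuples
  start with \<open>\<rho>\<^sup>0 = \<rho>\<^sup>1\<close>.
\<close>

lemma be_boundary_psi_gen_even:
  "be_boundary (psi_gen r (2 * m + 2)) = (\<Sum>g\<in>carrier (cyc_group r). be_act g (psi_gen r (2 * m + 1)))"
proof -
  have "psi_gen r (2 * m + 2) = normalise (prepend id (psi_tail r (Suc m)))"
    using psi_gen_eq(1)[of r "Suc m"] by simp
  then have l: "be_boundary (psi_gen r (2 * m + 2)) = normalise (psi_tail r (Suc m))"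
    by (simp add: be_boundary_eq aug_bd_psi_tail)
  show ?thesis
  proof (cases "r = 0")
    case True
    have "psi_gen r (2 * m + 1) = 0"
      unfolding psi_gen_eq using True
      by (simp add: rot_zero normalise_0_if_reduce_0 reduce_prepend_prepend)
    moreover have "psi_tail r (Suc m) = 0" using True by (simp add: psi_tail_Suc)
    ultimately show ?thesis unfolding l by simp
  next
    case False
    have "be_act (rot r ^^ j) (psi_gen r (2 * m + 1)) =
        normalise (prepend (rot r ^^ j) (prepend (rot r ^^ Suc j) (psi_tail r m)))" for j
    proof -
      have "rot r ^^ j \<circ> rot r = rot r ^^ Suc j" by (simp add: funpow_Suc_right del: funpow.simps)
      then show ?thesis
        unfolding psi_gen_eq
        by (simp add: be_act_prepend be_act_rot_funpow_psi_tail del: funpow.simps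
          flip: normalise_be_act[OF rot_funpow_permutes])
    qed
    then have "(\<Sum>g\<in>carrier (cyc_group r). be_act g (psi_gen r (2 * m + 1))) = normalise (psi_tail r (Suc m))"
      using False by (simp add: carrier_cyc_group_lessThan sum.reindex inj_on_rot_funpow
          psi_tail_Suc normalise_sum del: funpow.simps)
    then show ?thesis using l by simp
  qed
qed

lemma psi_BE_simps [simp]:
  "psi_BE r d 0 = 0" "psi_BE r d (a + b) = psi_BE r d a + psi_BE r d b"
  "psi_BE r d (a - b) = psi_BE r d a - psi_BE r d b"
  "psi_BE r d (frag_cmul n a) = frag_cmul n (psi_BE r d a)"
  "psi_BE r d (frag_of g) = be_act g (psi_gen r (nat d))"
  by (auto simp: psi_BE_def frag_extend_add frag_extend_diff frag_extend_cmul)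

lemma psi_BE_sum: "psi_BE r d (sum f I) = (\<Sum>i\<in>I. psi_BE r d (f i))"
  by (induction I rule: infinite_finite_induct) auto

lemma psi_BE_gr_mult: "psi_BE r d (gr_mult (frag_of g) x) = be_act g (psi_BE r d x)"
  by (rule frag_induction[where S = UNIV and c = x]) (auto simp: be_act_comp)

lemma keys_psi_gen: "keys (psi_gen r n) \<subseteq> be_basis r (int n)"
proof -
  have t: "keys (psi_tail r m) \<subseteq> tuples r (int (2 * m) - 1)" for m
  proof -
    have "concat (map (\<lambda>j. [rot r ^^ j, rot r ^^ (j + 1)]) js) \<in> tuples r (int (2 * length js) - 1)" for js
      using rot_funpow_in_sym_group
      by (induction js) (auto simp: tuples_def simp del: funpow.simps)
    then show ?thesis
      unfolding psi_tail_def by (intro order_trans[OF keys_sum]) auto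
  qed
  have p: "keys (prepend g a) \<subseteq> tuples r (d + 1)"
    if "g \<in> carrier (sym_group r)" "keys a \<subseteq> tuples r d" for g a d
  proof (rule order_trans[OF keys_prepend], rule image_subsetI)
    fix xs assume "xs \<in> keys a"
    then have "xs \<in> tuples r d" using that by blast
    then show "g # xs \<in> tuples r (d + 1)" using that by (simp add: tuples_def)
  qed
  have id: "id \<in> carrier (sym_group r)" and rot: "rot r \<in> carrier (sym_group r)"
    by (simp_all only: sym_group_carrier permutes_id rot_permutes)
  show ?thesis
  proof (cases "even n")
    case True
    then obtain m where n: "n = 2 * m" by blast
    show ?thesis unfolding n psi_gen_eq
      using p[OF id t, of m] by (intro keys_normalise_be_basis) simp
  next
    case False
    then obtain m where n: "n = 2 * m + 1" by (elim oddE)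
    show ?thesis unfolding n psi_gen_eq
      using p[OF id p[OF rot t], of m] by (intro keys_normalise_be_basis) (simp add: add.commute)
  qed
qed

lemma keys_psi_BE:
  assumes "keys x \<subseteq> W_basis r d"
  shows "keys (psi_BE r d x) \<subseteq> be_basis r d"
proof (cases "d \<ge> 0")
  case True
  have "keys (be_act g (psi_gen r (nat d))) \<subseteq> be_basis r d" if "g \<in> keys x" for g
    using that assms True carrier_cyc_group_subset[of r] keys_psi_gen[of r "nat d"]
    by (intro keys_be_act) (auto simp: W_basis_def)
  then show ?thesis
    unfolding psi_BE_def by (intro order_trans[OF keys_frag_extend]) blast
next
  case False
  then have "x = 0" using assms by (simp add: W_basis_def)
  then show ?thesis by simp
qed

lemma psi_BE_Bd:
  assumes x: "keys x \<subseteq> W_basis r d"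
  shows "psi_BE r (d - 1) (Bd W_module r d x) = be_boundary (psi_BE r d x)"
proof (cases "d \<le> 0")
  case True
  then have "be_basis r (d - 1) = {}" by (simp add: be_basis_neg)
  then have "be_boundary (psi_BE r d x) = 0"
    using keys_be_boundary[OF keys_psi_BE[OF x]] by simp
  then show ?thesis using True by simp
next
  case False
  have gen: "psi_BE r (d - 1) (Bd W_module r d (frag_of id)) = be_boundary (psi_gen r (nat d))"
  proof (cases "odd d")
    case True
    then obtain m where "d = 2 * m + 1" by (elim oddE)
    then have m: "nat d = 2 * nat m + 1" "nat (d - 1) = 2 * nat m" using False by auto
    show ?thesis
      using True False be_boundary_psi_gen_odd[of r "nat m"] by (simp add: T_elem_def m)
  next
    case even: False
    then obtain m where "d = 2 * m" by auto
    then have m: "nat d = 2 * (nat m - 1) + 2" "nat (d - 1) = 2 * (nat m - 1) + 1" using False by auto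
    show ?thesis
      using even False be_boundary_psi_gen_even[of r "nat m - 1"] by (simp add: N_elem_def m psi_BE_sum)
  qed
  have bd: "Bd W_module r d (gr_mult a b) = gr_mult a (Bd W_module r d b)" for a b
    by (simp add: gr_mult_assoc)
  have bd_diff: "Bd W_module r d (a - b) = Bd W_module r d a - Bd W_module r d b" "Bd W_module r d 0 = 0" for a b
    by simp_all
  have "keys x \<subseteq> carrier (cyc_group r)" using x W_basis_subset by blast
  then show ?thesis
  proof (induction rule: frag_induction)
    case (one g)
    then have g: "g permutes {1..r}"
      using carrier_cyc_group_subset unfolding sym_group_carrier[symmetric] by blast
    have "psi_BE r (d - 1) (Bd W_module r d (frag_of g)) =
        psi_BE r (d - 1) (gr_mult (frag_of g) (Bd W_module r d (frag_of id)))"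
      unfolding bd[symmetric] by simp
    also have "\<dots> = be_boundary (be_act g (psi_gen r (nat d)))"
      unfolding psi_BE_gr_mult gen by (rule be_boundary_be_act[OF g, symmetric])
    finally show ?case by simp
  next
    case zero
    show ?case by (simp add: be_boundary_eq)
  next
    case (diff a b)
    then show ?case unfolding bd_diff psi_BE_simps by (simp add: be_boundary_eq)
  qed
qed

lemma gamma_module_cyc_barratt_eccles: "gamma_module cyc_group barratt_eccles"
proof -
  interpret S: gamma_module sym_group barratt_eccles by (rule gamma_module_barratt_eccles)
  have sub: "g \<in> carrier (sym_group r)" if "g \<in> carrier (cyc_group r)" for g r
    using that carrier_cyc_group_subset by blast
  show ?thesis
    by (rule gamma_module.intro)
      (use S.Grp_comm_group S.Bd_hom S.Bd_Bd S.Act_hom[OF sub] S.Bd_Act[OF sub] in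
        \<open>simp_all add: be_act_comp del: barratt_eccles_simps(2)\<close>)
qed

lemma psi_BE_morphism: "C_morphism W_module barratt_eccles psi_BE"
proof (intro gamma_morphism.intro gamma_module_W gamma_module_cyc_barratt_eccles
    gamma_morphism_axioms.intro)
  fix r d g and x :: "(nat \<Rightarrow> nat) \<Rightarrow>\<^sub>0 int"
  show "psi_BE r d \<in> hom (Grp W_module r d) (Grp barratt_eccles r d)"
    by (intro homI) (simp_all add: keys_psi_BE)
  show "psi_BE r d (Act W_module r d g x) = Act barratt_eccles r d g (psi_BE r d x)"
    by (simp add: psi_BE_gr_mult)
  assume "x \<in> carrier (Grp W_module r d)"
  then show "psi_BE r (d - 1) (Bd W_module r d x) = Bd barratt_eccles r d (psi_BE r d x)"
    using psi_BE_Bd[of x r d] by simp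
qed

lemma psi_gen_0: "psi_gen r 0 = frag_of [id]"
  using psi_gen_eq(1)[of r 0] by (simp add: simplex_def nondegenerate_def)

lemma coeff_sum_psi_BE_0: "coeff_sum (psi_BE r 0 x) = coeff_sum x"
  by (rule frag_induction[where S = UNIV and c = x]) (auto simp: psi_gen_0)

text \<open>
  Exactness of the periodic resolution: the kernel of \<open>T\<close> is the image of \<open>N\<close>, and the kernel of \<open>N\<close>,
  which consists of the elements with coefficient sum zero, is the image of \<open>T\<close>.
\<close>

lemma W_module_exact:
  assumes x: "keys x \<subseteq> W_basis r d" and cyc: "Bd W_module r d x = 0"
    and aug: "d = 0 \<Longrightarrow> coeff_sum x = 0"
  shows "x \<in> boundaries W_module r d"
proof -
  have x': "keys x \<subseteq> carrier (cyc_group r)" using x W_basis_subset by blast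
  consider "d < 0" | "d \<ge> 0" "odd d" | "d \<ge> 0" "even d" by linarith
  then have "\<exists>y. keys y \<subseteq> W_basis r (d + 1) \<and> Bd W_module r (d + 1) y = x"
  proof cases
    case 1
    then have "x = 0" using x by (simp add: W_basis_def)
    then show ?thesis by (intro exI[of _ 0]) simp
  next
    case 2
    then have "d > 0" using order_le_less by fastforce
    then have "gr_mult x (T_elem r) = 0" using cyc 2 by simp
    then have "x = frag_cmul (lookup x id) (N_elem r)" by (rule gr_mult_T_eq_0[OF x'])
    moreover have "keys (frag_cmul (lookup x id) (frag_of id)) \<subseteq> carrier (cyc_group r)"
      using keys_cmul[of _ "frag_of id"] id_in_cyc_group by fastforce
    ultimately show ?thesis
      using 2 by (intro exI[of _ "frag_cmul (lookup x id) (frag_of id)"]) (auto simp: W_basis_def)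
  next
    case 3
    have "coeff_sum x = 0"
    proof (cases "d = 0")
      case False
      then show ?thesis using cyc 3 coeff_sum_0_if_gr_mult_N_0[OF x'] by simp
    qed (rule aug)
    with augmentation_ideal_T[OF x'] obtain y
      where "keys y \<subseteq> carrier (cyc_group r)" "gr_mult y (T_elem r) = x" by auto
    then show ?thesis using 3 by (intro exI[of _ y]) (auto simp: W_basis_def)
  qed
  then show ?thesis
    unfolding boundaries_def by (auto simp del: W_module_simps(2) intro!: image_eqI)
qed

text \<open>
  In nonzero degrees every cycle is a boundary on both sides. In degree zero, homology is detected by the
  coefficient sum, which \<open>\<psi>\<close> preserves; the class of \<open>z\<close> comes from the multiple
  \<open>coeff_sum z\<close> of the generator \<open>e\<^sub>0\<close>.
\<close>

lemma psi_BE_quasi_iso: "quasi_iso W_module barratt_eccles psi_BE"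
proof (rule gamma_morphism.quasi_isoI[OF psi_BE_morphism])
  fix r d z assume "z \<in> cycles barratt_eccles r d"
  then have z: "keys z \<subseteq> be_basis r d" "be_boundary z = 0" by (auto simp: cycles_barratt_eccles)
  show "\<exists>w\<in>cycles W_module r d. \<exists>b\<in>boundaries barratt_eccles r d.
      z = b \<otimes>\<^bsub>Grp barratt_eccles r d\<^esub> psi_BE r d w"
  proof (cases "d = 0")
    case True
    \<comment> \<open>Subtracting the image of this multiple of \<open>e\<^sub>0\<close> makes the coefficient sum vanish.\<close>
    let ?w = "frag_cmul (coeff_sum z) (frag_of id) :: (nat \<Rightarrow> nat) \<Rightarrow>\<^sub>0 int"
    have w: "keys ?w \<subseteq> W_basis r d"
      using keys_cmul[of _ "frag_of id"] id_in_cyc_group True by (fastforce simp: W_basis_def)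
    have b: "keys (z - psi_BE r d ?w) \<subseteq> be_basis r d"
      using z(1) keys_psi_BE[OF w] keys_diff[of z "psi_BE r d ?w"] by blast
    have "z - psi_BE r d ?w \<in> boundaries barratt_eccles r d"
      using b be_boundary_vertices[of "z - psi_BE r d ?w" r] True
      by (intro barratt_eccles_exact) (auto simp: psi_gen_0)
    moreover have "?w \<in> cycles W_module r d" using w True by (simp add: cycles_def kernel_def)
    ultimately show ?thesis by (intro bexI[of _ ?w] bexI[of _ "z - psi_BE r d ?w"]) auto
  next
    case False
    have "z \<in> boundaries barratt_eccles r d" using z False by (intro barratt_eccles_exact) auto
    moreover have "0 \<in> cycles W_module r d" by (simp add: cycles_def kernel_def)
    ultimately show ?thesis by (intro bexI[of _ 0] bexI[of _ z]) auto
  qed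
next
  fix r d w assume "w \<in> cycles W_module r d" and b: "psi_BE r d w \<in> boundaries barratt_eccles r d"
  then have w: "keys w \<subseteq> W_basis r d" "Bd W_module r d w = 0"
    by (auto simp: cycles_def kernel_def simp del: W_module_simps(2))
  have "coeff_sum w = 0" if d: "d = 0"
  proof -
    obtain y where "keys y \<subseteq> be_basis r 1" "psi_BE r 0 w = be_boundary y"
      using b d by (auto simp: boundaries_def)
    then show ?thesis using coeff_sum_be_boundary[of y r] coeff_sum_psi_BE_0[of r w] by simp
  qed
  then show "w \<in> boundaries W_module r d" by (intro W_module_exact w)
qed

theorem theorem15:
  shows "C_morphism W_module barratt_eccles psi_BE \<and>
    may_steenrod_structure TYPE(be_elem) barratt_eccles psi_BE"
proof -
  have "operad_morphism barratt_eccles barratt_eccles (\<lambda>r d x. x)"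
    by (intro operad_morphism.intro operad_barratt_eccles gamma_morphism.intro
        gamma_module_barratt_eccles gamma_morphism_axioms.intro operad_morphism_axioms.intro)
      (auto simp: hom_def)
  then have "may_steenrod_structure TYPE(be_elem) barratt_eccles psi_BE"
    unfolding may_steenrod_structure_def
    using operad_barratt_eccles psi_BE_morphism psi_BE_quasi_iso E_infinity_barratt_eccles by blast
  then show ?thesis using psi_BE_morphism by blast
qed

end
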